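(* Let $K$ be a field of characteristic $0$, let $V$ be a graded $K$-vector space with distinguished homogeneous basis $\{v_s:s\in S\}$, and let $\{B'_k\in\mathrm{End}(V):k\in\mathbb Z\setminus\{0\}\}$ be graded linear operators on $V$, as described in the context, such that $B'_k$ and $B'_l$ commute whenever $k$ and $l$ have the same sign. Let $b\in S$ be such that $B'_k\cdot v_b=0$ for all $k>0$, and set $F'_s:=F'_{s/b}$, $G'_s:=G'_{s/b}$. Let $\{a_k\in K: k\ne 0\}$ be a sequence of non-zero parameters satisfying $a_k=a_{-k}$, and suppose that $\{G'_s : s\in S\}$ are linearly independent. Then the following are equivalent: (1) The operators $\{B'_k\}$ generate an action of the Heisenberg algebra $H[a_i]$ with parameters $a_i$, i.e. $[B'_k,B'_l]=k\,a_k\,\delta_{k,-l}$ for all $k,l\in\mathbb Z\setminus\{0\}$. (2) The family $\{G'_s\}$ satisfies, for all $k\ge1$ and $s\in S$, $$h_k[a_i]\,G'_s=\sum_{t\in S}\langle U'_k\cdot v_s,v_t\rangle\,G'_t\qquad\text{and}\qquad h_k^\perp G'_s=\sum_{t\in S}\langle D'_k\cdot v_s,v_t\rangle\,G'_t.$$ (3) The families $\{G'_{s/t}\}$ and $\{F'_{s/t}\}$ satisfy $$\sum_{s\in S}F'_s(x_1,x_2,\ldots)\,G'_s(y_1,y_2,\ldots)=\prod_{j,k\ge1}\left(1+h_1\langle a_i\rangle x_jy_k+h_2\langle a_i\rangle(x_jy_k)^2+\cdots\right)$$ and, for all $r,t\in S$, $$\sum_{s\in S}F'_{s/t}(x_1,x_2,\ldots)\,G'_{s/r}(y_1,y_2,\ldots)=\prod_{j,k\ge1}\left(1+h_1\langle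 a_i\rangle x_jy_k+h_2\langle a_i\rangle(x_jy_k)^2+\cdots\right)\sum_{s\in S}F'_{r/s}(x_1,x_2,\ldots)\,G'_{t/s}(y_1,y_2,\ldots)$$ in the completion of $\Lambda_K(X)\otimes\Lambda_K(Y)$.
   Context: Symmetric functions: $\Lambda_K$ is the ring of symmetric functions over $K$; $\Lambda_K(X)$, $\Lambda_K(Y)$ denote it in variables $x_1,x_2,\ldots$ and $y_1,y_2,\ldots$; $h_k$ and $p_k$ are the complete homogeneous and power sum symmetric functions. The Hall inner product on $\Lambda_K$ is the bilinear form with $\langle p_\lambda,p_\mu\rangle=\delta_{\lambda\mu}z_\lambda$, and $h_k^\perp$ is the linear operator adjoint to multiplication by $h_k$. $h_k[a_i]:=\theta(h_k)$, where $\theta$ is the algebra homomorphism into $\Lambda_K$ with $\theta(p_j)=a_jp_j$ ($j\ge1$); $h_k\langle a_i\rangle:=\kappa(h_k)\in K$, where $\kappa:\Lambda_K\to K$ is the $K$-algebra homomorphism with $\kappa(p_j)=a_j$ ($j\ge1$). Partitions: for a partition $\lambda$, $m_i(\lambda)$ is the number of parts equal to $i$, and $z_\lambda=\prod_{i\ge1} i^{m_i(\lambda)}m_i(\lambda)!$. Setting: $V$ and $S$ are $\mathbb Z$-graded, each $v_s$ is homogeneous with $\deg(v_s)=\deg(s)$, each graded component of $V$ is finite-dimensional, and $\deg(B'_k)=-mk$ for some fixed $m\in\mathbb Z\setminus\{0\}$. The inner product $\langle\cdot,\cdot\rangle$ on $V$ is the bilinear form with $\langle v_s,v_{s'}\rangle=\delta_{ss'}$.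 For a partition $\lambda=(\lambda_1,\ldots,\lambda_l)$ put $B'_\lambda=B'_{\lambda_1}\cdots B'_{\lambda_l}$, $B'_{-\lambda}=B'_{-\lambda_1}\cdots B'_{-\lambda_l}$; for $k\ge0$ put $D'_k=\sum_{\lambda\vdash k}z_\lambda^{-1}B'_\lambda$ and $U'_k=\sum_{\lambda\vdash k}z_\lambda^{-1}B'_{-\lambda}$ (so $D'_0=U'_0=1$). For $s,t\in S$, $$F'_{s/t}=\sum_\alpha x^\alpha\langle U'_{\alpha_l}\cdots U'_{\alpha_1}\cdot v_t,v_s\rangle,\qquad G'_{s/t}=\sum_\alpha x^\alpha\langle D'_{\alpha_l}\cdots D'_{\alpha_1}\cdot v_s,v_t\rangle,$$ where $\alpha=(\alpha_1,\alpha_2,\ldots)$ runs over sequences of non-negative integers with finitely many non-zero terms and $x^\alpha=\prod_i x_i^{\alpha_i}$. These are symmetric functions. The Heisenberg algebra $H[a_i]$ is the unital associative $K$-algebra generated by $\{B_k:k\in\mathbb Z\setminus\{0\}\}$ with relations $[B_k,B_l]=k\,a_k\,\delta_{k,-l}$. *)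

theory Defs
  imports Complex_Main "HOL-Library.Poly_Mapping"
begin

text \<open>A monomial is a finitely supported exponent function. The elements of the type below are
  arbitrary formal sums of monomials, with no bound on the degree or on the number of variables.\<close>

typedef (overloaded) ('x, 'k) mps = "UNIV :: (('x \<Rightarrow>\<^sub>0 nat) \<Rightarrow> 'k) set"
  morphisms mps_coeff Abs_mps
  by simp

lemma mps_coeff_Abs [simp]: "mps_coeff (Abs_mps f) = f"
  by (simp add: Abs_mps_inverse)

lemma mps_eqI: "(\<And>w. mps_coeff f w = mps_coeff g w) \<Longrightarrow> f = g"
  by (metis ext mps_coeff_inject)

lemma finite_monomial_splits:
  fixes w :: "'x \<Rightarrow>\<^sub>0 nat"
  shows "finite {(u, v). u + v = w}"
proof -
  let ?A = "{f. \<forall>i. (i \<in> Poly_Mapping.keys w \<longrightarrow> f i \<in> {..\<Sum>j\<in>Poly_Mapping.keys w. Poly_Mapping.lookup w j}) \<and> (i \<notin> Poly_Mapping.keys w \<longrightarrow> f i = (0::nat))}"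
  have fin: "finite ?A"
    by (rule finite_set_of_finite_funs) auto
  have sub: "Poly_Mapping.lookup ` {u. \<exists>v. u + v = w} \<subseteq> ?A"
  proof
    fix f
    assume "f \<in> Poly_Mapping.lookup ` {u. \<exists>v. u + v = w}"
    then obtain u v where f: "f = Poly_Mapping.lookup u" and w: "u + v = w"
      by auto
    have le: "f i \<le> Poly_Mapping.lookup w i" for i
      by (simp add: f w[symmetric] lookup_add)
    have "f i \<le> (\<Sum>j\<in>Poly_Mapping.keys w. Poly_Mapping.lookup w j)"
      if "i \<in> Poly_Mapping.keys w" for i
      by (rule order_trans[OF le], rule member_le_sum) (use that in auto)
    moreover have "f i = 0" if "i \<notin> Poly_Mapping.keys w" for i
      using le[of i] that by (simp add: in_keys_iff)
    ultimately show "f \<in> ?A"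
      by auto
  qed
  have "finite {u. \<exists>v. u + v = w}"
    by (rule finite_imageD[OF finite_subset[OF sub fin]]) (auto simp: inj_on_def lookup_inject)
  then have "finite ((\<lambda>u. (u, w - u)) ` {u. \<exists>v. u + v = w})"
    by simp
  then show ?thesis
    by (rule rev_finite_subset) (auto simp: image_iff)
qed

instantiation mps :: (type, comm_ring_1) comm_ring_1
begin

definition "0 = Abs_mps (\<lambda>_. 0)"
definition "1 = Abs_mps (\<lambda>w. if w = 0 then 1 else 0)"
definition "f + g = Abs_mps (\<lambda>w. mps_coeff f w + mps_coeff g w)"
definition "f - g = Abs_mps (\<lambda>w. mps_coeff f w - mps_coeff g w)"
definition "- f = Abs_mps (\<lambda>w. - mps_coeff f w)"
definition "f * g = Abs_mps (\<lambda>w. \<Sum>(u, v) | u + v = w. mps_coeff f u * mps_coeff g v)"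

instance
proof
  fix f g h :: "('a, 'b) mps"
  show "f + g + h = f + (g + h)" "f + g = g + f" "0 + f = f" "- f + f = 0" "f - g = f + - g"
    by (simp_all add: plus_mps_def minus_mps_def uminus_mps_def zero_mps_def add_ac mps_coeff_inverse)
  show "(0::('a, 'b) mps) \<noteq> 1"
    by (auto simp: zero_mps_def one_mps_def Abs_mps_inject dest: fun_cong[of _ _ 0])
  show "(f + g) * h = f * h + g * h"
    by (simp add: plus_mps_def times_mps_def Abs_mps_inject fun_eq_iff distrib_right
        sum.distrib split_def)
  show "f * g = g * f"
    by (rule mps_eqI, simp add: times_mps_def,
        rule sum.reindex_bij_witness[where i = prod.swap and j = prod.swap])
      (auto simp: add.commute mult.commute)
  show "1 * f = f"
  proof (rule mps_eqI)
    fix w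
    have "mps_coeff (1 * f) w = (\<Sum>(u, v) | u + v = w. if u = 0 then mps_coeff f v else 0)"
      by (auto simp: times_mps_def one_mps_def intro!: sum.cong)
    also have "\<dots> = (\<Sum>(u :: 'a \<Rightarrow>\<^sub>0 nat, v) \<in> {(0, w)}. if u = 0 then mps_coeff f v else 0)"
      by (rule sum.mono_neutral_right) (auto simp: finite_monomial_splits split: if_splits)
    finally show "mps_coeff (1 * f) w = mps_coeff f w"
      by simp
  qed
  show "f * g * h = f * (g * h)"
  proof (rule mps_eqI)
    fix w
    let ?S = "\<lambda>w :: 'a \<Rightarrow>\<^sub>0 nat. {p. fst p + snd p = w}"
    have fin: "finite (?S w)" for w
      using finite_monomial_splits[of w] by (simp add: split_def)
    have m: "mps_coeff (a * b) w = (\<Sum>p\<in>?S w. mps_coeff a (fst p) * mps_coeff b (snd p))"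
      for a b :: "('a, 'b) mps" and w
      by (simp add: times_mps_def split_def)
    have "mps_coeff (f * g * h) w = (\<Sum>p\<in>?S w. \<Sum>q\<in>?S (fst p).
        mps_coeff f (fst q) * mps_coeff g (snd q) * mps_coeff h (snd p))"
      by (simp add: m sum_distrib_right)
    also have "\<dots> = (\<Sum>(p, q)\<in>(SIGMA p:?S w. ?S (fst p)).
        mps_coeff f (fst q) * mps_coeff g (snd q) * mps_coeff h (snd p))"
      by (rule sum.Sigma) (auto simp: fin)
    also have "\<dots> = (\<Sum>(p, q)\<in>(SIGMA p:?S w. ?S (snd p)).
        mps_coeff f (fst p) * (mps_coeff g (fst q) * mps_coeff h (snd q)))"
      by (rule sum.reindex_bij_witness
            [where j = "\<lambda>(p, q). ((fst q, snd q + snd p), (snd q, snd p))"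
               and i = "\<lambda>(p, q). ((fst p + fst q, snd q), (fst p, fst q))"])
        (auto simp: add.assoc mult.assoc)
    also have "\<dots> = (\<Sum>p\<in>?S w. \<Sum>q\<in>?S (snd p).
        mps_coeff f (fst p) * (mps_coeff g (fst q) * mps_coeff h (snd q)))"
      by (rule sum.Sigma[symmetric]) (auto simp: fin)
    also have "\<dots> = mps_coeff (f * (g * h)) w"
      by (simp add: m sum_distrib_left)
    finally show "mps_coeff (f * g * h) w = mps_coeff (f * (g * h)) w" .
  qed
qed

end

definition mps_scale :: "'k \<Rightarrow> ('x, 'k::comm_ring_1) mps \<Rightarrow> ('x, 'k) mps" where
  "mps_scale c f = Abs_mps (\<lambda>w. c * mps_coeff f w)"

interpretation mps: vector_space "mps_scale :: 'k::field \<Rightarrow> ('x, 'k) mps \<Rightarrow> ('x, 'k) mps"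
  by unfold_locales
    (simp_all add: mps_scale_def plus_mps_def algebra_simps mps_coeff_inverse)

definition mps_var :: "'x \<Rightarrow> ('x, 'k::comm_ring_1) mps" where
  "mps_var i = Abs_mps (\<lambda>w. if w = Poly_Mapping.single i 1 then 1 else 0)"

text \<open>Infinite sums and products are taken coefficientwise. They have their intended meaning for
  families in which every monomial occurs in only finitely many summands, respectively for which
  each coefficient of the finite partial products is eventually constant.\<close>

definition mps_sum :: "('i \<Rightarrow> ('x, 'k::comm_ring_1) mps) \<Rightarrow> ('x, 'k) mps" where
  "mps_sum f = Abs_mps (\<lambda>w. Sum_any (\<lambda>i. mps_coeff (f i) w))"

definition mps_prod :: "('i \<Rightarrow> ('x, 'k::comm_ring_1) mps) \<Rightarrow> ('x, 'k) mps" where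
  "mps_prod f = Abs_mps (\<lambda>w. THE c.
     \<forall>\<^sub>F I in finite_subsets_at_top UNIV. mps_coeff (prod f I) w = c)"

text \<open>Substitution of the variable \<open>\<iota> i\<close> for the variable \<open>i\<close>, for injective \<open>\<iota>\<close>.\<close>

definition mps_rename :: "('x \<Rightarrow> 'y) \<Rightarrow> ('x, 'k::comm_ring_1) mps \<Rightarrow> ('y, 'k) mps" where
  "mps_rename \<iota> f = Abs_mps (\<lambda>w.
     if Poly_Mapping.keys w \<subseteq> range \<iota> then mps_coeff f (Poly_Mapping.map_key \<iota> w) else 0)"

definition partitions :: "nat \<Rightarrow> nat list set" where
  "partitions n = {l. sorted_wrt (\<ge>) l \<and> (\<forall>i\<in>set l. i \<ge> 1) \<and> sum_list l = n}"

definition all_partitions :: "nat list set" where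
  "all_partitions = (\<Union>n. partitions n)"

definition z_part :: "nat list \<Rightarrow> nat" where
  "z_part l = (\<Prod>i\<in>set l. i ^ count_list l i * fact (count_list l i))"

definition mdeg :: "('x \<Rightarrow>\<^sub>0 nat) \<Rightarrow> nat" where
  "mdeg w = (\<Sum>i\<in>Poly_Mapping.keys w. Poly_Mapping.lookup w i)"

text \<open>Symmetric functions are symmetric power series of bounded degree. The variable with index \<open>i\<close> plays
  the role of \<open>x\<^bsub>i+1\<^esub>\<close>.\<close>

definition Sym :: "(nat, 'k::comm_ring_1) mps set" where
  "Sym = {f. (\<exists>d. \<forall>w. mps_coeff f w \<noteq> 0 \<longrightarrow> mdeg w \<le> d) \<and>
             (\<forall>\<pi> w. bij \<pi> \<longrightarrow> mps_coeff f (Poly_Mapping.map_key \<pi> w) = mps_coeff f w)}"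

definition sym_h :: "nat \<Rightarrow> (nat, 'k::comm_ring_1) mps" where
  "sym_h k = Abs_mps (\<lambda>w. if mdeg w = k then 1 else 0)"

definition sym_p :: "nat \<Rightarrow> (nat, 'k::comm_ring_1) mps" where
  "sym_p k = mps_sum (\<lambda>i. mps_var i ^ k)"

definition sym_p_part :: "nat list \<Rightarrow> (nat, 'k::comm_ring_1) mps" where
  "sym_p_part l = prod_list (map sym_p l)"

definition sym_bilinear :: "((nat, 'k::comm_ring_1) mps \<Rightarrow> (nat, 'k) mps \<Rightarrow> 'k) \<Rightarrow> bool" where
  "sym_bilinear H \<longleftrightarrow> (\<forall>f\<in>Sym. \<forall>g\<in>Sym. \<forall>h\<in>Sym. \<forall>c.
     H (f + g) h = H f h + H g h \<and> H f (g + h) = H f g + H f h \<and>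
     H (mps_scale c f) h = c * H f h \<and> H f (mps_scale c h) = c * H f h)"

text \<open>The maps chosen by \<open>SOME\<close> below are unique on \<^const>\<open>Sym\<close>, because over a field of
  characteristic 0 the power sums are algebraically independent generators of the ring of
  symmetric functions. Their values elsewhere are never used.\<close>

definition hall :: "(nat, 'k::field_char_0) mps \<Rightarrow> (nat, 'k) mps \<Rightarrow> 'k" where
  "hall = (SOME H. sym_bilinear H \<and> (\<forall>l\<in>all_partitions. \<forall>m\<in>all_partitions.
     H (sym_p_part l) (sym_p_part m) = (if l = m then of_nat (z_part l) else 0)))"

definition sym_h_perp :: "nat \<Rightarrow> (nat, 'k::field_char_0) mps \<Rightarrow> (nat, 'k) mps" where
  "sym_h_perp k = (SOME T.
     (\<forall>f\<in>Sym. T f \<in> Sym) \<and>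
     (\<forall>f\<in>Sym. \<forall>g\<in>Sym. \<forall>c. T (f + g) = T f + T g \<and> T (mps_scale c f) = mps_scale c (T f)) \<and>
     (\<forall>f\<in>Sym. \<forall>g\<in>Sym. hall (T f) g = hall f (sym_h k * g)))"

definition sym_alg_hom ::
  "('k \<Rightarrow> 'b \<Rightarrow> 'b) \<Rightarrow> ((nat, 'k::comm_ring_1) mps \<Rightarrow> 'b::comm_ring_1) \<Rightarrow> bool" where
  "sym_alg_hom sc \<phi> \<longleftrightarrow> \<phi> 1 = 1 \<and> (\<forall>f\<in>Sym. \<forall>g\<in>Sym. \<forall>c.
     \<phi> (f + g) = \<phi> f + \<phi> g \<and> \<phi> (f * g) = \<phi> f * \<phi> g \<and> \<phi> (mps_scale c f) = sc c (\<phi> f))"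

definition sym_theta :: "(int \<Rightarrow> 'k) \<Rightarrow> (nat, 'k::field_char_0) mps \<Rightarrow> (nat, 'k) mps" where
  "sym_theta a = (SOME \<theta>. sym_alg_hom mps_scale \<theta> \<and> (\<forall>f\<in>Sym. \<theta> f \<in> Sym) \<and>
     (\<forall>j\<ge>1. \<theta> (sym_p j) = mps_scale (a (int j)) (sym_p j)))"

definition sym_kappa :: "(int \<Rightarrow> 'k) \<Rightarrow> (nat, 'k::field_char_0) mps \<Rightarrow> 'k" where
  "sym_kappa a = (SOME \<kappa>. sym_alg_hom (*) \<kappa> \<and> (\<forall>j\<ge>1. \<kappa> (sym_p j) = a (int j)))"

text \<open>Usual notation: \<open>h_bracket a k\<close> is \<open>h\<^sub>k[a\<^sub>i]\<close>, and \<open>h_angle a k\<close> is \<open>h\<^sub>k\<langle>a\<^sub>i\<rangle>\<close>.\<close>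

definition h_bracket :: "(int \<Rightarrow> 'k) \<Rightarrow> nat \<Rightarrow> (nat, 'k::field_char_0) mps" where
  "h_bracket a k = sym_theta a (sym_h k)"

definition h_angle :: "(int \<Rightarrow> 'k) \<Rightarrow> nat \<Rightarrow> 'k::field_char_0" where
  "h_angle a k = sym_kappa a (sym_h k)"

text \<open>The completion of \<open>\<Lambda>(X) \<otimes> \<Lambda>(Y)\<close> is viewed inside the power series in the disjoint union of
  the two alphabets, \<open>Inl\<close> indexing \<open>X\<close> and \<open>Inr\<close> indexing \<open>Y\<close>. The summand for \<open>n = 0\<close> is 1.\<close>

abbreviation in_X :: "(nat, 'k::comm_ring_1) mps \<Rightarrow> (nat + nat, 'k) mps" where
  "in_X \<equiv> mps_rename Inl"

abbreviation in_Y :: "(nat, 'k::comm_ring_1) mps \<Rightarrow> (nat + nat, 'k) mps" where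
  "in_Y \<equiv> mps_rename Inr"

definition cauchy_kernel :: "(int \<Rightarrow> 'k) \<Rightarrow> (nat + nat, 'k::field_char_0) mps" where
  "cauchy_kernel a = mps_prod (\<lambda>(j, k).
     mps_sum (\<lambda>n. mps_scale (h_angle a n) ((mps_var (Inl j) * mps_var (Inr k)) ^ n)))"

definition graded_vector_space :: "('k::field \<Rightarrow> 'v::ab_group_add \<Rightarrow> 'v) \<Rightarrow> (int \<Rightarrow> 'v set) \<Rightarrow> bool" where
  "graded_vector_space scale V \<longleftrightarrow> vector_space scale \<and>
     (\<forall>n. module.subspace scale (V n)) \<and>
     (\<forall>x. \<exists>!c. (\<forall>n. c n \<in> V n) \<and> finite {n. c n \<noteq> 0} \<and> x = (\<Sum>n | c n \<noteq> 0. c n))"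

definition graded_components_finite_dim ::
  "('k::field \<Rightarrow> 'v::ab_group_add \<Rightarrow> 'v) \<Rightarrow> (int \<Rightarrow> 'v set) \<Rightarrow> bool" where
  "graded_components_finite_dim scale V \<longleftrightarrow>
     (\<forall>n. \<exists>A. finite A \<and> module.span scale A = V n)"

definition homogeneous_basis ::
  "('k::field \<Rightarrow> 'v::ab_group_add \<Rightarrow> 'v) \<Rightarrow> (int \<Rightarrow> 'v set) \<Rightarrow> ('s \<Rightarrow> int) \<Rightarrow> ('s \<Rightarrow> 'v) \<Rightarrow> bool" where
  "homogeneous_basis scale V deg v \<longleftrightarrow>
     inj v \<and> \<not> module.dependent scale (range v) \<and> module.span scale (range v) = UNIV \<and>
     (\<forall>s. v s \<in> V (deg s))"

definition graded_operator ::
  "('k::field \<Rightarrow> 'v::ab_group_add \<Rightarrow> 'v) \<Rightarrow> (int \<Rightarrow> 'v set) \<Rightarrow> int \<Rightarrow> ('v \<Rightarrow> 'v) \<Rightarrow> bool" where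
  "graded_operator scale V d T \<longleftrightarrow>
     Vector_Spaces.linear scale scale T \<and> (\<forall>n. T ` V n \<subseteq> V (n + d))"

definition orthonormal_form ::
  "('k::field \<Rightarrow> 'v::ab_group_add \<Rightarrow> 'v) \<Rightarrow> ('s \<Rightarrow> 'v) \<Rightarrow> ('v \<Rightarrow> 'v \<Rightarrow> 'k) \<Rightarrow> bool" where
  "orthonormal_form scale v ip \<longleftrightarrow>
     (\<forall>x. Vector_Spaces.linear scale (*) (ip x)) \<and>
     (\<forall>y. Vector_Spaces.linear scale (*) (\<lambda>x. ip x y)) \<and>
     (\<forall>s t. ip (v s) (v t) = (if s = t then 1 else 0))"

definition D_op ::
  "('k::field_char_0 \<Rightarrow> 'v::ab_group_add \<Rightarrow> 'v) \<Rightarrow> (int \<Rightarrow> 'v \<Rightarrow> 'v) \<Rightarrow> nat \<Rightarrow> 'v \<Rightarrow> 'v" where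
  "D_op scale B k x = (\<Sum>l\<in>partitions k.
     scale (inverse (of_nat (z_part l))) (foldr (\<lambda>i. B (int i)) l x))"

definition U_op ::
  "('k::field_char_0 \<Rightarrow> 'v::ab_group_add \<Rightarrow> 'v) \<Rightarrow> (int \<Rightarrow> 'v \<Rightarrow> 'v) \<Rightarrow> nat \<Rightarrow> 'v \<Rightarrow> 'v" where
  "U_op scale B k x = (\<Sum>l\<in>partitions k.
     scale (inverse (of_nat (z_part l))) (foldr (\<lambda>i. B (- int i)) l x))"

text \<open>\<open>apply_word T \<alpha> = \<cdots> \<circ> T (\<alpha> 1) \<circ> T (\<alpha> 0)\<close>. All exponents at positions from
  \<^term>\<open>Poly_Mapping.degree \<alpha>\<close> on vanish, and the operators it is used with have \<open>T 0 = id\<close>.\<close>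

definition apply_word :: "(nat \<Rightarrow> 'v \<Rightarrow> 'v) \<Rightarrow> (nat \<Rightarrow>\<^sub>0 nat) \<Rightarrow> 'v \<Rightarrow> 'v" where
  "apply_word T \<alpha> = fold (\<lambda>i. T (Poly_Mapping.lookup \<alpha> i)) [0..<Poly_Mapping.degree \<alpha>]"

definition F_skew ::
  "('k::field_char_0 \<Rightarrow> 'v::ab_group_add \<Rightarrow> 'v) \<Rightarrow> ('v \<Rightarrow> 'v \<Rightarrow> 'k) \<Rightarrow> ('s \<Rightarrow> 'v) \<Rightarrow> (int \<Rightarrow> 'v \<Rightarrow> 'v) \<Rightarrow>
   's \<Rightarrow> 's \<Rightarrow> (nat, 'k) mps" where
  "F_skew scale ip v B s t = Abs_mps (\<lambda>\<alpha>. ip (apply_word (U_op scale B) \<alpha> (v t)) (v s))"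

definition G_skew ::
  "('k::field_char_0 \<Rightarrow> 'v::ab_group_add \<Rightarrow> 'v) \<Rightarrow> ('v \<Rightarrow> 'v \<Rightarrow> 'k) \<Rightarrow> ('s \<Rightarrow> 'v) \<Rightarrow> (int \<Rightarrow> 'v \<Rightarrow> 'v) \<Rightarrow>
   's \<Rightarrow> 's \<Rightarrow> (nat, 'k) mps" where
  "G_skew scale ip v B s t = Abs_mps (\<lambda>\<alpha>. ip (apply_word (D_op scale B) \<alpha> (v s)) (v t))"

definition heisenberg_action ::
  "('k::field \<Rightarrow> 'v::ab_group_add \<Rightarrow> 'v) \<Rightarrow> (int \<Rightarrow> 'k) \<Rightarrow> (int \<Rightarrow> 'v \<Rightarrow> 'v) \<Rightarrow> bool" where
  "heisenberg_action scale a B \<longleftrightarrow> (\<forall>k l x. k \<noteq> 0 \<longrightarrow> l \<noteq> 0 \<longrightarrow>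
     B k (B l x) - B l (B k x) = scale (if k = - l then of_int k * a k else 0) x)"

end

theory Submission
  imports Defs "HOL-Combinatorics.Permutations"
begin

text \<open>Write \<open>D(y) = \<Sum>\<^sub>k D'\<^sub>k y\<^sup>k\<close>, \<open>U(x) = \<Sum>\<^sub>k U'\<^sub>k x\<^sup>k\<close> and \<open>\<eta>\<^sub>n = h\<^sub>n\<langle>a\<^sub>i\<rangle>\<close>. Newton's
  identity \<open>k D'\<^sub>k = \<Sum>\<^sub>i B'\<^sub>i D'\<^bsub>k-i\<^esub>\<close> (and its analogues for \<open>U'\<close> and \<open>\<eta>\<close>) shows by induction that the Heisenberg
  relations are equivalent to \<open>D(y) U(x) = (\<Sum>\<^sub>n \<eta>\<^sub>n (xy)\<^sup>n) U(x) D(y)\<close>. The matrix coefficients of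
  this identity, iterated over all variables, are the skew Cauchy identities in (3).

  For (2), the linear map \<open>G\<close> with \<open>G(v\<^sub>s) = G'\<^sub>s\<close> is injective by linear independence. The operator
  \<open>h\<^sub>k\<^sup>\<perp>\<close> extracts the coefficient of the \<open>k\<close>-th power of the first variable, so that always
  \<open>G(D'\<^sub>k x) = h\<^sub>k\<^sup>\<perp> G(x)\<close>, and it satisfies the same commutation rule with multiplication by
  \<open>h\<^sub>l[a\<^sub>i]\<close> as \<open>D'\<^sub>k\<close> does with \<open>U'\<^sub>l\<close>. Conversely, \<open>G(U'\<^sub>k x) = h\<^sub>k[a\<^sub>i] G(x)\<close> follows from the
  commutation rule because no \<open>v\<^sub>s\<close> has lower degree than \<open>v\<^sub>b\<close>.\<close>

text \<open>The homomorphisms, the Hall form and \<open>h_k^\<perp>\<close> are given as choices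
  from a specification, so each needs a witness, and \<open>h_k^\<perp>\<close> needs uniqueness as
  well. Everything of this kind rests on one fact: the products of power sums form a basis of
  \<open>Sym\<close>. Newton's identity stands in for the exponentials
  \<open>exp (\<Sum> B'_k y^k / k)\<close>. Its advantage is that it can be run backwards: in the
  identity of index \<open>k\<close> the summand \<open>i = k\<close> is \<open>B'_k\<close>
  followed by nothing, since \<open>D'_0 = 1\<close>, so agreement at all smaller indices isolates
  \<open>B'_k\<close>. The equivalence passes through a half-step in which a single
  \<open>B'_j\<close> is commuted with \<open>U(x)\<close>. Infinitely many variables are handled
  one at a time. Every monomial arises from 1 by finitely many insertions of a new first variable,
  and for words of operators such an insertion applies one more operator to the starting vector.
  With two alphabets, the coefficient of each \<open>x\<close>-monomial is compared as a series in
  \<open>y\<close>; the sums over \<open>S\<close> then collapse to expansions in the orthonormal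
  basis.\<close>

abbreviation (input) lookup where "lookup \<equiv> Poly_Mapping.lookup"
abbreviation (input) keys where "keys \<equiv> Poly_Mapping.keys"
abbreviation (input) single where "single \<equiv> Poly_Mapping.single"

section \<open>Coefficients of formal power series\<close>

lemma mps_coeff_zero [simp]: "mps_coeff 0 w = 0"
  by (simp add: zero_mps_def)

lemma mps_coeff_one: "mps_coeff 1 w = (if w = 0 then 1 else 0)"
  by (simp add: one_mps_def)

lemma mps_coeff_add [simp]: "mps_coeff (f + g) w = mps_coeff f w + mps_coeff g w"
  by (simp add: plus_mps_def)

lemma mps_coeff_diff [simp]: "mps_coeff (f - g) w = mps_coeff f w - mps_coeff g w"
  by (simp add: minus_mps_def)

lemma mps_coeff_scale [simp]: "mps_coeff (mps_scale c f) w = c * mps_coeff f w"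
  by (simp add: mps_scale_def)

lemma mps_coeff_sum [simp]: "mps_coeff (sum f A) w = (\<Sum>i\<in>A. mps_coeff (f i) w)"
  by (induction A rule: infinite_finite_induct) simp_all

lemma mps_coeff_times:
  "mps_coeff (f * g) w = (\<Sum>p\<in>{p. fst p + snd p = w}. mps_coeff f (fst p) * mps_coeff g (snd p))"
  by (simp add: times_mps_def split_def)

lemma finite_splits [simp, intro]: "finite {p. fst p + snd p = (w :: 'x \<Rightarrow>\<^sub>0 nat)}"
  using finite_monomial_splits[of w] by (simp add: split_def)

lemma mps_coeff_mps_sum: "mps_coeff (mps_sum f) w = Sum_any (\<lambda>i. mps_coeff (f i) w)"
  by (simp add: mps_sum_def)

lemma mps_scale_mult_left: "mps_scale c f * g = mps_scale c (f * g)"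
  by (rule mps_eqI) (simp add: mps_coeff_times sum_distrib_left mult.assoc)

lemma mps_scale_mult_right: "f * mps_scale c g = mps_scale c (f * g)"
  by (metis mps_scale_mult_left mult.commute)

lemma mps_coeff_0_times:
  fixes f g :: "('x, 'k::comm_ring_1) mps"
  shows "mps_coeff (f * g) 0 = mps_coeff f 0 * mps_coeff g 0"
proof -
  have "{p. fst p + snd p = (0 :: 'x \<Rightarrow>\<^sub>0 nat)} = {(0, 0)}"
    by (auto simp: poly_mapping_eq_iff fun_eq_iff lookup_add)
  then show ?thesis
    by (simp add: mps_coeff_times)
qed

definition mps_monom :: "('x \<Rightarrow>\<^sub>0 nat) \<Rightarrow> ('x, 'k::comm_ring_1) mps" where
  "mps_monom u = Abs_mps (\<lambda>w. if w = u then 1 else 0)"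

lemma mps_coeff_monom: "mps_coeff (mps_monom u) w = (if w = u then 1 else 0)"
  by (simp add: mps_monom_def)

lemma mps_var_eq_monom: "mps_var i = mps_monom (single i 1)"
  by (simp add: mps_var_def mps_monom_def)

lemma mps_monom_mult: "mps_monom u * mps_monom v = mps_monom (u + v)"
proof (rule mps_eqI)
  fix w
  have "mps_coeff (mps_monom u * mps_monom v) w
    = (\<Sum>p\<in>{p. fst p + snd p = w}. if p = (u, v) then 1 else 0)"
    unfolding mps_coeff_times by (rule sum.cong) (auto simp: mps_coeff_monom prod_eq_iff)
  also have "\<dots> = mps_coeff (mps_monom (u + v)) w"
    by (subst sum.delta) (auto simp: mps_coeff_monom)
  finally show "mps_coeff (mps_monom u * mps_monom v) w = mps_coeff (mps_monom (u + v)) w" .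
qed

lemma mps_monom_0: "mps_monom 0 = 1"
  by (rule mps_eqI) (simp add: mps_coeff_monom mps_coeff_one)

lemma mps_var_power: "mps_var i ^ n = mps_monom (single i n)"
  by (induction n) (simp_all add: mps_var_eq_monom mps_monom_mult mps_monom_0 single_add[symmetric])

lemma mps_var_mult_power:
  "(mps_var i * mps_var j) ^ n = mps_monom (single i n + single j n)"
  by (simp add: power_mult_distrib mps_var_power mps_monom_mult)

lemma pm_add_diff: "(u :: 'x \<Rightarrow>\<^sub>0 nat) + v - u = v"
  by (simp add: poly_mapping_eq_iff fun_eq_iff lookup_add lookup_minus)

lemma pm_single_add_diff:
  "n \<le> lookup w i \<Longrightarrow> single i n + (w - single i n) = w"
  for w :: "'x \<Rightarrow>\<^sub>0 nat"
  by (auto simp: poly_mapping_eq_iff fun_eq_iff lookup_add lookup_minus lookup_single when_def)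

section \<open>Symmetric functions\<close>

lemma mdeg_superset:
  assumes "finite A" "keys w \<subseteq> A"
  shows "mdeg w = (\<Sum>i\<in>A. lookup w i)"
  unfolding mdeg_def by (rule sum.mono_neutral_left) (use assms in \<open>auto simp: in_keys_iff\<close>)

lemma mdeg_add: "mdeg (u + v) = mdeg u + mdeg v"
proof -
  let ?A = "keys u \<union> keys v"
  have "keys (u + v) \<subseteq> ?A"
    by (rule Poly_Mapping.keys_add)
  then show ?thesis
    by (simp add: mdeg_superset[of ?A] sum.distrib lookup_add)
qed

lemma mdeg_single [simp]: "mdeg (single i n) = n"
  by (simp add: mdeg_def)

lemma mdeg_0 [simp]: "mdeg 0 = 0"
  by (simp add: mdeg_def)

lemma mdeg_eq_0_iff [simp]: "mdeg w = 0 \<longleftrightarrow> w = 0"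
  by (auto simp: mdeg_def in_keys_iff poly_mapping_eq_iff fun_eq_iff)

lemma mdeg_diff_single:
  "n \<le> lookup w i \<Longrightarrow> mdeg (w - single i n) = mdeg w - n"
  by (metis mdeg_add mdeg_single pm_single_add_diff diff_add_inverse)

text \<open>The nonzero exponents with multiplicity, that is, the partition attached to a monomial.
  It is a complete invariant under bijections of the variables, so symmetry of a series becomes
  dependence on \<open>vals\<close> alone.\<close>

definition vals :: "('x \<Rightarrow>\<^sub>0 nat) \<Rightarrow> nat multiset" where
  "vals w = image_mset (lookup w) (mset_set (keys w))"

lemma sum_mset_vals: "sum_mset (vals w) = mdeg w"
  by (simp add: vals_def mdeg_def sum_unfold_sum_mset)

lemma size_vals: "size (vals w) = card (keys w)"
  by (simp add: vals_def)

lemma vals_pos: "0 \<notin># vals w"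
  by (auto simp: vals_def in_keys_iff)

lemma map_key_bij_keys:
  assumes "bij \<pi>"
  shows "keys (Poly_Mapping.map_key \<pi> w) = inv \<pi> ` keys w"
    and "lookup (Poly_Mapping.map_key \<pi> w) i = lookup w (\<pi> i)"
  using assms by (auto simp: keys_map_key bij_vimage_eq_inv_image bij_is_inj map_key.rep_eq)

lemma vals_map_key:
  assumes "bij \<pi>"
  shows "vals (Poly_Mapping.map_key \<pi> w) = vals w"
proof -
  have "inj_on (inv \<pi>) (keys w)"
    using assms by (metis bij_imp_bij_inv bij_is_inj inj_on_subset subset_UNIV)
  then have "mset_set (inv \<pi> ` keys w) = image_mset (inv \<pi>) (mset_set (keys w))"
    by (simp add: image_mset_mset_set)
  then show ?thesis
    using assms by (simp add: vals_def map_key_bij_keys multiset.map_comp comp_def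
        surj_f_inv_f[OF bij_is_surj])
qed

text \<open>On the finite union of the two supports both exponent functions take the same values
  with multiplicity once zeros are counted too, so a permutation of that union matches them; outside
  it both vanish.\<close>

lemma vals_eq_imp_map_key:
  fixes w w' :: "'x \<Rightarrow>\<^sub>0 nat"
  assumes "vals w = vals w'"
  obtains \<pi> where "bij \<pi>" "w = Poly_Mapping.map_key \<pi> w'"
proof -
  let ?A = "keys w \<union> keys w'"
  have img: "image_mset (lookup u) (mset_set ?A)
      = vals u + replicate_mset (card ?A - size (vals u)) 0"
    if "keys u \<subseteq> ?A" for u :: "'x \<Rightarrow>\<^sub>0 nat"
  proof -
    have A: "?A = keys u \<union> (?A - keys u)"
      using that by auto
    have "mset_set ?A = mset_set (keys u) + mset_set (?A - keys u)"
      by (subst A, subst mset_set_Union) auto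
    moreover have "image_mset (lookup u) (mset_set (?A - keys u))
      = image_mset (\<lambda>_. 0) (mset_set (?A - keys u))"
      by (rule image_mset_cong) (auto simp: in_keys_iff)
    moreover have "card (?A - keys u) = card ?A - size (vals u)"
      using that by (simp add: card_Diff_subset size_vals)
    ultimately show ?thesis
      by (simp add: vals_def image_mset_const_eq)
  qed
  have "image_mset (lookup w) (mset_set ?A) = image_mset (lookup w') (mset_set ?A)"
    using img[of w] img[of w'] assms by simp
  then obtain \<pi> where \<pi>: "\<pi> permutes ?A"
    "\<forall>x\<in>?A. lookup w x = lookup w' (\<pi> x)"
    by (rule image_mset_eq_implies_permutes[rotated]) auto
  have bij: "bij \<pi>"
    using \<pi>(1) by (rule permutes_bij)
  have "lookup w x = lookup w' (\<pi> x)" for x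
  proof (cases "x \<in> ?A")
    case False
    then have "\<pi> x = x"
      using \<pi>(1) by (simp add: permutes_not_in)
    with False show ?thesis
      by (simp add: in_keys_iff)
  qed (use \<pi>(2) in auto)
  then have "w = Poly_Mapping.map_key \<pi> w'"
    using bij by (intro poly_mapping_eqI) (simp add: map_key_bij_keys)
  with bij show ?thesis
    by (rule that)
qed

lemma ex_vals:
  assumes "0 \<notin># M"
  shows "\<exists>w :: nat \<Rightarrow>\<^sub>0 nat. vals w = M"
  using assms
proof (induction M)
  case empty
  then show ?case
    by (intro exI[of _ 0]) (simp add: vals_def)
next
  case (add k M)
  then obtain w :: "nat \<Rightarrow>\<^sub>0 nat" where w: "vals w = M"
    by auto
  obtain i where i: "i \<notin> keys w"
    using ex_new_if_finite[OF infinite_UNIV_nat finite_keys] by blast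
  have keys: "keys (w + single i k) = insert i (keys w)"
    using add.prems i by (auto simp: in_keys_iff lookup_add lookup_single when_def split: if_splits)
  have "vals (w + single i k) = add_mset k (vals w)"
    using i unfolding vals_def keys
    by (auto simp: lookup_add lookup_single when_def in_keys_iff intro!: image_mset_cong)
  with w show ?case
    by auto
qed

lemma Sym_iff:
  "f \<in> Sym \<longleftrightarrow> (\<exists>d. \<forall>w. mps_coeff f w \<noteq> 0 \<longrightarrow> mdeg w \<le> d) \<and>
     (\<forall>w w'. vals w = vals w' \<longrightarrow> mps_coeff f w = mps_coeff f w')"
proof -
  have "(\<forall>\<pi> w. bij \<pi> \<longrightarrow> mps_coeff f (Poly_Mapping.map_key \<pi> w) = mps_coeff f w)
    \<longleftrightarrow> (\<forall>w w'. vals w = vals w' \<longrightarrow> mps_coeff f w = mps_coeff f w')"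
    by (metis vals_eq_imp_map_key vals_map_key)
  then show ?thesis
    by (simp add: Sym_def)
qed

section \<open>Power sums and their products\<close>

lemma single_inject: "single i k = single j k \<Longrightarrow> k \<noteq> 0 \<Longrightarrow> i = j"
  by (metis lookup_single_eq lookup_single_not_eq)

lemma mps_coeff_sym_p:
  assumes "k \<ge> 1"
  shows "mps_coeff (sym_p k) w = (if \<exists>i. w = single i k then 1 else 0)"
proof (cases "\<exists>i. w = single i k")
  case True
  then obtain i where i: "w = single i k"
    by auto
  have "mps_coeff (sym_p k) w = Sum_any (\<lambda>j. if j = i then 1 else 0)"
    unfolding sym_p_def mps_coeff_mps_sum mps_var_power mps_coeff_monom i
    by (rule Sum_any.cong) (metis assms not_one_le_zero lookup_single_eq lookup_single_not_eq)
  then show ?thesis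
    using True by simp
qed (simp add: sym_p_def mps_coeff_mps_sum mps_var_power mps_coeff_monom)

text \<open>A split of \<open>w\<close> contributes only when its first half is a pure power
  \<open>single i k\<close>, and such a split is determined by \<open>i\<close>. Since
  \<open>k \<ge> 1\<close>, only finitely many \<open>i\<close> occur.\<close>

lemma mps_coeff_sym_p_times:
  assumes "k \<ge> 1"
  shows "mps_coeff (sym_p k * f) w
    = (\<Sum>i | k \<le> lookup w i. mps_coeff f (w - single i k))"
proof -
  let ?I = "{i. k \<le> lookup w i}"
  let ?g = "\<lambda>i. (single i k, w - single i k)"
  have inj: "inj_on ?g ?I"
    using assms by (auto intro!: inj_onI dest!: single_inject)
  have "mps_coeff (sym_p k * f) w
      = (\<Sum>p\<in>?g ` ?I. mps_coeff (sym_p k) (fst p) * mps_coeff f (snd p))"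
    unfolding mps_coeff_times
  proof (rule sum.mono_neutral_right)
    show "?g ` ?I \<subseteq> {p. fst p + snd p = w}"
      by (auto simp: pm_single_add_diff)
    show "\<forall>p\<in>{p. fst p + snd p = w} - ?g ` ?I. mps_coeff (sym_p k) (fst p) * mps_coeff f (snd p) = 0"
    proof
      fix p assume p: "p \<in> {p. fst p + snd p = w} - ?g ` ?I"
      have "\<nexists>i. fst p = single i k"
      proof
        assume "\<exists>i. fst p = single i k"
        then obtain i where i: "fst p = single i k" by auto
        then have w: "w = single i k + snd p"
          using p by auto
        then have "i \<in> ?I" "p = ?g i"
          using i by (auto simp: lookup_add prod_eq_iff pm_add_diff)
        then show False
          using p by blast
      qed
      then show "mps_coeff (sym_p k) (fst p) * mps_coeff f (snd p) = 0"
        using assms by (simp add: mps_coeff_sym_p)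
    qed
  qed auto
  also have "\<dots> = (\<Sum>i\<in>?I. mps_coeff f (w - single i k))"
    by (subst sum.reindex[OF inj]) (use assms in \<open>auto simp: mps_coeff_sym_p intro!: sum.cong\<close>)
  finally show ?thesis .
qed

lemma finite_lookup_ge:
  "k \<ge> 1 \<Longrightarrow> finite {i. k \<le> lookup w i}" for w :: "'x \<Rightarrow>\<^sub>0 nat"
  by (rule finite_subset[OF _ finite_keys[of w]]) (auto simp: in_keys_iff)

text \<open>Multisets as indices, in place of sorted lists, turn products into unions and allow
  induction by adding one part.\<close>

definition sym_pm :: "nat multiset \<Rightarrow> (nat, 'k::comm_ring_1) mps" where
  "sym_pm M = prod_mset (image_mset sym_p M)"

lemma sym_pm_empty [simp]: "sym_pm {#} = 1"
  by (simp add: sym_pm_def)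

lemma sym_pm_add_mset: "sym_pm (add_mset k M) = sym_p k * sym_pm M"
  by (simp add: sym_pm_def)

lemma sym_pm_union: "sym_pm (M + N) = sym_pm M * sym_pm N"
  by (simp add: sym_pm_def)

lemma sym_p_part_eq: "sym_p_part l = sym_pm (mset l)"
  by (simp add: sym_p_part_def sym_pm_def mset_map[symmetric] prod_mset_prod_list del: mset_map)

lemma vals_diff_single:
  assumes "lookup w i = k" "k \<ge> 1"
  shows "vals w = add_mset k (vals (w - single i k))"
proof -
  have keys: "keys (w - single i k) = keys w - {i}"
    using assms by (auto simp: in_keys_iff lookup_minus lookup_single when_def split: if_splits)
  have i: "i \<in> keys w"
    using assms by (simp add: in_keys_iff)
  have "mset_set (keys w) = add_mset i (mset_set (keys w - {i}))"
    by (rule mset_set.remove[OF finite_keys i])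
  then show ?thesis
    using assms unfolding vals_def keys
    by (auto simp: lookup_minus lookup_single when_def intro!: image_mset_cong)
qed

text \<open>\<open>p\<^bsub>M\<^esub>\<close> is triangular with respect to the monomial symmetric functions, ordered by length.\<close>

lemma sym_pm_triangular:
  assumes "0 \<notin># M"
  shows "\<exists>n. mps_coeff (sym_pm M :: (nat, 'k::field_char_0) mps) w = of_nat n \<and>
    (n \<noteq> 0 \<longrightarrow> card (keys w) \<le> size M \<and> mdeg w = sum_mset M \<and>
       (card (keys w) = size M \<longrightarrow> vals w = M)) \<and>
    (vals w = M \<longrightarrow> n \<noteq> 0)"
  using assms
proof (induction M arbitrary: w)
  case empty
  then show ?case
    by (intro exI[of _ "if w = 0 then 1 else 0"])
      (auto simp: mps_coeff_one vals_def mset_set_empty_iff)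
next
  case (add k M)
  then have k: "k \<ge> 1" and M: "0 \<notin># M"
    by (auto simp: not_less_eq_eq[symmetric] Suc_le_eq intro: gr0I)
  from add.IH[OF M] obtain c where c: "\<And>w. mps_coeff (sym_pm M :: (nat, 'k) mps) w = of_nat (c w)"
    and c1: "\<And>w. c w \<noteq> 0 \<Longrightarrow> card (keys w) \<le> size M"
    and c2: "\<And>w. c w \<noteq> 0 \<Longrightarrow> mdeg w = sum_mset M"
    and c3: "\<And>w. c w \<noteq> 0 \<Longrightarrow> card (keys w) = size M \<Longrightarrow> vals w = M"
    and c4: "\<And>w. vals w = M \<Longrightarrow> c w \<noteq> 0"
    by metis
  let ?I = "{i. k \<le> lookup w i}"
  let ?w = "\<lambda>i. w - single i k"
  let ?n = "\<Sum>i\<in>?I. c (?w i)"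
  have fin: "finite ?I"
    using k by (rule finite_lookup_ge)
  show ?case
  proof (intro exI[of _ ?n] conjI impI)
    show "mps_coeff (sym_pm (add_mset k M) :: (nat, 'k) mps) w = of_nat ?n"
      using k by (simp add: sym_pm_add_mset mps_coeff_sym_p_times c)
  next
    assume "?n \<noteq> 0"
    then obtain i where i: "k \<le> lookup w i" "c (?w i) \<noteq> 0"
      using fin by auto
    have sub: "keys w \<subseteq> insert i (keys (?w i))"
      by (auto simp: in_keys_iff lookup_minus lookup_single when_def split: if_splits)
    then have card: "card (keys w) \<le> card (insert i (keys (?w i)))"
      by (intro card_mono) auto
    also have "\<dots> \<le> Suc (card (keys (?w i)))"
      by (rule card_insert_le_m1) auto
    also have "\<dots> \<le> Suc (size M)"
      using c1 i by simp
    finally show "card (keys w) \<le> size (add_mset k M)"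
      by simp
    have "w = single i k + ?w i"
      using i by (simp add: pm_single_add_diff)
    then have "mdeg w = k + mdeg (?w i)"
      by (metis mdeg_add mdeg_single)
    then show "mdeg w = sum_mset (add_mset k M)"
      using c2[OF i(2)] by simp
    show "vals w = add_mset k M" if eq: "card (keys w) = size (add_mset k M)"
    proof -
      \<comment> \<open>Equality of lengths leaves no slack: removing \<open>k\<close> must delete
        \<open>i\<close> from the support, so the exponent of \<open>i\<close> was exactly
        \<open>k\<close>.\<close>
      have i': "i \<notin> keys (?w i)"
        using card eq c1[OF i(2)] by (auto simp: insert_absorb)
      then have "lookup w i = k"
        using i by (simp add: in_keys_iff lookup_minus)
      moreover have "card (keys (?w i)) = size M"
        using card eq c1[OF i(2)] i' by simp
      ultimately show ?thesis
        using vals_diff_single k c3 i(2) by metis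
    qed
  next
    assume v: "vals w = add_mset k M"
    then have "k \<in># vals w"
      by simp
    then obtain i where i: "lookup w i = k"
      by (auto simp: vals_def)
    then have "vals (?w i) = M"
      using vals_diff_single[OF i k] v by simp
    then have "c (?w i) \<noteq> 0"
      by (rule c4)
    then show "?n \<noteq> 0"
      using i fin by auto
  qed
qed

section \<open>Power sum products as a basis of the symmetric functions\<close>

lemma Sym_bounded: "f \<in> Sym \<Longrightarrow> \<exists>d. \<forall>w. mps_coeff f w \<noteq> 0 \<longrightarrow> mdeg w \<le> d"
  by (simp add: Sym_def)

lemma Sym_map_key:
  "f \<in> Sym \<Longrightarrow> bij \<pi> \<Longrightarrow> mps_coeff f (Poly_Mapping.map_key \<pi> w) = mps_coeff f w"
  by (simp add: Sym_def)

lemma Sym_vals: "f \<in> Sym \<Longrightarrow> vals w = vals w' \<Longrightarrow> mps_coeff f w = mps_coeff f w'"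
  unfolding Sym_iff by blast

lemma SymI:
  assumes "\<And>w. mps_coeff f w \<noteq> 0 \<Longrightarrow> mdeg w \<le> d"
    and "\<And>\<pi> w. bij \<pi> \<Longrightarrow> mps_coeff f (Poly_Mapping.map_key \<pi> w) = mps_coeff f w"
  shows "f \<in> Sym"
  unfolding Sym_def mem_Collect_eq
proof (intro conjI)
  show "\<exists>d. \<forall>w. mps_coeff f w \<noteq> 0 \<longrightarrow> mdeg w \<le> d"
    using assms(1) by blast
  show "\<forall>\<pi> w. bij \<pi> \<longrightarrow> mps_coeff f (Poly_Mapping.map_key \<pi> w) = mps_coeff f w"
    using assms(2) by blast
qed

text \<open>Closure under arbitrary products comes only after the spanning theorem; this special
  case, checked on coefficients, is what that theorem needs to start.\<close>

lemma sym_p_times_in_Sym: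
  assumes k: "k \<ge> 1" and f: "f \<in> Sym"
  shows "sym_p k * f \<in> Sym"
proof -
  from f obtain d where d: "\<And>w. mps_coeff f w \<noteq> 0 \<Longrightarrow> mdeg w \<le> d"
    using Sym_bounded by blast
  note sym = Sym_map_key[OF f]
  have "mdeg w \<le> d + k" if nz: "mps_coeff (sym_p k * f) w \<noteq> 0" for w
  proof -
    obtain i where i: "k \<le> lookup w i" "mps_coeff f (w - single i k) \<noteq> 0"
      using nz unfolding mps_coeff_sym_p_times[OF k] by (auto elim: sum.not_neutral_contains_not_neutral)
    then show ?thesis
      using d[OF i(2)] by (simp add: mdeg_diff_single)
  qed
  moreover have "mps_coeff (sym_p k * f) (Poly_Mapping.map_key \<pi> w) = mps_coeff (sym_p k * f) w"
    if bij: "bij \<pi>" for \<pi> w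
  proof -
    have eq: "Poly_Mapping.map_key \<pi> w - single i k
      = Poly_Mapping.map_key \<pi> (w - single (\<pi> i) k)" for i
      using bij by (intro poly_mapping_eqI)
        (auto simp: map_key_bij_keys lookup_minus lookup_single when_def bij_is_inj inj_eq)
    have "mps_coeff (sym_p k * f) (Poly_Mapping.map_key \<pi> w)
      = (\<Sum>i | k \<le> lookup w (\<pi> i). mps_coeff f (w - single (\<pi> i) k))"
      using bij by (simp add: mps_coeff_sym_p_times[OF k] map_key_bij_keys eq sym)
    also have "\<dots> = (\<Sum>i | k \<le> lookup w i. mps_coeff f (w - single i k))"
      by (rule sum.reindex_bij_witness[where i = "inv \<pi>" and j = \<pi>])
        (use bij in \<open>auto simp: bij_is_inj surj_f_inv_f[OF bij_is_surj]\<close>)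
    finally show ?thesis
      by (simp add: mps_coeff_sym_p_times[OF k])
  qed
  ultimately show ?thesis
    by (rule SymI)
qed

lemma one_in_Sym: "1 \<in> Sym"
  unfolding Sym_iff
proof (intro conjI allI impI)
  show "\<exists>d. \<forall>w. mps_coeff (1 :: (nat, 'a) mps) w \<noteq> 0 \<longrightarrow> mdeg w \<le> d"
    by (intro exI[of _ 0]) (simp add: mps_coeff_one)
  show "mps_coeff (1 :: (nat, 'a) mps) w = mps_coeff 1 w'" if "vals w = vals w'" for w w'
    using that by (metis mps_coeff_one mdeg_eq_0_iff sum_mset_vals)
qed

lemma sym_pm_in_Sym: "0 \<notin># M \<Longrightarrow> sym_pm M \<in> Sym"
  by (induction M) (auto simp: one_in_Sym sym_pm_add_mset intro!: sym_p_times_in_Sym Suc_leI gr0I)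

lemma subspace_Sym: "mps.subspace (Sym :: (nat, 'k::field) mps set)"
proof (rule mps.subspaceI)
  show "(0 :: (nat, 'k) mps) \<in> Sym"
    by (simp add: Sym_def)
next
  fix f g :: "(nat, 'k) mps"
  assume "f \<in> Sym" "g \<in> Sym"
  then obtain d e where d: "\<And>w. mps_coeff f w \<noteq> 0 \<Longrightarrow> mdeg w \<le> d"
    and e: "\<And>w. mps_coeff g w \<noteq> 0 \<Longrightarrow> mdeg w \<le> e"
    using Sym_bounded by meson
  have "mdeg w \<le> max d e" if "mps_coeff (f + g) w \<noteq> 0" for w
    using that d[of w] e[of w] by (cases "mps_coeff f w = 0") auto
  with \<open>f \<in> Sym\<close> \<open>g \<in> Sym\<close> show "f + g \<in> Sym"
    by (intro SymI[of _ "max d e"]) (auto simp: Sym_map_key)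
next
  fix c and f :: "(nat, 'k) mps"
  assume f: "f \<in> Sym"
  then obtain d where d: "\<And>w. mps_coeff f w \<noteq> 0 \<Longrightarrow> mdeg w \<le> d"
    using Sym_bounded by blast
  with f show "mps_scale c f \<in> Sym"
    by (intro SymI[of _ d]) (auto simp: Sym_map_key)
qed

text \<open>Among the multisets with nonzero coefficient take \<open>M\<close> of maximal size and
  look at a monomial of type \<open>M\<close>. By triangularity another \<open>N\<close> reaches it
  only if its size is at least that of \<open>M\<close>, hence equal, and then
  \<open>N = M\<close>.\<close>

lemma sym_pm_sum_eq_0:
  fixes c :: "nat multiset \<Rightarrow> 'k::field_char_0"
  assumes fin: "finite A" and pos: "\<And>M. M \<in> A \<Longrightarrow> 0 \<notin># M"
    and eq: "(\<Sum>M\<in>A. mps_scale (c M) (sym_pm M)) = 0" and "M0 \<in> A"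
  shows "c M0 = 0"
proof (rule ccontr)
  assume "c M0 \<noteq> 0"
  let ?B = "{M\<in>A. c M \<noteq> 0}"
  have "Max (size ` ?B) \<in> size ` ?B"
    using fin \<open>M0 \<in> A\<close> \<open>c M0 \<noteq> 0\<close> by (intro Max_in) auto
  then obtain M where M: "M \<in> ?B" "size M = Max (size ` ?B)"
    by auto
  have max: "size N \<le> size M" if "N \<in> ?B" for N
    using that fin M by auto
  obtain w :: "nat \<Rightarrow>\<^sub>0 nat" where w: "vals w = M"
    using ex_vals pos M by blast
  have "mps_coeff (\<Sum>M\<in>A. mps_scale (c M) (sym_pm M)) w = c M * mps_coeff (sym_pm M) w"
  proof -
    have "c N * mps_coeff (sym_pm N) w = 0" if "N \<in> A - {M}" for N
    proof (rule ccontr)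
      assume nz: "c N * mps_coeff (sym_pm N) w \<noteq> 0"
      then have "size N \<le> size M"
        using max that by auto
      moreover have "card (keys w) \<le> size N"
        "card (keys w) = size N \<longrightarrow> vals w = N"
        using sym_pm_triangular[where ?'k = 'k, of N w] pos[of N] that nz by auto
      moreover have "card (keys w) = size M"
        using w size_vals by metis
      ultimately show False
        using w that by auto
    qed
    then have "(\<Sum>N\<in>A - {M}. c N * mps_coeff (sym_pm N) w) = 0"
      by (intro sum.neutral) blast
    then show ?thesis
      using M fin by (simp add: sum.remove[of A M])
  qed
  moreover have "mps_coeff (sym_pm M :: (nat, 'k) mps) w \<noteq> 0"
    using sym_pm_triangular[where ?'k = 'k, of M w] pos[of M] M w by auto
  ultimately show False
    using M eq by simp
qed

abbreviation pos_msets :: "nat multiset set" where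
  "pos_msets \<equiv> {M. 0 \<notin># M}"

lemma inj_on_sym_pm: "inj_on (sym_pm :: _ \<Rightarrow> (nat, 'k::field_char_0) mps) pos_msets"
proof (rule inj_onI, rule ccontr)
  fix M N assume MN: "M \<in> pos_msets" "N \<in> pos_msets" "sym_pm M = (sym_pm N :: (nat, 'k) mps)" "M \<noteq> N"
  let ?c = "\<lambda>L. if L = M then 1 else (-1 :: 'k)"
  have "(\<Sum>L\<in>{M, N}. mps_scale (?c L) (sym_pm L)) = 0"
    using MN by (simp add: mps.scale_minus_left)
  then have "?c M = 0"
    by (rule sym_pm_sum_eq_0[rotated 2]) (use MN in auto)
  then show False
    by simp
qed

lemma independent_sym_pm:
  "\<not> mps.dependent ((sym_pm :: _ \<Rightarrow> (nat, 'k::field_char_0) mps) ` pos_msets)"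
  unfolding mps.independent_explicit_finite_subsets
proof (intro allI impI ballI)
  fix S :: "(nat, 'k) mps set" and u b
  assume S: "S \<subseteq> sym_pm ` pos_msets" "finite S" and eq: "(\<Sum>v\<in>S. mps_scale (u v) v) = 0" and "b \<in> S"
  then obtain A where A: "A \<subseteq> pos_msets" "S = sym_pm ` A"
    by (auto simp: subset_image_iff)
  then have inj: "inj_on (sym_pm :: _ \<Rightarrow> (nat, 'k) mps) A"
    using inj_on_sym_pm inj_on_subset by blast
  have "finite A"
    using A S finite_imageD inj by blast
  moreover have "(\<Sum>M\<in>A. mps_scale (u (sym_pm M)) (sym_pm M)) = 0"
    using eq A inj by (simp add: sum.reindex)
  ultimately show "u b = 0"
    using sym_pm_sum_eq_0[of A "\<lambda>M. u (sym_pm M)"] A \<open>b \<in> S\<close> by auto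
qed

lemma card_keys_le_mdeg: "card (keys w) \<le> mdeg w"
  using sum_mono[of "keys w" "\<lambda>_. 1" "lookup w"]
  by (auto simp: mdeg_def in_keys_iff Suc_leI)

text \<open>The monomial symmetric functions are eliminated in the order of decreasing length.\<close>

lemma Sym_eq_span: "(Sym :: (nat, 'k::field_char_0) mps set) = mps.span (sym_pm ` pos_msets)"
proof
  show "mps.span (sym_pm ` pos_msets) \<subseteq> (Sym :: (nat, 'k) mps set)"
    by (rule mps.span_minimal) (auto simp: subspace_Sym sym_pm_in_Sym)
next
  let ?span = "mps.span (sym_pm ` pos_msets) :: (nat, 'k) mps set"
  \<comment> \<open>The degree bound \<open>d\<close> stays fixed during the induction on the
    length; it keeps the set of multisets to be subtracted finite.\<close>
  have main: "f \<in> ?span" if "f \<in> Sym" "\<And>w. mps_coeff f w \<noteq> 0 \<Longrightarrow> mdeg w \<le> d"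
    "\<And>w. mps_coeff f w \<noteq> 0 \<Longrightarrow> card (keys w) \<le> l" for f :: "(nat, 'k) mps" and d l
    using that
  proof (induction l arbitrary: f)
    case 0
    then have "mps_coeff f w = 0" if "w \<noteq> 0" for w
      using that by fastforce
    then have "f = mps_scale (mps_coeff f 0) (sym_pm {#})"
      by (intro mps_eqI) (simp add: mps_coeff_one)
    then show ?case
      by (metis (mono_tags, lifting) empty_iff imageI mem_Collect_eq mps.span_base mps.span_scale
          set_mset_empty)
  next
    case (Suc l)
    let ?A = "{M. 0 \<notin># M \<and> size M = Suc l \<and> sum_mset M \<le> d}"
    have "?A \<subseteq> mset ` {xs. set xs \<subseteq> {..d} \<and> length xs = Suc l}"
    proof
      fix M assume M: "M \<in> ?A"
      obtain xs where xs: "M = mset xs"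
        by (metis ex_mset)
      have "x \<le> d" if "x \<in> set xs" for x
        using M xs member_le_sum_list[OF that] by (simp add: sum_mset_sum_list)
      with M xs show "M \<in> mset ` {xs. set xs \<subseteq> {..d} \<and> length xs = Suc l}"
        by auto
    qed
    then have fin: "finite ?A"
      by (rule finite_subset) (intro finite_imageI finite_lists_length_eq finite_atMost)
    obtain W :: "nat multiset \<Rightarrow> (nat \<Rightarrow>\<^sub>0 nat)" where W: "\<And>M. 0 \<notin># M \<Longrightarrow> vals (W M) = M"
      using ex_vals by metis
    let ?p = "sym_pm :: _ \<Rightarrow> (nat, 'k) mps"
    \<comment> \<open>Chosen so that \<open>?g\<close> matches \<open>f\<close> at the monomial
      \<open>W M\<close> of type \<open>M\<close>; by triangularity no other multiset of the same
      size contributes there.\<close>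
    let ?c = "\<lambda>M. mps_coeff f (W M) / mps_coeff (?p M) (W M)"
    let ?g = "\<Sum>M\<in>?A. mps_scale (?c M) (?p M)"
    have g_span: "?g \<in> ?span"
      by (intro mps.span_sum mps.span_scale mps.span_base) auto
    have g_Sym: "?g \<in> Sym"
      by (intro mps.subspace_sum[OF subspace_Sym] mps.subspace_scale[OF subspace_Sym] sym_pm_in_Sym) auto
    have g_coeff: "mps_coeff ?g w = mps_coeff f w" if w: "card (keys w) \<ge> Suc l" for w
    proof -
      have zero: "mps_coeff (?p M) w = 0" if "M \<in> ?A" "M \<noteq> vals w" for M
        using sym_pm_triangular[where ?'k = 'k, of M w] that w by auto
      show ?thesis
      proof (cases "vals w \<in> ?A")
        case True
        have "mps_coeff ?g w = (\<Sum>M\<in>?A. ?c M * mps_coeff (?p M) w)"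
          by simp
        also have "\<dots> = ?c (vals w) * mps_coeff (?p (vals w)) w"
          using fin True zero by (subst sum.remove[of _ "vals w"]) (auto intro!: sum.neutral)
        also have "mps_coeff f (W (vals w)) = mps_coeff f w"
          using Suc.prems(1) W[OF vals_pos] by (rule Sym_vals)
        also have "mps_coeff (?p (vals w)) (W (vals w)) = mps_coeff (?p (vals w)) w"
          using sym_pm_in_Sym[OF vals_pos] W[OF vals_pos] by (rule Sym_vals)
        also have "mps_coeff f w / mps_coeff (?p (vals w)) w * mps_coeff (?p (vals w)) w = mps_coeff f w"
          using sym_pm_triangular[where ?'k = 'k, OF vals_pos, of w w] by auto
        finally show ?thesis .
      next
        case False
        then have "mps_coeff f w = 0"
          using Suc.prems(2)[of w] Suc.prems(3)[of w] w vals_pos[of w]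
          by (auto simp: sum_mset_vals size_vals)
        moreover have "mps_coeff ?g w = 0"
        proof -
          have "mps_coeff (?p M) w = 0" if "M \<in> ?A" for M
            using zero[OF that] that False by fastforce
          then show ?thesis
            unfolding mps_coeff_sum mps_coeff_scale by (intro sum.neutral) simp
        qed
        ultimately show ?thesis
          by simp
      qed
    qed
    have g_deg: "mdeg w \<le> d" if nz: "mps_coeff ?g w \<noteq> 0" for w
    proof -
      obtain M where M: "M \<in> ?A" "?c M * mps_coeff (?p M) w \<noteq> 0"
        using nz unfolding mps_coeff_sum mps_coeff_scale
        by (rule sum.not_neutral_contains_not_neutral)
      then have "mps_coeff (?p M) w \<noteq> 0" "0 \<notin># M"
        by auto
      then have "mdeg w = sum_mset M"
        using sym_pm_triangular[where ?'k = 'k, of M w] by fastforce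
      with M show ?thesis
        by simp
    qed
    have diff: "f - ?g \<in> ?span"
    proof (rule Suc.IH)
      show "f - ?g \<in> Sym"
        using Suc.prems(1) g_Sym by (rule mps.subspace_diff[OF subspace_Sym])
      show "mdeg w \<le> d" if "mps_coeff (f - ?g) w \<noteq> 0" for w
      proof (cases "mps_coeff f w = 0")
        case True
        with that have "mps_coeff ?g w \<noteq> 0"
          unfolding mps_coeff_diff by (metis diff_self)
        then show ?thesis
          by (rule g_deg)
      qed (rule Suc.prems(2))
      show "card (keys w) \<le> l" if "mps_coeff (f - ?g) w \<noteq> 0" for w
      proof (rule ccontr)
        assume "\<not> card (keys w) \<le> l"
        then have "mps_coeff (f - ?g) w = 0"
          unfolding mps_coeff_diff by (subst g_coeff) simp_all
        with that show False ..
      qed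
    qed
    show ?case
      using mps.span_add[OF diff g_span] unfolding diff_add_cancel .
  qed
  show "Sym \<subseteq> ?span"
  proof
    fix f :: "(nat, 'k) mps" assume f: "f \<in> Sym"
    obtain d where d: "\<And>w. mps_coeff f w \<noteq> 0 \<Longrightarrow> mdeg w \<le> d"
      using Sym_bounded[OF f] by blast
    show "f \<in> ?span"
      by (rule main[OF f d order_trans[OF card_keys_le_mdeg d]])
  qed
qed

text \<open>The working form of the spanning theorem: a property that respects linear combinations
  has to be checked on products of power sums only.\<close>

lemma Sym_induct [consumes 1, case_names zero step]:
  fixes f :: "(nat, 'k::field_char_0) mps"
  assumes "f \<in> Sym" "P 0"
    and step: "\<And>c M g. 0 \<notin># M \<Longrightarrow> g \<in> Sym \<Longrightarrow> P g \<Longrightarrow> P (mps_scale c (sym_pm M) + g)"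
  shows "P f"
proof -
  have "f \<in> mps.span (sym_pm ` pos_msets)"
    using assms(1) unfolding Sym_eq_span .
  then have "f \<in> Sym \<and> P f"
  proof (induction rule: mps.span_induct_alt)
    case base
    then show ?case
      using assms(2) mps.subspace_0[OF subspace_Sym] by simp
  next
    case (step c x y)
    show ?case
    proof -
      obtain M where M: "0 \<notin># M" "x = sym_pm M"
        using step(1) by blast
      from step have y: "y \<in> Sym" "P y"
        by simp_all
      have "mps_scale c (sym_pm M) + y \<in> Sym"
        by (intro mps.subspace_add[OF subspace_Sym] mps.subspace_scale[OF subspace_Sym]
            sym_pm_in_Sym M y)
      with assms(3)[OF M(1) y, of c] M(2) show ?thesis
        by simp
    qed
  qed
  then show ?thesis ..
qed

text \<open>Extending from an independent set yields a map on all formal series, so additivity and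
  homogeneity come without membership conditions.\<close>

lemma ex_linear_on_sym_pm:
  fixes g :: "nat multiset \<Rightarrow> 'b::ab_group_add" and sc :: "'k::field_char_0 \<Rightarrow> 'b \<Rightarrow> 'b"
  assumes "vector_space sc"
  shows "\<exists>L. (\<forall>x y. L (x + y) = L x + L y) \<and> (\<forall>c x. L (mps_scale c x) = sc c (L x)) \<and>
    (\<forall>M. 0 \<notin># M \<longrightarrow> L (sym_pm M) = g M)"
proof -
  interpret target: vector_space sc by fact
  interpret pair: vector_space_pair "mps_scale :: 'k \<Rightarrow> (nat, 'k) mps \<Rightarrow> (nat, 'k) mps" sc
    by (intro vector_space_pair.intro mps.vector_space_axioms assms)
  obtain L where L: "Vector_Spaces.linear mps_scale sc L"
    "\<forall>x\<in>(sym_pm :: _ \<Rightarrow> (nat, 'k) mps) ` pos_msets. L x = g (inv_into pos_msets sym_pm x)"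
    using pair.linear_independent_extend[OF independent_sym_pm,
        of "\<lambda>x. g (inv_into pos_msets sym_pm x)"] by blast
  have "L (sym_pm M) = g M" if "0 \<notin># M" for M
    using L(2) inv_into_f_f[OF inj_on_sym_pm[where ?'k = 'k], of M] that by simp
  then show ?thesis
    using pair.linear_add[OF L(1)] pair.linear_scale[OF L(1)] by blast
qed

lemmas Sym_add = mps.subspace_add[OF subspace_Sym]
  and Sym_scale = mps.subspace_scale[OF subspace_Sym]
  and Sym_zero = mps.subspace_0[OF subspace_Sym]
  and Sym_sum = mps.subspace_sum[OF subspace_Sym]

lemma Sym_mult:
  fixes f g :: "(nat, 'k::field_char_0) mps"
  assumes "f \<in> Sym" "g \<in> Sym"
  shows "f * g \<in> Sym"
  using assms(1)
proof (induction rule: Sym_induct)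
  case (step c M f)
  have "sym_pm M * g \<in> Sym"
    using assms(2)
  proof (induction rule: Sym_induct)
    case (step d N g)
    have "sym_pm M * (mps_scale d (sym_pm N) + g) = mps_scale d (sym_pm (M + N)) + sym_pm M * g"
      by (simp add: distrib_left mps_scale_mult_right sym_pm_union)
    also have "\<dots> \<in> Sym"
      using step \<open>0 \<notin># M\<close> by (intro Sym_add Sym_scale sym_pm_in_Sym) simp_all
    finally show ?case .
  qed (simp add: Sym_zero)
  then have "mps_scale c (sym_pm M * g) + f * g \<in> Sym"
    using step by (intro Sym_add Sym_scale)
  then show ?case
    by (simp add: distrib_right mps_scale_mult_left)
qed (simp add: Sym_zero)

section \<open>Algebra homomorphisms prescribed on power sums\<close>

lemma sym_p_eq_sym_pm: "sym_p j = sym_pm {#j#}"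
  by (simp add: sym_pm_def)

lemma sym_p_in_Sym: "j \<ge> 1 \<Longrightarrow> sym_p j \<in> Sym"
  by (simp add: sym_p_eq_sym_pm sym_pm_in_Sym)

text \<open>Products of basis elements are again basis elements, so a linear map with multiplicative
  values on the basis is multiplicative on \<open>Sym\<close>. It supplies the witnesses for both
  \<open>sym_theta\<close> and \<open>sym_kappa\<close>.\<close>

lemma ex_sym_alg_hom:
  fixes sc :: "'k::field_char_0 \<Rightarrow> 'b::comm_ring_1 \<Rightarrow> 'b"
  assumes vs: "vector_space sc" and sc_mult: "\<And>c x y. sc c x * y = sc c (x * y)"
  shows "\<exists>\<phi>. sym_alg_hom sc \<phi> \<and> (\<forall>M. 0 \<notin># M \<longrightarrow> \<phi> (sym_pm M) = (\<Prod>i\<in>#M. g i))"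
proof -
  have sc_mult': "x * sc c y = sc c (x * y)" for c x y
    using sc_mult[of c y x] by (simp add: mult.commute)
  obtain \<phi> where add: "\<And>x y. \<phi> (x + y) = \<phi> x + \<phi> y"
    and scale: "\<And>c x. \<phi> (mps_scale c x) = sc c (\<phi> x)"
    and basis: "\<And>M. 0 \<notin># M \<Longrightarrow> \<phi> (sym_pm M) = (\<Prod>i\<in>#M. g i)"
    using ex_linear_on_sym_pm[OF vs, of "\<lambda>M. \<Prod>i\<in>#M. g i"] by blast
  have zero: "\<phi> 0 = 0"
    using add[of 0 0] by simp
  have "\<phi> (f * h) = \<phi> f * \<phi> h" if "f \<in> Sym" "h \<in> Sym" for f h
    using that(1)
  proof (induction rule: Sym_induct)
    case (step c M f)
    have "\<phi> (sym_pm M * h) = \<phi> (sym_pm M) * \<phi> h"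
      using that(2)
    proof (induction rule: Sym_induct)
      case (step d N h)
      then show ?case
        using \<open>0 \<notin># M\<close>
        by (simp add: distrib_left mps_scale_mult_right add scale sc_mult' basis
            flip: sym_pm_union)
    qed (simp add: zero)
    with step show ?case
      by (simp add: distrib_right mps_scale_mult_left add scale sc_mult)
  qed (simp add: zero)
  then have "sym_alg_hom sc \<phi>"
    using add scale basis[of "{#}"] by (auto simp: sym_alg_hom_def)
  with basis show ?thesis
    by blast
qed

lemma vector_space_times: "vector_space ((*) :: 'k::field \<Rightarrow> 'k \<Rightarrow> 'k)"
  by unfold_locales (simp_all add: algebra_simps)

lemma mps_scale_1 [simp]: "mps_scale 1 f = f"
  by (rule mps_eqI) simp

lemma mps_scale_scale: "mps_scale c (mps_scale d f) = mps_scale (c * d) f"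
  by (rule mps_eqI) (simp add: mult.assoc)

lemma prod_mset_scale_sym_p:
  "(\<Prod>i\<in>#M. mps_scale (g i) (sym_p i)) = mps_scale (\<Prod>i\<in>#M. g i) (sym_pm M)"
  by (induction M) (simp_all add: sym_pm_add_mset mps_scale_mult_left mps_scale_mult_right
      mps_scale_scale mult.commute)

lemma sym_theta_spec:
  fixes a :: "int \<Rightarrow> 'k::field_char_0"
  shows "sym_alg_hom mps_scale (sym_theta a)"
    and "f \<in> Sym \<Longrightarrow> sym_theta a f \<in> Sym"
    and "j \<ge> 1 \<Longrightarrow> sym_theta a (sym_p j) = mps_scale (a (int j)) (sym_p j)"
proof -
  obtain \<theta> where \<theta>: "sym_alg_hom mps_scale \<theta>"
    "\<And>M. 0 \<notin># M \<Longrightarrow> \<theta> (sym_pm M) = (\<Prod>i\<in>#M. mps_scale (a (int i)) (sym_p i :: (nat, 'k) mps))"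
    using ex_sym_alg_hom[where ?'k = 'k and ?'b = "(nat, 'k) mps", OF mps.vector_space_axioms mps_scale_mult_left,
        of "\<lambda>i. mps_scale (a (int i)) (sym_p i)"] by blast
  have \<theta>_M: "\<theta> (sym_pm M) = mps_scale (\<Prod>i\<in>#M. a (int i)) (sym_pm M)" if "0 \<notin># M" for M
    using \<theta>(2)[OF that] by (simp add: prod_mset_scale_sym_p)
  have lin: "\<theta> (f + g) = \<theta> f + \<theta> g" "\<theta> (mps_scale c f) = mps_scale c (\<theta> f)"
    if "f \<in> Sym" "g \<in> Sym" for f g c
    using \<theta>(1) that by (auto simp: sym_alg_hom_def)
  have \<theta>0: "\<theta> 0 = 0"
    using lin(1)[OF Sym_zero Sym_zero] by simp
  have "\<theta> f \<in> Sym" if "f \<in> Sym" for f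
    using that
  proof (induction rule: Sym_induct)
    case zero
    then show ?case
      by (simp add: \<theta>0 Sym_zero)
  next
    case (step c M g)
    have "\<theta> (mps_scale c (sym_pm M) + g) = mps_scale c (mps_scale (\<Prod>i\<in>#M. a (int i)) (sym_pm M)) + \<theta> g"
      using step by (simp only: lin Sym_scale sym_pm_in_Sym \<theta>_M not_False_eq_True)
    then show ?case
      using step by (simp only: Sym_add Sym_scale sym_pm_in_Sym not_False_eq_True)
  qed
  moreover have "\<theta> (sym_p j) = mps_scale (a (int j)) (sym_p j)" if "j \<ge> 1" for j
    using \<theta>_M[of "{#j#}"] that by (simp add: sym_p_eq_sym_pm)
  ultimately have "\<exists>\<theta>. sym_alg_hom mps_scale \<theta> \<and> (\<forall>f\<in>Sym. \<theta> f \<in> Sym) \<and>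
     (\<forall>j\<ge>1. \<theta> (sym_p j) = mps_scale (a (int j)) (sym_p j :: (nat, 'k) mps))"
    using \<theta>(1) by blast
  then have "sym_alg_hom mps_scale (sym_theta a) \<and> (\<forall>f\<in>Sym. sym_theta a f \<in> Sym) \<and>
     (\<forall>j\<ge>1. sym_theta a (sym_p j) = mps_scale (a (int j)) (sym_p j))"
    unfolding sym_theta_def by (rule someI_ex)
  then show "sym_alg_hom mps_scale (sym_theta a)" "f \<in> Sym \<Longrightarrow> sym_theta a f \<in> Sym"
    "j \<ge> 1 \<Longrightarrow> sym_theta a (sym_p j) = mps_scale (a (int j)) (sym_p j)"
    by blast+
qed

lemma sym_kappa_spec:
  fixes a :: "int \<Rightarrow> 'k::field_char_0"
  shows "sym_alg_hom (*) (sym_kappa a)"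
    and "j \<ge> 1 \<Longrightarrow> sym_kappa a (sym_p j) = a (int j)"
proof -
  obtain \<kappa> :: "(nat, 'k) mps \<Rightarrow> 'k" where \<kappa>: "sym_alg_hom (*) \<kappa>"
    "\<And>M. 0 \<notin># M \<Longrightarrow> \<kappa> (sym_pm M) = (\<Prod>i\<in>#M. a (int i))"
    using ex_sym_alg_hom[OF vector_space_times mult.assoc, of "\<lambda>i. a (int i)"] by blast
  have "\<kappa> (sym_p j) = a (int j)" if "j \<ge> 1" for j
    using \<kappa>(2)[of "{#j#}"] that by (simp add: sym_p_eq_sym_pm)
  then have "\<exists>\<kappa>. sym_alg_hom (*) \<kappa> \<and> (\<forall>j\<ge>1. \<kappa> (sym_p j) = a (int j))"
    using \<kappa>(1) by blast
  then have "sym_alg_hom (*) (sym_kappa a) \<and> (\<forall>j\<ge>1. sym_kappa a (sym_p j) = a (int j))"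
    unfolding sym_kappa_def by (rule someI_ex)
  then show "sym_alg_hom (*) (sym_kappa a)" "j \<ge> 1 \<Longrightarrow> sym_kappa a (sym_p j) = a (int j)"
    by blast+
qed

section \<open>Weighted complete homogeneous functions and Newton's identities\<close>

text \<open>For \<open>\<eta> 0 = 1\<close> this is the degree \<open>k\<close> part of
  \<open>\<Prod>_i \<Sum>_n \<eta>_n x_i^n\<close>. Weights 1 give \<open>h_k\<close>, the weights
  \<open>h_angle a\<close> turn out to give \<open>h_k[a_i]\<close>, and the coefficients of the
  Cauchy kernel are products of such series.\<close>

definition sym_H :: "(nat \<Rightarrow> 'k) \<Rightarrow> nat \<Rightarrow> ('x, 'k::comm_ring_1) mps" where
  "sym_H \<eta> k = Abs_mps (\<lambda>w. if mdeg w = k then \<Prod>i\<in>keys w. \<eta> (lookup w i) else 0)"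

lemma mps_coeff_sym_H:
  "mps_coeff (sym_H \<eta> k) w = (if mdeg w = k then \<Prod>x\<in>#vals w. \<eta> x else 0)"
  by (simp add: sym_H_def vals_def prod_unfold_prod_mset multiset.map_comp comp_def)

lemma sym_h_eq_sym_H: "sym_h k = sym_H (\<lambda>_. 1) k"
  by (simp add: sym_h_def sym_H_def cong: if_cong)

lemma sym_H_in_Sym: "sym_H \<eta> k \<in> Sym"
  by (rule SymI[of _ k]) (auto simp: mps_coeff_sym_H vals_map_key sum_mset_vals[symmetric] split: if_splits)

lemma sym_H_0: "\<eta> 0 = 1 \<Longrightarrow> sym_H \<eta> 0 = 1"
  by (rule mps_eqI) (auto simp: sym_H_def mps_coeff_one)

text \<open>The degree \<open>k\<close> is the sum of the exponents. The share of a variable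
  \<open>x_j\<close>, its exponent times the coefficient, is rewritten by Newton's identity for the
  one-variable weights \<open>\<eta>\<close>.\<close>

lemma sym_H_newton:
  fixes \<eta> :: "nat \<Rightarrow> 'k::comm_ring_1"
  assumes \<eta>0: "\<eta> 0 = 1"
    and \<eta>: "\<And>n. of_nat n * \<eta> n = (\<Sum>i\<in>{1..n}. a i * \<eta> (n - i))"
  shows "mps_scale (of_nat k) (sym_H \<eta> k) = (\<Sum>i\<in>{1..k}. mps_scale (a i) (sym_p i * sym_H \<eta> (k - i)))"
proof (rule mps_eqI)
  fix w :: "nat \<Rightarrow>\<^sub>0 nat"
  let ?l = "lookup w"
  let ?K = "keys w"
  have rhs: "mps_coeff (\<Sum>i\<in>{1..k}. mps_scale (a i) (sym_p i * sym_H \<eta> (k - i))) w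
      = (\<Sum>i\<in>{1..k}. a i * (\<Sum>j | i \<le> ?l j. mps_coeff (sym_H \<eta> (k - i)) (w - single j i)))"
    by (simp add: mps_coeff_sym_p_times)
  show "mps_coeff (mps_scale (of_nat k) (sym_H \<eta> k)) w
      = mps_coeff (\<Sum>i\<in>{1..k}. mps_scale (a i) (sym_p i * sym_H \<eta> (k - i))) w"
  proof (cases "mdeg w = k")
    case False
    have "mps_coeff (sym_H \<eta> (k - i)) (w - single j i) = 0"
      if "i \<in> {1..k}" "i \<le> ?l j" for i j
    proof -
      have "mdeg w = i + mdeg (w - single j i)"
        using that(2) by (metis mdeg_add mdeg_single pm_single_add_diff)
      then have "mdeg (w - single j i) \<noteq> k - i"
        using that False by auto
      then show ?thesis
        by (simp add: mps_coeff_sym_H)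
    qed
    then show ?thesis
      using False unfolding rhs by (simp add: mps_coeff_sym_H)
  next
    case True
    define R where "R j = (\<Prod>i\<in>?K - {j}. \<eta> (?l i))" for j
    have le: "?l j \<le> k" for j
      using True by (metis mdeg_def member_le_sum finite_keys in_keys_iff le0 zero_le)
    have summand: "mps_coeff (sym_H \<eta> (k - i)) (w - single j i) = R j * \<eta> (?l j - i)"
      if "i \<le> ?l j" "j \<in> ?K" for i j
    proof -
      have "mdeg (w - single j i) = k - i"
        using that True by (simp add: mdeg_diff_single)
      then have "mps_coeff (sym_H \<eta> (k - i)) (w - single j i)
        = (\<Prod>x\<in>keys (w - single j i). \<eta> (lookup (w - single j i) x))"
        by (simp add: sym_H_def)
      also have "\<dots> = (\<Prod>x\<in>?K. \<eta> (lookup (w - single j i) x))"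
        by (rule prod.mono_neutral_left) (auto simp: in_keys_iff lookup_minus \<eta>0)
      also have "\<dots> = \<eta> (?l j - i) * (\<Prod>x\<in>?K - {j}. \<eta> (lookup (w - single j i) x))"
        using that by (subst prod.remove[of _ j]) (auto simp: lookup_minus)
      also have "(\<Prod>x\<in>?K - {j}. \<eta> (lookup (w - single j i) x)) = R j"
        unfolding R_def by (rule prod.cong) (auto simp: lookup_minus lookup_single when_def)
      finally show ?thesis
        by (simp add: mult.commute)
    qed
    have "(\<Sum>i\<in>{1..k}. a i * (\<Sum>j | i \<le> ?l j. mps_coeff (sym_H \<eta> (k - i)) (w - single j i)))
        = (\<Sum>i\<in>{1..k}. \<Sum>j\<in>?K. if i \<le> ?l j then a i * (R j * \<eta> (?l j - i)) else 0)"
    proof (rule sum.cong[OF refl])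
      fix i assume i: "i \<in> {1..k}"
      have sub: "{j. i \<le> ?l j} = {j \<in> ?K. i \<le> ?l j}"
        using i by (auto simp: in_keys_iff)
      have "a i * (\<Sum>j | i \<le> ?l j. mps_coeff (sym_H \<eta> (k - i)) (w - single j i))
        = (\<Sum>j\<in>{j \<in> ?K. i \<le> ?l j}. a i * (R j * \<eta> (?l j - i)))"
        unfolding sum_distrib_left sub by (rule sum.cong) (auto simp: summand)
      also have "\<dots> = (\<Sum>j\<in>?K. if i \<le> ?l j then a i * (R j * \<eta> (?l j - i)) else 0)"
        by (rule sum.inter_filter) simp
      finally show "a i * (\<Sum>j | i \<le> ?l j. mps_coeff (sym_H \<eta> (k - i)) (w - single j i))
        = (\<Sum>j\<in>?K. if i \<le> ?l j then a i * (R j * \<eta> (?l j - i)) else 0)" .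
    qed
    \<comment> \<open>With the variable \<open>j\<close> outside, the inner sum is the right side of
      Newton's identity for \<open>\<eta>\<close> at the exponent of \<open>j\<close>;
      \<open>R j\<close> collects the other variables.\<close>
    also have "\<dots> = (\<Sum>j\<in>?K. \<Sum>i\<in>{1..k}. if i \<le> ?l j then a i * (R j * \<eta> (?l j - i)) else 0)"
      by (rule sum.swap)
    also have "\<dots> = (\<Sum>j\<in>?K. of_nat (?l j) * (\<Prod>i\<in>?K. \<eta> (?l i)))"
    proof (rule sum.cong[OF refl])
      fix j assume j: "j \<in> ?K"
      have "(\<Sum>i\<in>{1..k}. if i \<le> ?l j then a i * (R j * \<eta> (?l j - i)) else 0)
        = (\<Sum>i\<in>{1..?l j}. R j * (a i * \<eta> (?l j - i)))"
        by (rule sum.mono_neutral_cong_right) (use le[of j] in \<open>auto simp: mult.left_commute\<close>)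
      also have "\<dots> = R j * (of_nat (?l j) * \<eta> (?l j))"
        by (simp add: \<eta> sum_distrib_left)
      also have "\<dots> = of_nat (?l j) * (\<eta> (?l j) * R j)"
        by (simp add: mult_ac)
      also have "\<eta> (?l j) * R j = (\<Prod>i\<in>?K. \<eta> (?l i))"
        unfolding R_def using j by (simp add: prod.remove)
      finally show "(\<Sum>i\<in>{1..k}. if i \<le> ?l j then a i * (R j * \<eta> (?l j - i)) else 0)
        = of_nat (?l j) * (\<Prod>i\<in>?K. \<eta> (?l i))" .
    qed
    also have "\<dots> = of_nat k * (\<Prod>i\<in>?K. \<eta> (?l i))"
      using True by (simp add: sum_distrib_right[symmetric] mdeg_def of_nat_sum[symmetric] del: of_nat_sum)
    finally show ?thesis
      using True unfolding rhs by (simp add: sym_H_def)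
  qed
qed

lemma sym_h_in_Sym: "sym_h k \<in> Sym"
  by (simp add: sym_h_eq_sym_H sym_H_in_Sym)

lemma sym_h_0: "sym_h 0 = 1"
  by (simp add: sym_h_eq_sym_H sym_H_0)

lemma sym_h_newton:
  "mps_scale (of_nat k) (sym_h k) = (\<Sum>i\<in>{1..k}. sym_p i * sym_h (k - i))"
  using sym_H_newton[of "\<lambda>_. 1" "\<lambda>_. 1" k] by (simp add: sym_h_eq_sym_H)

lemma sym_alg_homD:
  assumes "sym_alg_hom sc \<phi>" "f \<in> Sym" "g \<in> Sym"
  shows "\<phi> (f + g) = \<phi> f + \<phi> g" "\<phi> (f * g) = \<phi> f * \<phi> g" "\<phi> (mps_scale c f) = sc c (\<phi> f)"
  using assms unfolding sym_alg_hom_def by blast+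

lemma sym_alg_hom_sum:
  fixes sc :: "'k::field_char_0 \<Rightarrow> 'b::comm_ring_1 \<Rightarrow> 'b"
  assumes "sym_alg_hom sc \<phi>" and "\<And>i. i \<in> A \<Longrightarrow> f i \<in> Sym"
  shows "\<phi> (\<Sum>i\<in>A. f i) = (\<Sum>i\<in>A. \<phi> (f i))"
proof -
  have add: "\<phi> (f + g) = \<phi> f + \<phi> g" if "f \<in> Sym" "g \<in> Sym" for f g
    by (rule sym_alg_homD(1)[OF assms(1) that])
  have "\<phi> 0 = 0"
    using add[OF Sym_zero Sym_zero] by simp
  with assms(2) show ?thesis
  proof (induction A rule: infinite_finite_induct)
    case (insert i A)
    then have "\<phi> (f i + sum f A) = \<phi> (f i) + \<phi> (sum f A)"
      by (intro add Sym_sum) auto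
    with insert show ?case
      by simp
  qed simp_all
qed

lemma sym_alg_hom_newton:
  fixes sc :: "'k::field_char_0 \<Rightarrow> 'b::comm_ring_1 \<Rightarrow> 'b"
  assumes hom: "sym_alg_hom sc \<phi>"
  shows "sc (of_nat k) (\<phi> (sym_h k)) = (\<Sum>i\<in>{1..k}. \<phi> (sym_p i) * \<phi> (sym_h (k - i)))"
proof -
  have "sc (of_nat k) (\<phi> (sym_h k)) = \<phi> (mps_scale (of_nat k) (sym_h k))"
    by (rule sym_alg_homD(3)[OF hom sym_h_in_Sym sym_h_in_Sym, symmetric])
  also have "\<dots> = (\<Sum>i\<in>{1..k}. \<phi> (sym_p i * sym_h (k - i)))"
    unfolding sym_h_newton by (intro sym_alg_hom_sum[OF hom] Sym_mult sym_p_in_Sym sym_h_in_Sym) auto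
  also have "\<dots> = (\<Sum>i\<in>{1..k}. \<phi> (sym_p i) * \<phi> (sym_h (k - i)))"
    by (intro sum.cong sym_alg_homD(2)[OF hom] sym_p_in_Sym sym_h_in_Sym) auto
  finally show ?thesis .
qed

lemma h_angle_0: "h_angle a 0 = 1"
  using sym_kappa_spec(1)[of a] by (simp add: h_angle_def sym_h_0 sym_alg_hom_def)

lemma h_angle_newton:
  "of_nat n * h_angle a n = (\<Sum>i\<in>{1..n}. a (int i) * h_angle a (n - i))"
  using sym_alg_hom_newton[OF sym_kappa_spec(1), of n a] by (simp add: h_angle_def sym_kappa_spec(2))

text \<open>Both sides are 1 at \<open>k = 0\<close> and obey the same Newton recursion: the left by
  applying the homomorphism to the recursion of \<open>h_k\<close>, the right by
  \<open>sym_H_newton\<close>. The factor \<open>k\<close> cancels in characteristic 0.\<close>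

lemma h_bracket_eq: "h_bracket a k = sym_H (h_angle a) k"
proof (induction k rule: less_induct)
  case (less k)
  show ?case
  proof (cases "k = 0")
    case True
    then show ?thesis
      using sym_theta_spec(1)[of a]
      by (simp add: h_bracket_def sym_h_0 sym_H_0 h_angle_0 sym_alg_hom_def)
  next
    case False
    have "mps_scale (of_nat k) (h_bracket a k)
      = (\<Sum>i\<in>{1..k}. mps_scale (a (int i)) (sym_p i * h_bracket a (k - i)))"
      using sym_alg_hom_newton[OF sym_theta_spec(1), of k a]
      by (simp add: h_bracket_def sym_theta_spec(3) mps_scale_mult_left)
    also have "\<dots> = (\<Sum>i\<in>{1..k}. mps_scale (a (int i)) (sym_p i * sym_H (h_angle a) (k - i)))"
      using less by (intro sum.cong) auto
    also have "\<dots> = mps_scale (of_nat k) (sym_H (h_angle a) k)"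
      using sym_H_newton[of "h_angle a" "\<lambda>i. a (int i)"] by (simp add: h_angle_0 h_angle_newton)
    finally show ?thesis
      using False by simp
  qed
qed

section \<open>Splitting off the first variable\<close>

text \<open>Shifting an infinite alphabet by one frees a first variable. A series in
  \<open>x_1, x_2, ...\<close> is thereby a series in \<open>x_1\<close> whose coefficients are
  series of the same kind.\<close>

definition mono_cons :: "nat \<Rightarrow> (nat \<Rightarrow>\<^sub>0 nat) \<Rightarrow> (nat \<Rightarrow>\<^sub>0 nat)" where
  "mono_cons k w = Abs_poly_mapping (\<lambda>i. case i of 0 \<Rightarrow> k | Suc j \<Rightarrow> lookup w j)"

lemma lookup_mono_cons:
  "lookup (mono_cons k w) i = (case i of 0 \<Rightarrow> k | Suc j \<Rightarrow> lookup w j)"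
proof -
  have "finite {i. (case i of 0 \<Rightarrow> k | Suc j \<Rightarrow> lookup w j) \<noteq> 0}"
  proof (rule finite_subset)
    show "{i. (case i of 0 \<Rightarrow> k | Suc j \<Rightarrow> lookup w j) \<noteq> 0}
      \<subseteq> insert 0 (Suc ` keys w)"
    proof
      fix i assume "i \<in> {i. (case i of 0 \<Rightarrow> k | Suc j \<Rightarrow> lookup w j) \<noteq> 0}"
      then show "i \<in> insert 0 (Suc ` keys w)"
        by (cases i) (simp_all add: in_keys_iff)
    qed
  qed simp
  then show ?thesis
    by (simp add: mono_cons_def)
qed

lemma lookup_mono_cons_simps [simp]:
  "lookup (mono_cons k w) 0 = k"
  "lookup (mono_cons k w) (Suc j) = lookup w j"
  by (simp_all add: lookup_mono_cons)

lemma mono_cons_inject: "mono_cons k w = mono_cons k' w' \<longleftrightarrow> k = k' \<and> w = w'"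
  by (metis lookup_mono_cons_simps poly_mapping_eqI)

lemma mono_cons_0_0: "mono_cons 0 0 = 0"
  by (rule poly_mapping_eqI) (simp add: lookup_mono_cons split: nat.splits)

lemma mono_cons_eq_0_iff: "mono_cons k w = 0 \<longleftrightarrow> k = 0 \<and> w = 0"
  by (metis mono_cons_0_0 mono_cons_inject)

lemma mono_cons_add: "mono_cons k w + mono_cons k' w' = mono_cons (k + k') (w + w')"
  by (rule poly_mapping_eqI) (simp add: lookup_mono_cons lookup_add split: nat.splits)

lemma mono_cons_surj: "\<exists>k w. u = mono_cons k w"
proof (intro exI)
  show "u = mono_cons (lookup u 0) (Poly_Mapping.map_key Suc u)"
    by (rule poly_mapping_eqI) (simp add: lookup_mono_cons map_key.rep_eq split: nat.splits)
qed

lemma keys_mono_cons: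
  "keys (mono_cons k w) = (if k = 0 then {} else {0}) \<union> Suc ` keys w"
proof (rule set_eqI)
  fix i
  show "i \<in> keys (mono_cons k w)
    \<longleftrightarrow> i \<in> (if k = 0 then {} else {0}) \<union> Suc ` keys w"
    by (cases i) (simp_all add: in_keys_iff image_iff)
qed

text \<open>Deleting the first variable often enough turns any finitely supported monomial into 0.
  This is the induction behind all statements on words of operators.\<close>

lemma mono_cons_induct [case_names zero cons]:
  assumes "P 0" and step: "\<And>k w. P w \<Longrightarrow> P (mono_cons k w)"
  shows "P w"
proof -
  have "P w" if "\<And>i. lookup w i \<noteq> 0 \<Longrightarrow> i < n" for n
    using that
  proof (induction n arbitrary: w)
    case 0
    then have "w = 0"
      by (intro poly_mapping_eqI) auto
    with assms show ?case
      by simp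
  next
    case (Suc n)
    obtain k u where w: "w = mono_cons k u"
      using mono_cons_surj by blast
    have "P u"
      by (rule Suc.IH) (use Suc.prems[of "Suc _"] w in auto)
    then show ?case
      unfolding w by (rule step)
  qed
  then show ?thesis
    using in_keys_less_degree in_keys_iff by metis
qed

lemma vals_mono_cons: "vals (mono_cons k w) = (if k = 0 then {#} else {#k#}) + vals w"
proof -
  have "mset_set (Suc ` keys w) = image_mset Suc (mset_set (keys w))"
    by (simp add: image_mset_mset_set)
  then show ?thesis
    by (auto simp: vals_def keys_mono_cons multiset.map_comp comp_def)
qed

lemma mdeg_mono_cons: "mdeg (mono_cons k w) = k + mdeg w"
  by (simp add: sum_mset_vals[symmetric] vals_mono_cons)

lemma sum_splits_mono_cons:
  "(\<Sum>p\<in>{p. fst p + snd p = mono_cons k w}. g (fst p) (snd p))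
    = (\<Sum>i\<le>k. \<Sum>p\<in>{p. fst p + snd p = w}. g (mono_cons i (fst p)) (mono_cons (k - i) (snd p)))"
proof -
  have "(\<Sum>i\<le>k. \<Sum>p\<in>{p. fst p + snd p = w}. g (mono_cons i (fst p)) (mono_cons (k - i) (snd p)))
    = (\<Sum>(i, p)\<in>{..k} \<times> {p. fst p + snd p = w}. g (mono_cons i (fst p)) (mono_cons (k - i) (snd p)))"
    by (rule sum.cartesian_product)
  also have "\<dots> = (\<Sum>p\<in>(\<lambda>(i, p). (mono_cons i (fst p), mono_cons (k - i) (snd p))) ` ({..k} \<times> {p. fst p + snd p = w}).
      g (fst p) (snd p))"
    by (subst sum.reindex) (auto simp: inj_on_def mono_cons_inject split_def)
  also have "(\<lambda>(i, p). (mono_cons i (fst p), mono_cons (k - i) (snd p))) ` ({..k} \<times> {p. fst p + snd p = w})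
    = {p. fst p + snd p = mono_cons k w}" (is "?L = ?R")
  proof
    show "?L \<subseteq> ?R"
      by (auto simp: mono_cons_add)
    show "?R \<subseteq> ?L"
    proof
      fix p assume p: "p \<in> ?R"
      obtain i u j v where uv: "fst p = mono_cons i u" "snd p = mono_cons j v"
        using mono_cons_surj by metis
      then have "k = i + j" "w = u + v"
        using p by (auto simp: mono_cons_add mono_cons_inject)
      then show "p \<in> ?L"
        using uv by (intro image_eqI[of _ _ "(i, (u, v))"]) (auto simp: prod_eq_iff)
    qed
  qed
  finally show ?thesis ..
qed

text \<open>Restricted to symmetric functions, \<open>T\<^sub>k\<close> is the operator \<open>h\<^sub>k\<^sup>\<perp>\<close>.\<close>

definition sym_T :: "nat \<Rightarrow> (nat, 'k::comm_ring_1) mps \<Rightarrow> (nat, 'k) mps" where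
  "sym_T k f = Abs_mps (\<lambda>w. mps_coeff f (mono_cons k w))"

lemma mps_coeff_sym_T [simp]: "mps_coeff (sym_T k f) w = mps_coeff f (mono_cons k w)"
  by (simp add: sym_T_def)

lemma sym_T_add: "sym_T k (f + g) = sym_T k f + sym_T k g"
  by (rule mps_eqI) simp

lemma sym_T_scale: "sym_T k (mps_scale c f) = mps_scale c (sym_T k f)"
  by (rule mps_eqI) simp

lemma sym_T_zero: "sym_T k 0 = 0"
  by (rule mps_eqI) simp

lemma sym_T_one: "sym_T k 1 = (if k = 0 then 1 else 0)"
  by (rule mps_eqI) (simp add: mps_coeff_one mono_cons_eq_0_iff)

lemma sym_T_sum: "sym_T k (\<Sum>i\<in>A. f i) = (\<Sum>i\<in>A. sym_T k (f i))"
  by (rule mps_eqI) simp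

text \<open>The coefficient of a power of the first variable in a product is a Cauchy product. On
  symmetric functions this is the coproduct \<open>\<Sum> h_i \<otimes> h_(k-i)\<close> of
  \<open>h_k\<close>.\<close>

lemma sym_T_times: "sym_T k (f * g) = (\<Sum>i\<le>k. sym_T i f * sym_T (k - i) g)"
  by (rule mps_eqI)
    (simp add: mps_coeff_times sum_splits_mono_cons[of "\<lambda>u v. mps_coeff f u * mps_coeff g v"])

text \<open>Reads off coefficients from
  \<open>p_j(x_1, x_2, ...) = x_1^j + p_j(x_2, ...)\<close>.\<close>

lemma sym_T_sym_p:
  assumes "j \<ge> 1"
  shows "sym_T k (sym_p j) = (if k = 0 then sym_p j else if k = j then 1 else 0)"
proof (rule mps_eqI)
  fix w
  have "(\<exists>i. mono_cons k w = single i j)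
    \<longleftrightarrow> (k = 0 \<and> (\<exists>i. w = single i j)) \<or> (k = j \<and> w = 0)" (is "?L \<longleftrightarrow> ?R")
  proof
    assume ?L
    then obtain i where i: "mono_cons k w = single i j"
      by auto
    have *: "lookup (mono_cons k w) x = (if x = i then j else 0)" for x
      unfolding i by (simp add: lookup_single)
    show ?R
    proof (cases i)
      case 0
      then have "k = j"
        using *[of 0] by simp
      moreover have "w = 0"
        using *[of "Suc _"] 0 by (intro poly_mapping_eqI) simp
      ultimately show ?thesis by simp
    next
      case (Suc i')
      then have "k = 0"
        using *[of 0] by simp
      moreover have "w = single i' j"
        using *[of "Suc _"] Suc by (intro poly_mapping_eqI) (simp add: lookup_single)
      ultimately show ?thesis by auto
    qed
  next
    have "mono_cons 0 (single i j) = single (Suc i) j" for i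
      by (rule poly_mapping_eqI) (simp add: lookup_mono_cons lookup_single split: nat.splits)
    moreover have "mono_cons j 0 = single 0 j"
      by (rule poly_mapping_eqI) (simp add: lookup_mono_cons lookup_single split: nat.splits)
    moreover assume ?R
    ultimately show ?L
      by metis
  qed
  moreover have "0 \<noteq> single i j" for i :: nat
    using assms by (metis lookup_single_eq lookup_zero not_one_le_zero)
  ultimately show "mps_coeff (sym_T k (sym_p j)) w
    = mps_coeff (if k = 0 then sym_p j else if k = j then 1 else 0) w"
    using assms by (auto simp: mps_coeff_sym_p mps_coeff_one)
qed

lemma sym_T_sym_p_times:
  assumes "j \<ge> 1"
  shows "sym_T k (sym_p j * f) = sym_p j * sym_T k f + (if j \<le> k then sym_T (k - j) f else 0)"
proof -
  have "sym_T k (sym_p j * f) = (\<Sum>i\<le>k. (if i = 0 then sym_p j * sym_T (k - i) f else 0)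
      + (if i = j then sym_T (k - i) f else 0))"
    unfolding sym_T_times by (rule sum.cong) (use assms in \<open>auto simp: sym_T_sym_p\<close>)
  then show ?thesis
    by (simp add: sum.distrib)
qed

text \<open>The series \<open>\<Prod>_i \<Sum>_n \<eta>_n x_i^n\<close> factors over the variables,
  and without its first factor it keeps its shape. Together with \<open>sym_T_times\<close> this is
  the commutation rule of \<open>h_k^\<perp>\<close> with multiplication by
  \<open>h_l[a_i]\<close>.\<close>

lemma sym_T_sym_H:
  assumes "\<eta> 0 = 1"
  shows "sym_T k (sym_H \<eta> l) = (if k \<le> l then mps_scale (\<eta> k) (sym_H \<eta> (l - k)) else 0)"
  using assms by (intro mps_eqI) (auto simp: mps_coeff_sym_H mdeg_mono_cons vals_mono_cons)

lemma sym_T_in_Sym: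
  assumes "f \<in> Sym"
  shows "sym_T k f \<in> Sym"
proof -
  obtain d where d: "\<And>w. mps_coeff f w \<noteq> 0 \<Longrightarrow> mdeg w \<le> d"
    using Sym_bounded[OF assms] by blast
  show ?thesis
  proof (rule SymI)
    show "mdeg w \<le> d" if "mps_coeff (sym_T k f) w \<noteq> 0" for w
      using d[of "mono_cons k w"] that by (simp add: mdeg_mono_cons)
    show "mps_coeff (sym_T k f) (Poly_Mapping.map_key \<pi> w) = mps_coeff (sym_T k f) w" if "bij \<pi>" for \<pi> w
      unfolding mps_coeff_sym_T
      by (rule Sym_vals[OF assms]) (simp add: vals_mono_cons vals_map_key[OF that])
  qed
qed

section \<open>The Hall inner product\<close>

definition z_mset :: "nat multiset \<Rightarrow> nat" where
  "z_mset M = (\<Prod>i\<in>set_mset M. i ^ count M i * fact (count M i))"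

lemma z_part_eq: "z_part l = z_mset (mset l)"
  by (simp add: z_part_def z_mset_def count_mset)

lemma z_mset_pos: "0 \<notin># M \<Longrightarrow> z_mset M > 0"
  unfolding z_mset_def
proof (rule prod_pos)
  fix i assume "0 \<notin># M" "i \<in># M"
  then have "i \<noteq> 0"
    by metis
  then show "0 < i ^ count M i * fact (count M i)"
    by simp
qed

text \<open>The extra factor is exactly what makes \<open>j d/dp_j\<close> adjoint to multiplication
  by \<open>p_j\<close>.\<close>

lemma z_mset_add_mset: "z_mset (add_mset j M) = j * Suc (count M j) * z_mset M"
proof -
  let ?f = "\<lambda>M i. i ^ count M i * fact (count M i) :: nat"
  have z: "z_mset N = (\<Prod>i\<in>insert j (set_mset M). ?f N i)" if "set_mset N \<subseteq> insert j (set_mset M)" for N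
    unfolding z_mset_def by (rule prod.mono_neutral_left) (use that in \<open>auto simp: not_in_iff\<close>)
  have "z_mset (add_mset j M) = ?f (add_mset j M) j * (\<Prod>i\<in>insert j (set_mset M) - {j}. ?f (add_mset j M) i)"
    unfolding z[of "add_mset j M", OF subset_refl[THEN subset_trans, OF eq_refl[OF set_mset_add_mset_insert]]]
    by (rule prod.remove) simp_all
  also have "(\<Prod>i\<in>insert j (set_mset M) - {j}. ?f (add_mset j M) i) = (\<Prod>i\<in>insert j (set_mset M) - {j}. ?f M i)"
    by (rule prod.cong) auto
  also have "?f (add_mset j M) j = j * Suc (count M j) * ?f M j"
    by (simp add: algebra_simps)
  also have "j * Suc (count M j) * ?f M j * (\<Prod>i\<in>insert j (set_mset M) - {j}. ?f M i)
    = j * Suc (count M j) * (\<Prod>i\<in>insert j (set_mset M). ?f M i)"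
    by (subst prod.remove[of "insert j (set_mset M)" j]) auto
  also have "(\<Prod>i\<in>insert j (set_mset M). ?f M i) = z_mset M"
    by (rule z[of M, symmetric]) auto
  finally show ?thesis .
qed

lemma mset_all_partitions:
  shows "l \<in> all_partitions \<Longrightarrow> 0 \<notin># mset l"
    and "0 \<notin># M \<Longrightarrow> \<exists>l\<in>partitions (sum_mset M). mset l = M"
    and "l \<in> all_partitions \<Longrightarrow> l' \<in> all_partitions \<Longrightarrow> mset l = mset l' \<Longrightarrow> l = l'"
proof -
  show "l \<in> all_partitions \<Longrightarrow> 0 \<notin># mset l"
    by (force simp: all_partitions_def partitions_def)
  show "\<exists>l\<in>partitions (sum_mset M). mset l = M" if "0 \<notin># M"
  proof
    let ?l = "rev (sorted_list_of_multiset M)"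
    have "sorted_wrt (\<ge>) ?l"
      by (simp add: sorted_wrt_rev)
    then show "?l \<in> partitions (sum_mset M)"
      using that by (auto simp: partitions_def Suc_le_eq sum_mset_sum_list[symmetric] intro: gr0I)
    show "mset ?l = M"
      by simp
  qed
  show "l = l'" if "l \<in> all_partitions" "l' \<in> all_partitions" "mset l = mset l'"
  proof -
    have "sorted (rev l)" "sorted (rev l')"
      using that(1,2) by (auto simp: all_partitions_def partitions_def sorted_wrt_rev)
    moreover have "mset (rev l) = mset (rev l')"
      using that(3) by simp
    ultimately have "rev l = rev l'"
      by (metis properties_for_sort)
    then show ?thesis
      by simp
  qed
qed

text \<open>The form is diagonal in coordinates with respect to the products of power sums; vectors
  have finitely many nonzero coordinates, and \<open>inv_into\<close> recovers the multiset of a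
  basis element.\<close>

lemma ex_hall_form:
  "\<exists>H :: (nat, 'k::field_char_0) mps \<Rightarrow> _ \<Rightarrow> 'k. sym_bilinear H \<and>
    (\<forall>M N. 0 \<notin># M \<longrightarrow> 0 \<notin># N \<longrightarrow> H (sym_pm M) (sym_pm N) = (if M = N then of_nat (z_mset M) else 0))"
proof -
  let ?p = "sym_pm :: _ \<Rightarrow> (nat, 'k) mps"
  let ?B = "?p ` pos_msets"
  let ?rep = "mps.representation ?B"
  define z :: "(nat, 'k) mps \<Rightarrow> 'k" where "z x = of_nat (z_mset (inv_into pos_msets ?p x))" for x
  define H where "H f g = Sum_any (\<lambda>x. ?rep f x * ?rep g x * z x)" for f g
  have fin: "finite {x. ?rep f x * ?rep g x * z x \<noteq> 0}" for f g
    by (rule finite_subset[OF _ mps.finite_representation[of ?B f]]) auto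
  note rep_add = mps.representation_add[OF independent_sym_pm[where ?'k = 'k]]
  note rep_scale = mps.representation_scale[OF independent_sym_pm[where ?'k = 'k]]
  note rep_basis = mps.representation_basis[OF independent_sym_pm[where ?'k = 'k]]
  have sym: "H f g = H g f" for f g
    by (simp add: H_def mult.commute)
  have add: "H (f + g) h = H f h + H g h" if "f \<in> Sym" "g \<in> Sym" for f g h
  proof -
    have "H (f + g) h = Sum_any (\<lambda>x. ?rep f x * ?rep h x * z x + ?rep g x * ?rep h x * z x)"
      using that by (simp add: H_def Sym_eq_span rep_add distrib_right)
    also have "\<dots> = H f h + H g h"
      unfolding H_def by (rule Sum_any.distrib) (rule fin)+
    finally show ?thesis .
  qed
  have scale: "H (mps_scale c f) h = c * H f h" if "f \<in> Sym" for c f h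
    using that fin unfolding H_def Sym_eq_span
    by (subst rep_scale) (simp_all add: Sum_any_right_distrib mult.assoc)
  have "sym_bilinear H"
    unfolding sym_bilinear_def using add scale sym by metis
  moreover have "H (?p M) (?p N) = (if M = N then of_nat (z_mset M) else 0)"
    if "0 \<notin># M" "0 \<notin># N" for M N
  proof -
    have "H (?p M) (?p N) = Sum_any (\<lambda>x. if x = ?p M then (if ?p M = ?p N then z (?p M) else 0) else 0)"
      unfolding H_def using that by (intro Sum_any.cong) (simp add: rep_basis)
    also have "\<dots> = (if ?p M = ?p N then z (?p M) else 0)"
      by simp
    also have "\<dots> = (if M = N then of_nat (z_mset M) else 0)"
      using that inj_on_eq_iff[OF inj_on_sym_pm[where ?'k = 'k], of M N]
      by (simp add: z_def inv_into_f_f[OF inj_on_sym_pm])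
    finally show ?thesis .
  qed
  ultimately show ?thesis
    by blast
qed

lemma hall_spec:
  shows "sym_bilinear (hall :: (nat, 'k::field_char_0) mps \<Rightarrow> _ \<Rightarrow> 'k)"
    and "0 \<notin># M \<Longrightarrow> 0 \<notin># N \<Longrightarrow>
      hall (sym_pm M :: (nat, 'k) mps) (sym_pm N) = (if M = N then of_nat (z_mset M) else 0)"
proof -
  \<comment> \<open>Sorted lists of positive parts and multisets without 0 are the same indices. The
    equivalence is stated for every \<open>H\<close> so that it can rewrite the predicate under the
    choice operator.\<close>
  have iff: "(\<forall>l\<in>all_partitions. \<forall>m\<in>all_partitions.
      H (sym_p_part l) (sym_p_part m) = (if l = m then of_nat (z_part l) else 0))
    \<longleftrightarrow> (\<forall>M N. 0 \<notin># M \<longrightarrow> 0 \<notin># N \<longrightarrow> H (sym_pm M) (sym_pm N) = (if M = N then of_nat (z_mset M) else 0))"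
    (is "?L \<longleftrightarrow> ?R") for H :: "(nat, 'k) mps \<Rightarrow> _ \<Rightarrow> 'k"
  proof
    assume L: ?L
    show ?R
    proof (intro allI impI)
      fix M N :: "nat multiset" assume "0 \<notin># M" "0 \<notin># N"
      then obtain l m where "l \<in> partitions (sum_mset M)" "m \<in> partitions (sum_mset N)"
          "mset l = M" "mset m = N"
        using mset_all_partitions(2) by meson
      then have "l \<in> all_partitions" "m \<in> all_partitions" "mset l = M" "mset m = N"
        by (simp_all only: all_partitions_def) blast+
      then show "H (sym_pm M) (sym_pm N) = (if M = N then of_nat (z_mset M) else 0)"
        using L mset_all_partitions(3)[of l m] by (auto simp: sym_p_part_eq z_part_eq)
    qed
  next
    assume R: ?R
    show ?L
    proof (intro ballI)
      fix l m assume lm: "l \<in> all_partitions" "m \<in> all_partitions"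
      then show "H (sym_p_part l) (sym_p_part m) = (if l = m then of_nat (z_part l) else 0)"
        using R mset_all_partitions(1)[OF lm(1)] mset_all_partitions(1)[OF lm(2)]
          mset_all_partitions(3)[OF lm] by (auto simp: sym_p_part_eq z_part_eq)
    qed
  qed
  have "sym_bilinear (hall :: (nat, 'k) mps \<Rightarrow> _ \<Rightarrow> 'k) \<and> (\<forall>M N. 0 \<notin># M \<longrightarrow> 0 \<notin># N \<longrightarrow>
      hall (sym_pm M :: (nat, 'k) mps) (sym_pm N) = (if M = N then of_nat (z_mset M) else 0))"
    unfolding hall_def iff by (rule someI_ex[OF ex_hall_form])
  then show "sym_bilinear (hall :: (nat, 'k) mps \<Rightarrow> _ \<Rightarrow> 'k)"
    "0 \<notin># M \<Longrightarrow> 0 \<notin># N \<Longrightarrow>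
      hall (sym_pm M :: (nat, 'k) mps) (sym_pm N) = (if M = N then of_nat (z_mset M) else 0)"
    by blast+
qed

lemma hall_bilinear:
  fixes f g h :: "(nat, 'k::field_char_0) mps"
  assumes "f \<in> Sym" "g \<in> Sym" "h \<in> Sym"
  shows "hall (f + g) h = hall f h + hall g h" "hall f (g + h) = hall f g + hall f h"
    "hall (mps_scale c f) g = c * hall f g" "hall f (mps_scale c g) = c * hall f g"
  using hall_spec(1)[where ?'k = 'k] assms unfolding sym_bilinear_def by blast+

lemma hall_zero:
  fixes f :: "(nat, 'k::field_char_0) mps"
  assumes "f \<in> Sym"
  shows "hall 0 f = 0" "hall f 0 = 0"
  using hall_bilinear(1)[OF Sym_zero Sym_zero assms] hall_bilinear(2)[OF assms Sym_zero Sym_zero]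
  by simp_all

lemma hall_sum_right:
  assumes "finite A" "f \<in> Sym" "\<And>i. i \<in> A \<Longrightarrow> g i \<in> Sym"
  shows "hall f (\<Sum>i\<in>A. g i) = (\<Sum>i\<in>A. hall f (g i))"
  using assms(1,3)
proof (induction A rule: finite_induct)
  case (insert i A)
  then have "hall f (g i + sum g A) = hall f (g i) + hall f (sum g A)"
    by (intro hall_bilinear(2) assms(2) Sym_sum) auto
  with insert show ?case
    by simp
qed (simp add: hall_zero assms)

section \<open>Adjoints of multiplication by \<open>p_j\<close> and \<open>h_k\<close>\<close>

text \<open>The derivation \<open>j d/dp_j\<close>. If \<open>j\<close> is not a part of
  \<open>M\<close>, the difference \<open>M - {#j#}\<close> is \<open>M\<close>, but the scalar is
  0.\<close>

definition sym_dp :: "nat \<Rightarrow> (nat, 'k::field_char_0) mps \<Rightarrow> (nat, 'k) mps" where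
  "sym_dp j = (SOME L. (\<forall>x y. L (x + y) = L x + L y) \<and> (\<forall>c x. L (mps_scale c x) = mps_scale c (L x)) \<and>
    (\<forall>M. 0 \<notin># M \<longrightarrow> L (sym_pm M) = mps_scale (of_nat (j * count M j)) (sym_pm (M - {#j#}))))"

lemma sym_dp_spec:
  fixes x y :: "(nat, 'k::field_char_0) mps"
  shows "sym_dp j (x + y) = sym_dp j x + sym_dp j y"
    and "sym_dp j (mps_scale c x) = mps_scale c (sym_dp j x)"
    and "0 \<notin># M \<Longrightarrow> (sym_dp j (sym_pm M) :: (nat, 'k) mps)
      = mps_scale (of_nat (j * count M j)) (sym_pm (M - {#j#}))"
proof -
  let ?P = "\<lambda>L :: (nat, 'k) mps \<Rightarrow> (nat, 'k) mps.
    (\<forall>x y. L (x + y) = L x + L y) \<and> (\<forall>c x. L (mps_scale c x) = mps_scale c (L x)) \<and>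
    (\<forall>M. 0 \<notin># M \<longrightarrow> L (sym_pm M) = mps_scale (of_nat (j * count M j)) (sym_pm (M - {#j#})))"
  have "?P (sym_dp j)"
    unfolding sym_dp_def by (rule someI_ex[of ?P], rule ex_linear_on_sym_pm[OF mps.vector_space_axioms])
  then show "sym_dp j (x + y) = sym_dp j x + sym_dp j y"
    "sym_dp j (mps_scale c x) = mps_scale c (sym_dp j x)"
    "0 \<notin># M \<Longrightarrow> (sym_dp j (sym_pm M) :: (nat, 'k) mps)
      = mps_scale (of_nat (j * count M j)) (sym_pm (M - {#j#}))"
    by blast+
qed

lemma sym_dp_zero [simp]: "sym_dp j (0 :: (nat, 'k::field_char_0) mps) = 0"
  using sym_dp_spec(1)[of j "0 :: (nat, 'k) mps" 0] by simp

lemma sym_dp_sum: "sym_dp j (\<Sum>i\<in>A. f i) = (\<Sum>i\<in>A. sym_dp j (f i))"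
  by (induction A rule: infinite_finite_induct) (simp_all add: sym_dp_spec(1))

lemma sym_dp_in_Sym:
  assumes "f \<in> Sym"
  shows "sym_dp j f \<in> Sym"
  using assms
proof (induction rule: Sym_induct)
  case (step c M g)
  have "0 \<notin># M - {#j#}"
    using step(1) by (meson in_diffD)
  then have "mps_scale c (mps_scale (of_nat (j * count M j)) (sym_pm (M - {#j#}))) + sym_dp j g \<in> Sym"
    by (intro Sym_add Sym_scale sym_pm_in_Sym step(3))
  then show ?case
    by (simp only: sym_dp_spec(1,2) sym_dp_spec(3)[OF step(1)])
qed (simp add: Sym_zero)

lemma sym_dp_times:
  fixes f g :: "(nat, 'k::field_char_0) mps"
  assumes "f \<in> Sym" "g \<in> Sym"
  shows "sym_dp j (f * g) = sym_dp j f * g + f * sym_dp j g"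
  using assms(1)
proof (induction rule: Sym_induct)
  case (step c M f)
  have "sym_dp j (sym_pm M * g) = sym_dp j (sym_pm M) * g + sym_pm M * sym_dp j g"
    using assms(2)
  proof (induction rule: Sym_induct)
    case (step d N g)
    have l: "mps_scale (of_nat (j * count K j)) (sym_pm (K - {#j#})) * sym_pm L
      = mps_scale (of_nat (j * count K j) :: 'k) (sym_pm (K + L - {#j#}))" for K L
    proof (cases "j \<in># K")
      case True
      then have "K + L - {#j#} = K - {#j#} + L"
        by simp
      then show ?thesis
        by (simp only: sym_pm_union mps_scale_mult_left)
    next
      case False
      then have "count K j = 0"
        by (simp add: not_in_iff)
      then show ?thesis
        by simp
    qed
    have "sym_dp j (sym_pm (M + N)) = mps_scale (of_nat (j * count (M + N) j) :: 'k) (sym_pm (M + N - {#j#}))"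
      using step(1) \<open>0 \<notin># M\<close> by (intro sym_dp_spec(3)) simp
    also have "\<dots> = mps_scale (of_nat (j * count M j)) (sym_pm (M + N - {#j#}))
        + mps_scale (of_nat (j * count N j)) (sym_pm (N + M - {#j#}))"
      by (simp add: mps.scale_left_distrib[symmetric] distrib_left add.commute)
    also have "\<dots> = sym_dp j (sym_pm M) * sym_pm N + sym_pm M * sym_dp j (sym_pm N)"
      unfolding l[symmetric] sym_dp_spec(3)[OF step(1)] sym_dp_spec(3)[OF \<open>0 \<notin># M\<close>]
      by (simp only: mult.commute)
    finally have "sym_dp j (sym_pm M * sym_pm N) = sym_dp j (sym_pm M) * sym_pm N + sym_pm M * sym_dp j (sym_pm N :: (nat, 'k) mps)"
      by (simp only: sym_pm_union)
    then show ?case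
      using step(3)
      by (simp add: sym_dp_spec(1,2) distrib_left mps_scale_mult_right mps.scale_right_distrib add_ac)
  qed simp
  then show ?case
    using step(3)
    by (simp add: sym_dp_spec(1,2) distrib_left distrib_right mps_scale_mult_left mps.scale_right_distrib add_ac)
qed simp

lemma sym_dp_sym_p:
  assumes "i \<ge> 1"
  shows "sym_dp j (sym_p i :: (nat, 'k::field_char_0) mps) = (if i = j then mps_scale (of_nat j) 1 else 0)"
proof -
  have "sym_dp j (sym_pm {#i#} :: (nat, 'k) mps)
      = mps_scale (of_nat (j * count {#i#} j)) (sym_pm ({#i#} - {#j#}))"
    using assms by (intro sym_dp_spec(3)) simp
  then show ?thesis
    by (cases "i = j") (simp_all add: sym_p_eq_sym_pm)
qed

lemma sym_dp_one: "sym_dp j (1 :: (nat, 'k::field_char_0) mps) = 0"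
  using sym_dp_spec(3)[of "{#}" j] by simp

text \<open>The generating series of the \<open>h_k\<close> is
  \<open>exp (\<Sum> p_i t^i / i)\<close>, so \<open>j d/dp_j\<close> multiplies it by
  \<open>t^j\<close>. Newton's identity with induction on \<open>k\<close> gives the same without
  exponentials.\<close>

lemma sym_dp_sym_h:
  assumes "j \<ge> 1"
  shows "sym_dp j (sym_h k :: (nat, 'k::field_char_0) mps) = (if j \<le> k then sym_h (k - j) else 0)"
proof (induction k rule: less_induct)
  case (less k)
  let ?h = "sym_h :: nat \<Rightarrow> (nat, 'k) mps"
  show ?case
  proof (cases "k = 0")
    case True
    then show ?thesis
      using assms by (simp add: sym_h_0 sym_dp_one)
  next
    case False
    have "mps_scale (of_nat k) (sym_dp j (?h k)) = sym_dp j (\<Sum>i\<in>{1..k}. sym_p i * ?h (k - i))"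
      by (simp only: sym_dp_spec(2)[symmetric] sym_h_newton)
    also have "\<dots> = (\<Sum>i\<in>{1..k}. sym_dp j (sym_p i) * ?h (k - i) + sym_p i * sym_dp j (?h (k - i)))"
      unfolding sym_dp_sum by (intro sum.cong sym_dp_times sym_p_in_Sym sym_h_in_Sym) auto
    also have "\<dots> = (\<Sum>i\<in>{1..k}. (if i = j then mps_scale (of_nat j) (?h (k - i)) else 0)
        + (if j \<le> k - i then sym_p i * ?h (k - i - j) else 0))"
      by (rule sum.cong) (auto simp: sym_dp_sym_p less.IH mps_scale_mult_left)
    also have "\<dots> = (if j \<le> k then mps_scale (of_nat j) (?h (k - j)) else 0)
        + (\<Sum>i\<in>{1..k}. if j \<le> k - i then sym_p i * ?h (k - i - j) else 0)"
      using assms by (simp add: sum.distrib)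
    also have "(\<Sum>i\<in>{1..k}. if j \<le> k - i then sym_p i * ?h (k - i - j) else 0)
        = (\<Sum>i\<in>{1..k - j}. sym_p i * ?h (k - j - i))"
      using assms by (intro sum.mono_neutral_cong_right) (auto simp: diff_diff_add add.commute)
    also have "\<dots> = mps_scale (of_nat (k - j)) (?h (k - j))"
      by (rule sym_h_newton[symmetric])
    \<comment> \<open>For \<open>j > k\<close> truncated subtraction makes the scalar of the second
      summand 0.\<close>
    also have "(if j \<le> k then mps_scale (of_nat j) (?h (k - j)) else 0) + mps_scale (of_nat (k - j)) (?h (k - j))
      = mps_scale (of_nat k) (if j \<le> k then ?h (k - j) else 0)"
      by (auto simp: mps.scale_left_distrib[symmetric] of_nat_diff)
    finally show ?thesis
      using False by simp
  qed
qed

text \<open>On basis elements both sides vanish unless \<open>N\<close> arises from \<open>M\<close>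
  by adding a part \<open>j\<close>, and then the recursion for \<open>z_mset\<close> makes them
  equal.\<close>

lemma hall_sym_p_times:
  fixes f g :: "(nat, 'k::field_char_0) mps"
  assumes j: "j \<ge> 1" and "f \<in> Sym" "g \<in> Sym"
  shows "hall (sym_p j * f) g = hall f (sym_dp j g)"
  using assms(2)
proof (induction rule: Sym_induct)
  case zero
  then show ?case
    using assms by (simp add: hall_zero sym_dp_in_Sym)
next
  case (step c M f)
  have basis: "hall (sym_p j * sym_pm M) g = hall (sym_pm M) (sym_dp j g)"
    using assms(3)
  proof (induction rule: Sym_induct)
    case zero
    then show ?case
      using j \<open>0 \<notin># M\<close> by (simp add: hall_zero sym_p_times_in_Sym sym_pm_in_Sym)
  next
    case (step d N g)
    have jM: "0 \<notin># add_mset j M" and Nj: "0 \<notin># N - {#j#}"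
      using j \<open>0 \<notin># M\<close> step(1) by (auto dest: in_diffD)
    have "hall (sym_p j * sym_pm M) (sym_pm N) = (if add_mset j M = N then of_nat (z_mset N) else (0 :: 'k))"
      using jM step(1) unfolding sym_pm_add_mset[symmetric] by (subst hall_spec(2)) auto
    also have "\<dots> = of_nat (j * count N j) * (if M = N - {#j#} then of_nat (z_mset M) else 0)"
    proof (cases "j \<in># N")
      case True
      then have N: "N = add_mset j (N - {#j#})"
        by simp
      have iff: "add_mset j M = N \<longleftrightarrow> M = N - {#j#}"
        using N by (metis add_mset_remove_trivial)
      show ?thesis
      proof (cases "M = N - {#j#}")
        case True
        then have N: "N = add_mset j M"
          using N by simp
        show ?thesis
          unfolding N z_mset_add_mset by (simp add: algebra_simps)
      next
        case False
        then show ?thesis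
          unfolding iff by simp
      qed
    next
      case False
      then have "count N j = 0" "add_mset j M \<noteq> N"
        by (auto simp: not_in_iff)
      then show ?thesis
        by simp
    qed
    also have "\<dots> = hall (sym_pm M) (sym_dp j (sym_pm N) :: (nat, 'k) mps)"
      using \<open>0 \<notin># M\<close> step(1) Nj
      by (simp only: sym_dp_spec(3) hall_bilinear(4)[OF sym_pm_in_Sym sym_pm_in_Sym Sym_zero] hall_spec(2)
          not_False_eq_True)
    finally have eq: "hall (sym_p j * sym_pm M) (sym_pm N) = hall (sym_pm M) (sym_dp j (sym_pm N) :: (nat, 'k) mps)" .
    have mem: "sym_p j * sym_pm M \<in> (Sym :: (nat, 'k) mps set)" "sym_pm M \<in> (Sym :: (nat, 'k) mps set)"
      "sym_pm N \<in> (Sym :: (nat, 'k) mps set)"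
      using j \<open>0 \<notin># M\<close> step(1) by (simp_all add: sym_p_times_in_Sym sym_pm_in_Sym)
    show ?case
      unfolding sym_dp_spec(1,2) using mem step(2,3)
      by (simp add: hall_bilinear Sym_scale sym_dp_in_Sym eq)
  qed
  have mem: "sym_p j * sym_pm M \<in> (Sym :: (nat, 'k) mps set)" "sym_pm M \<in> (Sym :: (nat, 'k) mps set)"
    "sym_p j * f \<in> Sym" "sym_dp j g \<in> Sym"
    using j step(1,2) assms(3) by (simp_all add: sym_p_times_in_Sym sym_pm_in_Sym sym_dp_in_Sym)
  show ?case
    unfolding distrib_left mps_scale_mult_right using mem step(2,3) assms(3)
    by (simp add: hall_bilinear Sym_scale basis)
qed

lemma hall_one_sym_p_times:
  fixes f :: "(nat, 'k::field_char_0) mps"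
  assumes "j \<ge> 1" "f \<in> Sym"
  shows "hall 1 (sym_p j * f) = 0"
  using assms(2)
proof (induction rule: Sym_induct)
  case zero
  then show ?case
    by (simp add: hall_zero one_in_Sym)
next
  case (step c M f)
  have "hall (sym_pm {#}) (sym_pm (add_mset j M)) = (0 :: 'k)"
    using assms(1) step(1) by (subst hall_spec(2)) auto
  then have "hall 1 (sym_p j * sym_pm M) = (0 :: 'k)"
    by (simp add: sym_pm_add_mset)
  moreover have "sym_p j * sym_pm M \<in> (Sym :: (nat, 'k) mps set)" "sym_p j * f \<in> Sym"
    using assms(1) step(1,2) by (simp_all add: sym_p_times_in_Sym sym_pm_in_Sym)
  ultimately show ?case
    using step(3) by (simp add: distrib_left mps_scale_mult_right hall_bilinear one_in_Sym Sym_scale)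
qed

text \<open>By Newton's identity \<open>k h_k\<close> is a sum of terms divisible by some power sum,
  and multiples of power sums are orthogonal to 1.\<close>

lemma hall_one_sym_h_times:
  fixes g :: "(nat, 'k::field_char_0) mps"
  assumes "k \<ge> 1" "g \<in> Sym"
  shows "hall 1 (sym_h k * g) = 0"
proof -
  have mem: "sym_p i * (sym_h (k - i) * g) \<in> Sym" if "i \<ge> 1" for i
    using that assms(2) by (simp add: sym_p_times_in_Sym Sym_mult sym_h_in_Sym)
  have "of_nat k * hall 1 (sym_h k * g) = hall 1 (mps_scale (of_nat k) (sym_h k * g))"
    by (simp add: hall_bilinear(4)[OF one_in_Sym Sym_mult[OF sym_h_in_Sym assms(2)] Sym_zero])
  also have "mps_scale (of_nat k) (sym_h k * g) = (\<Sum>i\<in>{1..k}. sym_p i * (sym_h (k - i) * g))"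
    by (simp add: mps_scale_mult_left[symmetric] sym_h_newton sum_distrib_right mult.assoc)
  also have "hall 1 \<dots> = (\<Sum>i\<in>{1..k}. hall 1 (sym_p i * (sym_h (k - i) * g)))"
    using mem by (intro hall_sum_right one_in_Sym) auto
  also have "\<dots> = 0"
    using assms(2) by (intro sum.neutral ballI hall_one_sym_p_times Sym_mult sym_h_in_Sym) auto
  finally show ?thesis
    using assms(1) by simp
qed

text \<open>Moved across the form, a factor \<open>p_j\<close> becomes a derivation, which acts on
  \<open>h_k g\<close> by the product rule and sends \<open>h_k\<close> to \<open>h_(k-j)\<close>.
  The two resulting terms match those of \<open>sym_T_sym_p_times\<close>, which closes the
  induction on \<open>M\<close>.\<close>

lemma hall_sym_T_sym_pm:
  fixes g :: "(nat, 'k::field_char_0) mps"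
  assumes "0 \<notin># M" "g \<in> Sym"
  shows "hall (sym_T k (sym_pm M)) g = hall (sym_pm M) (sym_h k * g)"
  using assms
proof (induction M arbitrary: k g)
  case empty
  then show ?case
    by (cases "k = 0") (simp_all add: sym_T_one sym_h_0 hall_one_sym_h_times hall_zero)
next
  case (add j M)
  then have j: "j \<ge> 1" and M: "0 \<notin># M"
    by (auto simp: Suc_le_eq intro: gr0I)
  let ?p = "sym_pm M :: (nat, 'k) mps"
  have pM: "?p \<in> Sym"
    using M by (rule sym_pm_in_Sym)
  have dp: "sym_dp j g \<in> Sym"
    using add.prems(2) by (rule sym_dp_in_Sym)
  have hg: "sym_h k * g \<in> Sym" for k
    using add.prems(2) by (simp add: Sym_mult sym_h_in_Sym)
  have "hall (sym_pm (add_mset j M)) (sym_h k * g) = hall ?p (sym_dp j (sym_h k * g))"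
    unfolding sym_pm_add_mset by (rule hall_sym_p_times[OF j pM hg])
  also have "sym_dp j (sym_h k * g) = sym_h k * sym_dp j g + (if j \<le> k then sym_h (k - j) * g else 0)"
    unfolding sym_dp_times[OF sym_h_in_Sym add.prems(2)] sym_dp_sym_h[OF j]
    by (simp add: add.commute)
  also have "hall ?p \<dots> = hall ?p (sym_h k * sym_dp j g) + hall ?p (if j \<le> k then sym_h (k - j) * g else 0)"
    using pM dp hg by (intro hall_bilinear(2)) (auto simp: Sym_mult sym_h_in_Sym Sym_zero)
  also have "hall ?p (sym_h k * sym_dp j g) = hall (sym_T k ?p) (sym_dp j g)"
    by (rule add.IH[OF M dp, symmetric])
  also have "\<dots> = hall (sym_p j * sym_T k ?p) g"
    by (rule hall_sym_p_times[OF j sym_T_in_Sym[OF pM] add.prems(2), symmetric])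
  also have "hall ?p (if j \<le> k then sym_h (k - j) * g else 0) = hall (if j \<le> k then sym_T (k - j) ?p else 0) g"
    using add.IH[OF M add.prems(2), of "k - j"] pM add.prems(2) by (simp add: hall_zero)
  also have "hall (sym_p j * sym_T k ?p) g + hall (if j \<le> k then sym_T (k - j) ?p else 0) g
    = hall (sym_p j * sym_T k ?p + (if j \<le> k then sym_T (k - j) ?p else 0)) g"
    using pM add.prems(2) j
    by (intro hall_bilinear(1)[symmetric]) (auto simp: sym_p_times_in_Sym sym_T_in_Sym Sym_zero)
  also have "\<dots> = hall (sym_T k (sym_pm (add_mset j M))) g"
    unfolding sym_pm_add_mset sym_T_sym_p_times[OF j] ..
  finally show ?case ..
qed

lemma hall_sym_T:
  fixes f g :: "(nat, 'k::field_char_0) mps"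
  assumes "f \<in> Sym" "g \<in> Sym"
  shows "hall (sym_T k f) g = hall f (sym_h k * g)"
  using assms(1)
proof (induction rule: Sym_induct)
  case zero
  then show ?case
    using assms(2) by (simp add: sym_T_zero hall_zero Sym_mult sym_h_in_Sym)
next
  case (step c M f)
  then have "sym_T k (sym_pm M) \<in> (Sym :: (nat, 'k) mps set)" "sym_T k f \<in> Sym"
    "sym_pm M \<in> (Sym :: (nat, 'k) mps set)" "sym_h k * g \<in> Sym"
    using assms(2) by (simp_all add: sym_T_in_Sym sym_pm_in_Sym Sym_mult sym_h_in_Sym)
  then show ?case
    using step assms(2)
    by (simp add: sym_T_add sym_T_scale hall_bilinear Sym_scale hall_sym_T_sym_pm)
qed

text \<open>Pairing a finite expansion of \<open>f\<close> with \<open>sym_pm N\<close> isolates the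
  coefficient of \<open>N\<close> times the nonzero number \<open>z_mset N\<close>.\<close>

lemma hall_nondegenerate:
  fixes f :: "(nat, 'k::field_char_0) mps"
  assumes "f \<in> Sym" and zero: "\<And>g. g \<in> Sym \<Longrightarrow> hall f g = 0"
  shows "f = 0"
proof -
  have "\<exists>A c. finite A \<and> A \<subseteq> pos_msets \<and> f = (\<Sum>M\<in>A. mps_scale (c M) (sym_pm M))"
    using assms(1)
  proof (induction rule: Sym_induct)
    case zero
    show ?case
      by (intro exI[of _ "{}"]) simp
  next
    case (step d N g)
    then obtain A c where A: "finite A" "A \<subseteq> pos_msets" "g = (\<Sum>M\<in>A. mps_scale (c M) (sym_pm M))"
      by blast
    let ?c = "\<lambda>M. (if M = N then d else 0) + (if M \<in> A then c M else 0)"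
    have "(\<Sum>M\<in>insert N A. mps_scale (?c M) (sym_pm M))
      = (\<Sum>M\<in>insert N A. if M = N then mps_scale d (sym_pm M) else 0)
        + (\<Sum>M\<in>insert N A. if M \<in> A then mps_scale (c M) (sym_pm M) else 0)"
      unfolding sum.distrib[symmetric] by (rule sum.cong) (auto simp: mps.scale_left_distrib)
    also have "(\<Sum>M\<in>insert N A. if M = N then mps_scale d (sym_pm M) else 0) = mps_scale d (sym_pm N)"
      using A(1) by simp
    also have "(\<Sum>M\<in>insert N A. if M \<in> A then mps_scale (c M) (sym_pm M) else 0) = g"
      unfolding A(3) using A(1) by (intro sum.mono_neutral_cong_right) auto
    finally show ?case
      using A(1,2) step(1) by (intro exI[of _ "insert N A"] exI[of _ ?c]) auto
  qed
  then obtain A c where A: "finite A" "A \<subseteq> pos_msets" and f: "f = (\<Sum>M\<in>A. mps_scale (c M) (sym_pm M))"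
    by blast
  have "c N = 0" if N: "N \<in> A" for N
  proof -
    have pN: "0 \<notin># N"
      using A(2) N by auto
    \<comment> \<open>The hypothesis has \<open>f\<close> on the left, while sums are expanded in
      the right argument; symmetry against basis elements bridges the two.\<close>
    have sym: "hall f g = hall g f" if "g = sym_pm N" for g
    proof -
      have "hall h (sym_pm N) = hall (sym_pm N) h" if "h \<in> Sym" for h :: "(nat, 'k) mps"
        using that
      proof (induction rule: Sym_induct)
        case zero
        then show ?case
          using pN by (simp add: hall_zero sym_pm_in_Sym)
      next
        case (step c M h)
        have "hall (sym_pm M) (sym_pm N) = (hall (sym_pm N) (sym_pm M) :: 'k)"
          using step(1) pN by (simp add: hall_spec(2))
        then show ?case
          using step pN by (simp add: hall_bilinear Sym_scale sym_pm_in_Sym)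
      qed
      with assms(1) that show ?thesis
        by simp
    qed
    have "hall (sym_pm N) f = (\<Sum>M\<in>A. hall (sym_pm N) (mps_scale (c M) (sym_pm M)))"
      unfolding f using A pN by (intro hall_sum_right sym_pm_in_Sym Sym_scale) auto
    also have "\<dots> = (\<Sum>M\<in>A. if M = N then c N * of_nat (z_mset N) else 0)"
    proof (rule sum.cong[OF refl])
      fix M assume "M \<in> A"
      then have pM: "0 \<notin># M"
        using A(2) by auto
      show "hall (sym_pm N) (mps_scale (c M) (sym_pm M)) = (if M = N then c N * of_nat (z_mset N) else 0)"
        unfolding hall_bilinear(4)[OF sym_pm_in_Sym[OF pN] sym_pm_in_Sym[OF pM] Sym_zero]
          hall_spec(2)[OF pN pM] by simp
    qed
    also have "\<dots> = c N * of_nat (z_mset N)"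
      using A(1) N by simp
    finally have "c N * of_nat (z_mset N) = 0"
      using zero[OF sym_pm_in_Sym[OF pN]] sym[OF refl] by simp
    then show ?thesis
      using z_mset_pos[OF pN] by simp
  qed
  then show ?thesis
    unfolding f by simp
qed

text \<open>Adjoints for a nondegenerate form are unique, so it suffices that \<open>sym_T k\<close>
  is one. It is at the same time the witness for the choice.\<close>

lemma sym_h_perp_eq:
  fixes f :: "(nat, 'k::field_char_0) mps"
  assumes "f \<in> Sym"
  shows "sym_h_perp k f = sym_T k f"
proof -
  let ?P = "\<lambda>T :: (nat, 'k) mps \<Rightarrow> (nat, 'k) mps.
     (\<forall>f\<in>Sym. T f \<in> Sym) \<and>
     (\<forall>f\<in>Sym. \<forall>g\<in>Sym. \<forall>c. T (f + g) = T f + T g \<and> T (mps_scale c f) = mps_scale c (T f)) \<and>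
     (\<forall>f\<in>Sym. \<forall>g\<in>Sym. hall (T f) g = hall f (sym_h k * g))"
  have "?P (sym_T k)"
    by (simp add: sym_T_in_Sym sym_T_add sym_T_scale hall_sym_T)
  then have perp: "?P (sym_h_perp k)"
    unfolding sym_h_perp_def by (rule someI[of ?P])
  have "sym_h_perp k f + mps_scale (-1) (sym_T k f) = 0"
  proof (rule hall_nondegenerate)
    have mem: "sym_h_perp k f \<in> Sym" "sym_T k f \<in> Sym"
      using perp assms by (auto simp: sym_T_in_Sym)
    then show "sym_h_perp k f + mps_scale (-1) (sym_T k f) \<in> Sym"
      by (intro Sym_add Sym_scale)
    fix g :: "(nat, 'k) mps" assume g: "g \<in> Sym"
    have "hall (sym_h_perp k f + mps_scale (-1) (sym_T k f)) g
        = hall (sym_h_perp k f) g + (-1) * hall (sym_T k f) g"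
      using mem g by (simp only: hall_bilinear Sym_scale)
    also have "\<dots> = 0"
      using perp assms g by (simp add: hall_sym_T)
    finally show "hall (sym_h_perp k f + mps_scale (-1) (sym_T k f)) g = 0" .
  qed
  then show ?thesis
    by (simp add: mps.scale_minus_left)
qed

section \<open>The Cauchy kernel\<close>

definition mono_join :: "('x \<Rightarrow>\<^sub>0 nat) \<Rightarrow> ('y \<Rightarrow>\<^sub>0 nat) \<Rightarrow> ('x + 'y \<Rightarrow>\<^sub>0 nat)" where
  "mono_join \<alpha> \<beta> = Abs_poly_mapping (case_sum (lookup \<alpha>) (lookup \<beta>))"

lemma lookup_mono_join:
  "lookup (mono_join \<alpha> \<beta>) = case_sum (lookup \<alpha>) (lookup \<beta>)"
proof -
  have "finite {i. case_sum (lookup \<alpha>) (lookup \<beta>) i \<noteq> 0}"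
  proof (rule finite_subset)
    show "{i. case_sum (lookup \<alpha>) (lookup \<beta>) i \<noteq> 0}
      \<subseteq> Inl ` keys \<alpha> \<union> Inr ` keys \<beta>"
    proof
      fix i assume "i \<in> {i. case_sum (lookup \<alpha>) (lookup \<beta>) i \<noteq> 0}"
      then show "i \<in> Inl ` keys \<alpha> \<union> Inr ` keys \<beta>"
        by (cases i) (simp_all add: in_keys_iff)
    qed
  qed simp
  then show ?thesis
    by (simp add: mono_join_def)
qed

lemma lookup_mono_join_simps [simp]:
  "lookup (mono_join \<alpha> \<beta>) (Inl i) = lookup \<alpha> i"
  "lookup (mono_join \<alpha> \<beta>) (Inr j) = lookup \<beta> j"
  by (simp_all add: lookup_mono_join)

lemma sum_poly_mapping_eqI:
  assumes "\<And>i. lookup u (Inl i) = lookup w (Inl i)"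
    and "\<And>j. lookup u (Inr j) = lookup w (Inr j)"
  shows "u = w"
proof (rule poly_mapping_eqI)
  fix i show "lookup u i = lookup w i"
    using assms by (cases i) simp_all
qed

lemma mono_join_inject: "mono_join \<alpha> \<beta> = mono_join \<alpha>' \<beta>' \<longleftrightarrow> \<alpha> = \<alpha>' \<and> \<beta> = \<beta>'"
  by (metis lookup_mono_join_simps poly_mapping_eqI)

lemma mono_join_surj: "\<exists>\<alpha> \<beta>. w = mono_join \<alpha> \<beta>"
proof (intro exI)
  show "w = mono_join (Poly_Mapping.map_key Inl w) (Poly_Mapping.map_key Inr w)"
    by (rule sum_poly_mapping_eqI) (simp_all add: map_key.rep_eq)
qed

lemma mono_join_add: "mono_join \<alpha> \<beta> + mono_join \<alpha>' \<beta>' = mono_join (\<alpha> + \<alpha>') (\<beta> + \<beta>')"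
  by (rule sum_poly_mapping_eqI) (simp_all add: lookup_add)

lemma mono_join_0_0: "mono_join 0 0 = 0"
  by (rule sum_poly_mapping_eqI) simp_all

lemma mono_join_eq_0_iff: "mono_join \<alpha> \<beta> = 0 \<longleftrightarrow> \<alpha> = 0 \<and> \<beta> = 0"
  by (metis mono_join_0_0 mono_join_inject)

lemma sum_splits_mono_join:
  "(\<Sum>p\<in>{p. fst p + snd p = mono_join \<alpha> \<beta>}. g (fst p) (snd p))
    = (\<Sum>p\<in>{p. fst p + snd p = \<alpha>}. \<Sum>q\<in>{q. fst q + snd q = \<beta>}.
        g (mono_join (fst p) (fst q)) (mono_join (snd p) (snd q)))"
proof -
  let ?S = "{p. fst p + snd p = \<alpha>} \<times> {q. fst q + snd q = \<beta>}"
  let ?f = "\<lambda>(p, q). (mono_join (fst p) (fst q), mono_join (snd p) (snd q))"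
  have "(\<Sum>p\<in>{p. fst p + snd p = \<alpha>}. \<Sum>q\<in>{q. fst q + snd q = \<beta>}.
        g (mono_join (fst p) (fst q)) (mono_join (snd p) (snd q)))
    = (\<Sum>(p, q)\<in>?S. g (mono_join (fst p) (fst q)) (mono_join (snd p) (snd q)))"
    by (rule sum.cartesian_product)
  also have "\<dots> = (\<Sum>p\<in>?f ` ?S. g (fst p) (snd p))"
    by (subst sum.reindex) (auto simp: inj_on_def mono_join_inject split_def)
  also have "?f ` ?S = {p. fst p + snd p = mono_join \<alpha> \<beta>}" (is "?L = ?R")
  proof
    show "?L \<subseteq> ?R"
      by (auto simp: mono_join_add)
    show "?R \<subseteq> ?L"
    proof
      fix p assume p: "p \<in> ?R"
      obtain \<gamma> \<gamma>' \<delta> \<delta>' where *: "fst p = mono_join \<gamma> \<gamma>'" "snd p = mono_join \<delta> \<delta>'"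
        using mono_join_surj by metis
      then have "\<alpha> = \<gamma> + \<delta>" "\<beta> = \<gamma>' + \<delta>'"
        using p by (auto simp: mono_join_add mono_join_inject)
      then show "p \<in> ?L"
        using * by (intro image_eqI[of _ _ "((\<gamma>, \<delta>), (\<gamma>', \<delta>'))"]) (auto simp: prod_eq_iff)
    qed
  qed
  finally show ?thesis ..
qed

text \<open>The coefficient of \<open>x^\<alpha>\<close>, kept as a series in the second alphabet.
  Identities in two alphabets become families of identities in one, and products become finite sums
  over the splits of \<open>\<alpha>\<close>.\<close>

definition mps_slice :: "('x \<Rightarrow>\<^sub>0 nat) \<Rightarrow> ('x + 'y, 'k::comm_ring_1) mps \<Rightarrow> ('y, 'k) mps" where
  "mps_slice \<alpha> f = Abs_mps (\<lambda>\<beta>. mps_coeff f (mono_join \<alpha> \<beta>))"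

lemma mps_coeff_slice [simp]: "mps_coeff (mps_slice \<alpha> f) \<beta> = mps_coeff f (mono_join \<alpha> \<beta>)"
  by (simp add: mps_slice_def)

lemma mps_eq_slice_iff:
  fixes f g :: "('x + 'y, 'k::comm_ring_1) mps"
  shows "f = g \<longleftrightarrow> (\<forall>\<alpha>. mps_slice \<alpha> f = mps_slice \<alpha> g)"
proof (intro iffI mps_eqI)
  fix w :: "'x + 'y \<Rightarrow>\<^sub>0 nat" assume *: "\<forall>\<alpha>. mps_slice \<alpha> f = mps_slice \<alpha> g"
  obtain \<alpha> \<beta> where w: "w = mono_join \<alpha> \<beta>"
    using mono_join_surj by blast
  have "mps_coeff (mps_slice \<alpha> f) \<beta> = mps_coeff (mps_slice \<alpha> g) \<beta>"
    using * by simp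
  then show "mps_coeff f w = mps_coeff g w"
    by (simp add: w)
qed simp

lemma mps_slice_times:
  "mps_slice \<alpha> (f * g) = (\<Sum>p\<in>{p. fst p + snd p = \<alpha>}. mps_slice (fst p) f * mps_slice (snd p) g)"
  by (rule mps_eqI)
    (simp add: mps_coeff_times sum_splits_mono_join[of "\<lambda>u v. mps_coeff f u * mps_coeff g v"])

lemma mps_slice_mps_sum: "mps_slice \<alpha> (mps_sum f) = mps_sum (\<lambda>i. mps_slice \<alpha> (f i))"
  by (rule mps_eqI) (simp add: mps_coeff_mps_sum)

lemma mps_slice_one: "mps_slice \<alpha> 1 = (if \<alpha> = 0 then 1 else 0)"
  by (rule mps_eqI) (simp add: mps_coeff_one mono_join_eq_0_iff)

lemma keys_mono_join_subset_range:
  "keys (mono_join \<alpha> \<beta>) \<subseteq> range Inl \<longleftrightarrow> \<beta> = 0"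
  "keys (mono_join \<alpha> \<beta>) \<subseteq> range Inr \<longleftrightarrow> \<alpha> = 0"
proof -
  have "\<beta> = 0" if "keys (mono_join \<alpha> \<beta>) \<subseteq> range Inl"
  proof (rule poly_mapping_eqI)
    fix j
    have "Inr j \<notin> keys (mono_join \<alpha> \<beta>)"
      using that by blast
    then show "lookup \<beta> j = lookup 0 j"
      by (simp add: in_keys_iff)
  qed
  moreover have "\<alpha> = 0" if "keys (mono_join \<alpha> \<beta>) \<subseteq> range Inr"
  proof (rule poly_mapping_eqI)
    fix j
    have "Inl j \<notin> keys (mono_join \<alpha> \<beta>)"
      using that by blast
    then show "lookup \<alpha> j = lookup 0 j"
      by (simp add: in_keys_iff)
  qed
  moreover have "i \<in> range Inl" if "i \<in> keys (mono_join \<alpha> (0 :: 'b \<Rightarrow>\<^sub>0 nat))" for i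
    using that by (cases i) (simp_all add: in_keys_iff)
  moreover have "i \<in> range Inr" if "i \<in> keys (mono_join (0 :: 'a \<Rightarrow>\<^sub>0 nat) \<beta>)" for i
    using that by (cases i) (simp_all add: in_keys_iff)
  ultimately show "keys (mono_join \<alpha> \<beta>) \<subseteq> range Inl \<longleftrightarrow> \<beta> = 0"
    "keys (mono_join \<alpha> \<beta>) \<subseteq> range Inr \<longleftrightarrow> \<alpha> = 0"
    by blast+
qed

lemma mps_slice_in_X: "mps_slice \<alpha> (in_X f) = mps_scale (mps_coeff f \<alpha>) 1"
proof -
  have "Poly_Mapping.map_key Inl (mono_join \<alpha> \<beta>) = \<alpha>" for \<beta> :: "nat \<Rightarrow>\<^sub>0 nat"
    by (rule poly_mapping_eqI) (simp add: map_key.rep_eq)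
  then show ?thesis
    by (intro mps_eqI) (auto simp: mps_rename_def keys_mono_join_subset_range mps_coeff_one)
qed

lemma mps_slice_in_Y: "mps_slice \<alpha> (in_Y f) = (if \<alpha> = 0 then f else 0)"
proof -
  have "Poly_Mapping.map_key Inr (mono_join \<alpha> \<beta>) = \<beta>" for \<beta> :: "nat \<Rightarrow>\<^sub>0 nat"
    by (rule poly_mapping_eqI) (simp add: map_key.rep_eq)
  then show ?thesis
    by (intro mps_eqI) (auto simp: mps_rename_def keys_mono_join_subset_range)
qed

lemma mps_scale_zero_right [simp]: "mps_scale c 0 = 0"
  by (rule mps_eqI) simp

lemma mps_slice_in_X_in_Y: "mps_slice \<alpha> (in_X f * in_Y g) = mps_scale (mps_coeff f \<alpha>) g"
proof -
  have "mps_slice \<alpha> (in_X f * in_Y g)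
    = (\<Sum>p\<in>{p. fst p + snd p = \<alpha>}. if p = (\<alpha>, 0) then mps_scale (mps_coeff f \<alpha>) g else 0)"
    unfolding mps_slice_times
    by (rule sum.cong) (auto simp: mps_slice_in_X mps_slice_in_Y mps_scale_mult_left prod_eq_iff)
  then show ?thesis
    by (simp add: sum.delta)
qed

section \<open>Coefficients of the infinite product\<close>

definition kernel_factor :: "(nat \<Rightarrow> 'k) \<Rightarrow> 'x \<Rightarrow> 'y \<Rightarrow> ('x + 'y, 'k::comm_ring_1) mps" where
  "kernel_factor \<eta> j k = mps_sum (\<lambda>n. mps_scale (\<eta> n) ((mps_var (Inl j) * mps_var (Inr k)) ^ n))"

abbreviation kernel_monom :: "'x \<Rightarrow> 'y \<Rightarrow> nat \<Rightarrow> ('x + 'y \<Rightarrow>\<^sub>0 nat)" where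
  "kernel_monom j k n \<equiv> mono_join (single j n) (single k n)"

lemma kernel_monom_eq:
  "kernel_monom j k n = single (Inl j) n + single (Inr k) n"
  by (rule sum_poly_mapping_eqI) (simp_all add: lookup_add lookup_single)

lemma kernel_monom_inject: "kernel_monom j k n = kernel_monom j k n' \<longleftrightarrow> n = n'"
  by (metis lookup_mono_join_simps(1) lookup_single_eq)

lemma mps_coeff_kernel_factor:
  "mps_coeff (kernel_factor \<eta> j k) (kernel_monom j k n) = \<eta> n"
  "(\<And>n. w \<noteq> kernel_monom j k n) \<Longrightarrow> mps_coeff (kernel_factor \<eta> j k) w = 0"
proof -
  have coeff: "mps_coeff (kernel_factor \<eta> j k) w
      = Sum_any (\<lambda>n. \<eta> n * (if w = kernel_monom j k n then 1 else 0))" for w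
    by (simp add: kernel_factor_def mps_coeff_mps_sum mps_var_mult_power mps_coeff_monom kernel_monom_eq)
  have "mps_coeff (kernel_factor \<eta> j k) (kernel_monom j k n) = Sum_any (\<lambda>i. if i = n then \<eta> n else 0)"
    unfolding coeff by (rule Sum_any.cong) (auto simp: kernel_monom_inject)
  then show "mps_coeff (kernel_factor \<eta> j k) (kernel_monom j k n) = \<eta> n"
    by simp
  show "mps_coeff (kernel_factor \<eta> j k) w = 0" if "\<And>n. w \<noteq> kernel_monom j k n"
    unfolding coeff using that by simp
qed

lemma mps_coeff_times_kernel_factor:
  "mps_coeff (kernel_factor \<eta> j k * f) (mono_join \<alpha> \<beta>)
    = (\<Sum>n | n \<le> lookup \<alpha> j \<and> n \<le> lookup \<beta> k.
        \<eta> n * mps_coeff f (mono_join (\<alpha> - single j n) (\<beta> - single k n)))"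
proof -
  let ?N = "{n. n \<le> lookup \<alpha> j \<and> n \<le> lookup \<beta> k}"
  let ?r = "\<lambda>n. mono_join (\<alpha> - single j n) (\<beta> - single k n)"
  let ?g = "\<lambda>n. (kernel_monom j k n, ?r n)"
  have "mps_coeff (kernel_factor \<eta> j k * f) (mono_join \<alpha> \<beta>)
    = (\<Sum>p\<in>?g ` ?N. mps_coeff (kernel_factor \<eta> j k) (fst p) * mps_coeff f (snd p))"
    unfolding mps_coeff_times
  proof (rule sum.mono_neutral_right)
    show "?g ` ?N \<subseteq> {p. fst p + snd p = mono_join \<alpha> \<beta>}"
      by (auto simp: mono_join_add pm_single_add_diff)
    show "\<forall>p\<in>{p. fst p + snd p = mono_join \<alpha> \<beta>} - ?g ` ?N.
      mps_coeff (kernel_factor \<eta> j k) (fst p) * mps_coeff f (snd p) = 0"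
    proof
      fix p assume p: "p \<in> {p. fst p + snd p = mono_join \<alpha> \<beta>} - ?g ` ?N"
      obtain \<gamma> \<delta> where \<gamma>\<delta>: "snd p = mono_join \<gamma> \<delta>"
        using mono_join_surj by blast
      have "fst p \<noteq> kernel_monom j k n" for n
      proof
        assume n: "fst p = kernel_monom j k n"
        then have "\<alpha> = single j n + \<gamma>" "\<beta> = single k n + \<delta>"
          using p \<gamma>\<delta> by (auto simp: mono_join_add mono_join_inject)
        then have "n \<in> ?N" "p = ?g n"
          using n \<gamma>\<delta> by (auto simp: lookup_add prod_eq_iff pm_add_diff)
        then show False
          using p by blast
      qed
      then show "mps_coeff (kernel_factor \<eta> j k) (fst p) * mps_coeff f (snd p) = 0"
        by (simp add: mps_coeff_kernel_factor(2))
    qed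
  qed auto
  also have "\<dots> = (\<Sum>n\<in>?N. \<eta> n * mps_coeff f (?r n))"
    by (subst sum.reindex) (auto simp: inj_on_def kernel_monom_inject mps_coeff_kernel_factor(1))
  finally show ?thesis .
qed

lemma mps_coeff_mps_prod:
  assumes "finite I0" and "\<And>I. finite I \<Longrightarrow> I0 \<subseteq> I \<Longrightarrow> mps_coeff (prod f I) w = c"
  shows "mps_coeff (mps_prod f) w = c"
proof -
  have "(THE c. \<forall>\<^sub>F I in finite_subsets_at_top UNIV. mps_coeff (prod f I) w = c) = c"
  proof (rule the_equality)
    show ev: "\<forall>\<^sub>F I in finite_subsets_at_top UNIV. mps_coeff (prod f I) w = c"
      unfolding eventually_finite_subsets_at_top using assms by blast
    fix d assume "\<forall>\<^sub>F I in finite_subsets_at_top UNIV. mps_coeff (prod f I) w = d"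
    with ev have "\<forall>\<^sub>F I in finite_subsets_at_top (UNIV :: 'a set). d = c"
      by (rule eventually_elim2) simp
    then show "d = c"
      by (simp add: eventually_const)
  qed
  then show ?thesis
    by (simp add: mps_prod_def)
qed

text \<open>A factor whose two variables do not both occur in the monomial can contribute only its
  constant term 1, so the partial products stabilise.\<close>

lemma mps_coeff_prod_kernel_factor:
  assumes \<eta>: "\<eta> 0 = 1" and "finite I" and "keys \<alpha> \<times> keys \<beta> \<subseteq> I"
  shows "mps_coeff (prod (\<lambda>(j, k). kernel_factor \<eta> j k) I) (mono_join \<alpha> \<beta>)
    = mps_coeff (prod (\<lambda>(j, k). kernel_factor \<eta> j k) (keys \<alpha> \<times> keys \<beta>)) (mono_join \<alpha> \<beta>)"
proof -
  let ?E = "\<lambda>(j, k). kernel_factor \<eta> j k"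
  let ?I0 = "keys \<alpha> \<times> keys \<beta>"
  have "mps_coeff (prod ?E (?I0 \<union> J)) (mono_join \<alpha> \<beta>) = mps_coeff (prod ?E ?I0) (mono_join \<alpha> \<beta>)"
    if "finite J" "J \<inter> ?I0 = {}" for J
    using that
  proof (induction J rule: finite_induct)
    case (insert p J)
    obtain j k where p: "p = (j, k)"
      by (cases p)
    have "\<not> (0 < lookup \<alpha> j \<and> 0 < lookup \<beta> k)"
      using insert.prems p by (auto simp: in_keys_iff)
    then have N: "{n. n \<le> lookup \<alpha> j \<and> n \<le> lookup \<beta> k} = {0}"
      by auto
    have "p \<notin> ?I0 \<union> J" "finite (?I0 \<union> J)"
      using insert by auto
    then have "prod ?E (?I0 \<union> insert p J) = kernel_factor \<eta> j k * prod ?E (?I0 \<union> J)"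
      using p by simp
    then show ?case
      using insert by (simp add: mps_coeff_times_kernel_factor N \<eta>)
  qed simp
  from this[of "I - ?I0"] assms(2,3) show ?thesis
    by (simp add: Un_absorb1 Un_Diff_cancel Int_commute)
qed

text \<open>Each factor of row \<open>j\<close> carries equal powers of \<open>x_j\<close> and
  \<open>y_k\<close>, so the exponent of \<open>x_j\<close> is forced to be the total degree in
  \<open>y\<close>.\<close>

lemma mps_coeff_kernel_row:
  assumes \<eta>: "\<eta> 0 = 1" and "finite N"
  shows "mps_coeff (\<Prod>k\<in>N. kernel_factor \<eta> j k) (mono_join \<alpha> \<beta>)
    = (if keys \<beta> \<subseteq> N \<and> \<alpha> = single j (mdeg \<beta>)
       then \<Prod>k\<in>N. \<eta> (lookup \<beta> k) else 0)"
  using assms(2)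
proof (induction N arbitrary: \<alpha> \<beta> rule: finite_induct)
  case empty
  show ?case
    by (auto simp: mps_coeff_one mono_join_eq_0_iff)
next
  case (insert k N)
  let ?n = "lookup \<beta> k"
  let ?M = "{n. n \<le> lookup \<alpha> j \<and> n \<le> ?n}"
  let ?c = "\<lambda>n. mps_coeff (\<Prod>k\<in>N. kernel_factor \<eta> j k)
    (mono_join (\<alpha> - single j n) (\<beta> - single k n))"
  \<comment> \<open>If less than the full power of \<open>y_k\<close> is taken from this factor,
    some of it remains, and none of the other factors can supply it.\<close>
  have other: "?c n = 0" if "n \<in> ?M" "n \<noteq> ?n" for n
  proof -
    have "k \<in> keys (\<beta> - single k n)"
      using that by (simp add: in_keys_iff lookup_minus)
    then have "\<not> keys (\<beta> - single k n) \<subseteq> N"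
      using insert.hyps by blast
    then show ?thesis
      unfolding insert.IH by simp
  qed
  have keys: "keys (\<beta> - single k ?n) \<subseteq> N \<longleftrightarrow> keys \<beta> \<subseteq> insert k N"
  proof -
    have "keys (\<beta> - single k ?n) = keys \<beta> - {k}"
      by (auto simp: in_keys_iff lookup_minus lookup_single when_def split: if_splits)
    then show ?thesis
      by blast
  qed
  have single: "?n \<le> lookup \<alpha> j \<and>
      \<alpha> - single j ?n = single j (mdeg (\<beta> - single k ?n))
    \<longleftrightarrow> \<alpha> = single j (mdeg \<beta>)" (is "?L \<longleftrightarrow> ?R")
  proof -
    have mdeg: "mdeg \<beta> = ?n + mdeg (\<beta> - single k ?n)"
      by (metis mdeg_add mdeg_single pm_single_add_diff order_refl)
    show ?thesis
    proof
      assume L: ?L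
      then have "\<alpha> = single j ?n + (\<alpha> - single j ?n)"
        by (metis pm_single_add_diff)
      also have "\<dots> = single j (mdeg \<beta>)"
        using L mdeg by (simp add: single_add[symmetric])
      finally show ?R .
    next
      assume R: ?R
      then have "\<alpha> = single j ?n + single j (mdeg (\<beta> - single k ?n))"
        using mdeg by (simp only: single_add[symmetric])
      then show ?L
        using pm_add_diff R mdeg by (metis le_add1 lookup_single_eq)
    qed
  qed
  have "mps_coeff (\<Prod>k\<in>insert k N. kernel_factor \<eta> j k) (mono_join \<alpha> \<beta>) = (\<Sum>n\<in>?M. \<eta> n * ?c n)"
    using insert.hyps by (simp add: mps_coeff_times_kernel_factor)
  also have "\<dots> = (\<Sum>n\<in>?M. if n = ?n then \<eta> ?n * ?c ?n else 0)"
    using other by (intro sum.cong) auto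
  also have "\<dots> = (if ?n \<le> lookup \<alpha> j then \<eta> ?n * ?c ?n else 0)"
    by (simp add: sum.delta)
  also have "\<dots> = (if keys \<beta> \<subseteq> insert k N \<and> \<alpha> = single j (mdeg \<beta>)
       then \<eta> ?n * (\<Prod>i\<in>N. \<eta> (lookup (\<beta> - single k ?n) i)) else 0)"
    unfolding insert.IH keys using single by auto
  also have "(\<Prod>i\<in>N. \<eta> (lookup (\<beta> - single k ?n) i))
      = (\<Prod>i\<in>N. \<eta> (lookup \<beta> i))"
    using insert.hyps by (intro prod.cong) (auto simp: lookup_minus lookup_single when_def)
  finally show ?case
    using insert.hyps by simp
qed

text \<open>\<open>\<Prod>\<^sub>j H\<^bsub>\<alpha>\<^sub>j\<^esub>\<close> is the coefficient of \<open>x\<^sup>\<alpha>\<close> in the Cauchy kernel.\<close>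

definition H_word :: "(nat \<Rightarrow> 'k) \<Rightarrow> ('x \<Rightarrow>\<^sub>0 nat) \<Rightarrow> ('y, 'k::comm_ring_1) mps" where
  "H_word \<eta> \<alpha> = (\<Prod>j\<in>keys \<alpha>. sym_H \<eta> (lookup \<alpha> j))"

text \<open>A row with finitely many factors reproduces \<open>sym_H\<close> only on monomials in
  the variables \<open>N\<close>. The relation respects products because both halves of a split of
  such a monomial stay within \<open>N\<close>.\<close>

definition mps_agree :: "'x set \<Rightarrow> ('x, 'k::comm_ring_1) mps \<Rightarrow> ('x, 'k) mps \<Rightarrow> bool" where
  "mps_agree N f g \<longleftrightarrow> (\<forall>w. keys w \<subseteq> N \<longrightarrow> mps_coeff f w = mps_coeff g w)"

lemma mps_agree_times:
  fixes f g :: "('x, 'k::comm_ring_1) mps"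
  assumes "mps_agree N f f'" "mps_agree N g g'"
  shows "mps_agree N (f * g) (f' * g')"
  unfolding mps_agree_def mps_coeff_times
proof (intro allI impI sum.cong refl)
  fix w :: "'x \<Rightarrow>\<^sub>0 nat" and p
  assume w: "keys w \<subseteq> N" and "p \<in> {p. fst p + snd p = w}"
  then have "keys (fst p) \<subseteq> keys w" "keys (snd p) \<subseteq> keys w"
    by (auto simp: in_keys_iff lookup_add)
  with w assms show "mps_coeff f (fst p) * mps_coeff g (snd p) = mps_coeff f' (fst p) * mps_coeff g' (snd p)"
    by (simp add: mps_agree_def)
qed

lemma mps_agree_sum:
  assumes "\<And>i. i \<in> A \<Longrightarrow> mps_agree N (f i) (g i)"
  shows "mps_agree N (\<Sum>i\<in>A. f i) (\<Sum>i\<in>A. g i)"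
  using assms by (simp add: mps_agree_def)

lemma mps_agree_slice_kernel_row:
  fixes \<eta> :: "nat \<Rightarrow> 'k::comm_ring_1" and N :: "'y set"
  assumes \<eta>: "\<eta> 0 = 1" and "finite N"
  shows "mps_agree N (mps_slice \<alpha> (\<Prod>k\<in>N. kernel_factor \<eta> j k))
    (if \<alpha> = single j (lookup \<alpha> j) then sym_H \<eta> (lookup \<alpha> j) else 0)"
  unfolding mps_agree_def
proof (intro allI impI)
  fix \<beta> :: "'y \<Rightarrow>\<^sub>0 nat" assume \<beta>: "keys \<beta> \<subseteq> N"
  have "(\<Prod>k\<in>N. \<eta> (lookup \<beta> k)) = (\<Prod>k\<in>keys \<beta>. \<eta> (lookup \<beta> k))"
    by (rule prod.mono_neutral_right) (use assms \<beta> in \<open>auto simp: in_keys_iff\<close>)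
  then have "mps_coeff (mps_slice \<alpha> (\<Prod>k\<in>N. kernel_factor \<eta> j k)) \<beta>
    = (if \<alpha> = single j (mdeg \<beta>) then \<Prod>k\<in>keys \<beta>. \<eta> (lookup \<beta> k) else 0)"
    using \<beta> by (simp add: mps_coeff_kernel_row[of \<eta>, OF assms])
  moreover have "\<alpha> = single j (mdeg \<beta>) \<longleftrightarrow>
      \<alpha> = single j (lookup \<alpha> j) \<and> mdeg \<beta> = lookup \<alpha> j"
    by (metis lookup_single_eq)
  ultimately show "mps_coeff (mps_slice \<alpha> (\<Prod>k\<in>N. kernel_factor \<eta> j k)) \<beta>
    = mps_coeff (if \<alpha> = single j (lookup \<alpha> j) then sym_H \<eta> (lookup \<alpha> j) else 0) \<beta>"
    by (auto simp: sym_H_def)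
qed

text \<open>Row \<open>j\<close> involves only powers of \<open>x_j\<close>, so among the splits of
  \<open>\<alpha>\<close> a single one survives: the one that hands row \<open>j\<close> exactly the
  exponent of \<open>x_j\<close>.\<close>

lemma mps_agree_slice_kernel:
  fixes \<eta> :: "nat \<Rightarrow> 'k::comm_ring_1" and N :: "'y set" and J :: "'x set"
  assumes \<eta>: "\<eta> 0 = 1" and N: "finite N" and "finite J"
  shows "mps_agree N (mps_slice \<alpha> (\<Prod>j\<in>J. \<Prod>k\<in>N. kernel_factor \<eta> j k))
    (if keys \<alpha> \<subseteq> J then H_word \<eta> \<alpha> else 0)"
  using assms(3)
proof (induction J arbitrary: \<alpha> rule: finite_induct)
  case empty
  show ?case
    by (auto simp: mps_slice_one mps_agree_def H_word_def)
next
  case (insert j J)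
  let ?H = "H_word \<eta> :: ('x \<Rightarrow>\<^sub>0 nat) \<Rightarrow> ('y, 'k) mps"
  let ?h = "sym_H \<eta> :: nat \<Rightarrow> ('y, 'k) mps"
  let ?row = "\<lambda>\<gamma>. if \<gamma> = single j (lookup \<gamma> j) then ?h (lookup \<gamma> j) else 0"
  let ?rest = "\<lambda>\<delta>. if keys \<delta> \<subseteq> J then ?H \<delta> else 0"
  let ?n = "lookup \<alpha> j"
  let ?p = "(single j ?n, \<alpha> - single j ?n)"
  have p: "?p \<in> {p. fst p + snd p = \<alpha>}"
    by (simp add: pm_single_add_diff)
  have keys: "keys (\<alpha> - single j ?n) = keys \<alpha> - {j}"
    by (auto simp: in_keys_iff lookup_minus lookup_single when_def split: if_splits)
  have zero: "?row (fst q) * ?rest (snd q) = 0" if q: "q \<in> {p. fst p + snd p = \<alpha>}" "q \<noteq> ?p" for q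
  proof (rule ccontr)
    assume nz: "?row (fst q) * ?rest (snd q) \<noteq> 0"
    then have f: "fst q = single j (lookup (fst q) j)"
      and "keys (snd q) \<subseteq> J"
      by (auto split: if_splits)
    then have "lookup (snd q) j = 0"
      using insert.hyps by (auto simp: in_keys_iff)
    moreover have \<alpha>: "\<alpha> = fst q + snd q"
      using q by simp
    ultimately have "lookup (fst q) j = ?n"
      by (simp add: lookup_add)
    then have "fst q = single j ?n"
      using f by simp
    then have "q = ?p"
      using \<alpha> by (metis pm_add_diff prod.collapse)
    with q show False
      by simp
  qed
  have "(\<Sum>q\<in>{p. fst p + snd p = \<alpha>}. ?row (fst q) * ?rest (snd q)) = ?row (fst ?p) * ?rest (snd ?p)"
    using p zero by (subst sum.remove[OF finite_splits p]) (auto intro!: sum.neutral)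
  also have "\<dots> = (if keys \<alpha> \<subseteq> insert j J then ?h ?n * ?H (\<alpha> - single j ?n) else 0)"
    using keys by auto
  also have "?h ?n * ?H (\<alpha> - single j ?n) = ?H \<alpha>"
  proof -
    have "?H (\<alpha> - single j ?n)
      = (\<Prod>i\<in>keys \<alpha> - {j}. ?h (lookup \<alpha> i))"
      unfolding H_word_def keys by (rule prod.cong) (auto simp: lookup_minus lookup_single when_def)
    moreover have "?H \<alpha> = ?h ?n * (\<Prod>i\<in>keys \<alpha> - {j}. ?h (lookup \<alpha> i))"
    proof (cases "j \<in> keys \<alpha>")
      case True
      then show ?thesis
        by (simp add: H_word_def prod.remove)
    next
      case False
      then have "?n = 0"
        by (simp add: in_keys_iff)
      then show ?thesis
        using False \<eta> by (simp add: H_word_def sym_H_0)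
    qed
    ultimately show ?thesis
      by simp
  qed
  finally have "(\<Sum>q\<in>{p. fst p + snd p = \<alpha>}. ?row (fst q) * ?rest (snd q))
    = (if keys \<alpha> \<subseteq> insert j J then ?H \<alpha> else 0)" .
  moreover have "mps_slice \<alpha> (\<Prod>j\<in>insert j J. \<Prod>k\<in>N. kernel_factor \<eta> j k)
    = (\<Sum>q\<in>{p. fst p + snd p = \<alpha>}. mps_slice (fst q) (\<Prod>k\<in>N. kernel_factor \<eta> j k)
        * mps_slice (snd q) (\<Prod>j\<in>J. \<Prod>k\<in>N. kernel_factor \<eta> j k))"
    using insert.hyps by (simp add: mps_slice_times)
  moreover have "mps_agree N \<dots> (\<Sum>q\<in>{p. fst p + snd p = \<alpha>}. ?row (fst q) * ?rest (snd q))"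
    by (intro mps_agree_sum mps_agree_times mps_agree_slice_kernel_row \<eta> N insert.IH)
  ultimately show ?case
    by (simp only:)
qed

lemma mps_slice_cauchy_kernel: "mps_slice \<alpha> (cauchy_kernel a) = H_word (h_angle a) \<alpha>"
proof (rule mps_eqI)
  fix \<beta> :: "nat \<Rightarrow>\<^sub>0 nat"
  let ?E = "\<lambda>(j, k). kernel_factor (h_angle a) j k"
  let ?I = "keys \<alpha> \<times> keys \<beta>"
  have "mps_coeff (cauchy_kernel a) (mono_join \<alpha> \<beta>) = mps_coeff (prod ?E ?I) (mono_join \<alpha> \<beta>)"
    unfolding cauchy_kernel_def kernel_factor_def[symmetric]
    by (rule mps_coeff_mps_prod[of ?I]) (simp, rule mps_coeff_prod_kernel_factor, simp_all add: h_angle_0)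
  also have "prod ?E ?I = (\<Prod>j\<in>keys \<alpha>. \<Prod>k\<in>keys \<beta>. kernel_factor (h_angle a) j k)"
    by (simp add: prod.cartesian_product)
  also have "mps_coeff \<dots> (mono_join \<alpha> \<beta>) = mps_coeff (H_word (h_angle a) \<alpha>) \<beta>"
    using mps_agree_slice_kernel[of "h_angle a" "keys \<beta>" "keys \<alpha>" \<alpha>]
    by (simp add: mps_agree_def h_angle_0)
  finally show "mps_coeff (mps_slice \<alpha> (cauchy_kernel a)) \<beta> = mps_coeff (H_word (h_angle a) \<alpha>) \<beta>"
    by simp
qed

lemma H_word_mono_cons:
  assumes "\<eta> 0 = 1"
  shows "H_word \<eta> (mono_cons k \<alpha>) = sym_H \<eta> k * H_word \<eta> \<alpha>"
proof -
  have "(\<Prod>j\<in>Suc ` keys \<alpha>. sym_H \<eta> (lookup (mono_cons k \<alpha>) j)) = H_word \<eta> \<alpha>"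
    by (simp add: H_word_def prod.reindex)
  then show ?thesis
    using assms unfolding H_word_def keys_mono_cons by (auto simp: sym_H_0)
qed

lemma H_word_0: "H_word \<eta> 0 = 1"
  by (simp add: H_word_def)

section \<open>Commuting operators and their complete homogeneous combinations\<close>

definition mset_partitions :: "nat \<Rightarrow> nat multiset set" where
  "mset_partitions k = {M. 0 \<notin># M \<and> sum_mset M = k}"

lemma bij_betw_mset_partitions: "bij_betw mset (partitions k) (mset_partitions k)"
proof (rule bij_betw_imageI)
  have sub: "partitions k \<subseteq> all_partitions"
    unfolding all_partitions_def by blast
  show "inj_on mset (partitions k)"
    using mset_all_partitions(3) sub by (meson inj_onI subsetD)
  show "mset ` partitions k = mset_partitions k"
  proof
    show "mset ` partitions k \<subseteq> mset_partitions k"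
      using mset_all_partitions(1) sub by (auto simp: mset_partitions_def partitions_def sum_mset_sum_list)
    show "mset_partitions k \<subseteq> mset ` partitions k"
    proof
      fix M assume "M \<in> mset_partitions k"
      then obtain l where "l \<in> partitions k" "mset l = M"
        using mset_all_partitions(2)[of M] by (auto simp: mset_partitions_def)
      then show "M \<in> mset ` partitions k"
        by blast
    qed
  qed
qed

lemma finite_mset_partitions: "finite (mset_partitions k)"
proof -
  have "partitions k \<subseteq> {l. set l \<subseteq> {..k} \<and> length l \<le> k}"
  proof
    fix l assume l: "l \<in> partitions k"
    have "length l \<le> sum_list l"
      using l sum_list_mono[of l "\<lambda>_. 1" "\<lambda>x. x"] by (simp add: partitions_def sum_list_triv)
    then show "l \<in> {l. set l \<subseteq> {..k} \<and> length l \<le> k}"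
      using l member_le_sum_list by (auto simp: partitions_def)
  qed
  then have "finite (partitions k)"
    by (rule finite_subset) (intro finite_lists_length_le finite_atMost)
  then show ?thesis
    using bij_betw_finite[OF bij_betw_mset_partitions] by blast
qed

lemma sum_count_mset: "(\<Sum>i\<in>set_mset M. i * count M i) = sum_mset M" for M :: "nat multiset"
proof -
  have "(\<Sum>i\<in>A. i * count M i) = sum_mset M" if "finite A" "set_mset M \<subseteq> A" for A
    using that(2)
  proof (induction M)
    case (add j M)
    then have "(\<Sum>i\<in>A. i * count (add_mset j M) i) = (\<Sum>i\<in>A. i * count M i + (if i = j then j else 0))"
      by (intro sum.cong) auto
    also have "\<dots> = (\<Sum>i\<in>A. i * count M i) + j"
      using add.prems \<open>finite A\<close> by (simp add: sum.distrib)
    finally show ?case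
      using add by simp
  qed simp
  then show ?thesis
    by simp
qed

text \<open>The common shape of \<open>D_op\<close> and \<open>U_op\<close>: the expansion of
  \<open>h_k\<close> in power sums, with operators \<open>b i\<close> in place of
  \<open>p_i\<close>.\<close>

definition P_op :: "('k::field_char_0 \<Rightarrow> 'v::ab_group_add \<Rightarrow> 'v) \<Rightarrow> (nat \<Rightarrow> 'v \<Rightarrow> 'v) \<Rightarrow> nat \<Rightarrow> 'v \<Rightarrow> 'v" where
  "P_op scale b k x = (\<Sum>l\<in>partitions k. scale (inverse (of_nat (z_part l))) (foldr b l x))"

lemma D_op_eq: "D_op scale B = P_op scale (\<lambda>i. B (int i))"
  by (simp add: fun_eq_iff D_op_def P_op_def)

lemma U_op_eq: "U_op scale B = P_op scale (\<lambda>i. B (- int i))"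
  by (simp add: fun_eq_iff U_op_def P_op_def)

locale commuting_family = vector_space scale
  for scale :: "'k::field_char_0 \<Rightarrow> 'v::ab_group_add \<Rightarrow> 'v" +
  fixes b :: "nat \<Rightarrow> 'v \<Rightarrow> 'v"
  assumes b_add: "i \<ge> 1 \<Longrightarrow> b i (x + y) = b i x + b i y"
    and b_scale: "i \<ge> 1 \<Longrightarrow> b i (scale c x) = scale c (b i x)"
    and b_commute: "i \<ge> 1 \<Longrightarrow> j \<ge> 1 \<Longrightarrow> b i (b j x) = b j (b i x)"
begin

abbreviation "E \<equiv> P_op scale b"

text \<open>Folding over multisets requires that the operators for all indices commute, and nothing
  is assumed about \<open>b 0\<close>; the identity takes its place.\<close>

definition b' :: "nat \<Rightarrow> 'v \<Rightarrow> 'v" where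
  "b' i = (if i = 0 then id else b i)"

lemma b'_commute: "comp_fun_commute b'"
  by unfold_locales (auto simp: b'_def fun_eq_iff b_commute Suc_le_eq)

lemma b_zero: "i \<ge> 1 \<Longrightarrow> b i 0 = 0"
  using b_scale[of i 0 0] by simp

lemma b_sum: "i \<ge> 1 \<Longrightarrow> b i (\<Sum>x\<in>A. f x) = (\<Sum>x\<in>A. b i (f x))"
  by (induction A rule: infinite_finite_induct) (simp_all add: b_add b_zero)

abbreviation "bm M x \<equiv> fold_mset b' x M"

lemma bm_add_mset: "i \<ge> 1 \<Longrightarrow> bm (add_mset i M) x = b i (bm M x)"
  by (simp add: comp_fun_commute.fold_mset_add_mset[OF b'_commute] b'_def)

lemma foldr_eq_bm: "0 \<notin> set l \<Longrightarrow> foldr b l x = bm (mset l) x"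
proof (induction l)
  case (Cons i l)
  then have "i \<ge> 1" "0 \<notin> set l"
    by auto
  with Cons.IH show ?case
    by (simp add: bm_add_mset)
qed simp

lemma E_eq_bm: "E k x = (\<Sum>M\<in>mset_partitions k. scale (inverse (of_nat (z_mset M))) (bm M x))"
proof -
  have "E k x = (\<Sum>l\<in>partitions k. scale (inverse (of_nat (z_mset (mset l)))) (bm (mset l) x))"
    unfolding P_op_def
  proof (rule sum.cong[OF refl])
    fix l assume "l \<in> partitions k"
    then have "0 \<notin> set l"
      by (force simp: partitions_def)
    then show "scale (inverse (of_nat (z_part l))) (foldr b l x)
      = scale (inverse (of_nat (z_mset (mset l)))) (bm (mset l) x)"
      by (simp add: foldr_eq_bm z_part_eq)
  qed
  also have "\<dots> = (\<Sum>M\<in>mset_partitions k. scale (inverse (of_nat (z_mset M))) (bm M x))"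
    by (rule sum.reindex_bij_betw[OF bij_betw_mset_partitions])
  finally show ?thesis .
qed

lemma E_0: "E 0 x = x"
proof -
  have "mset_partitions 0 = {{#}}"
    by (auto simp: mset_partitions_def) (metis multi_nonempty_split union_single_eq_member)
  then show ?thesis
    by (simp add: E_eq_bm z_mset_def)
qed

text \<open>Write \<open>k\<close> as the sum of \<open>i * count M i\<close> over the distinct
  parts of \<open>M\<close>. Removing one part \<open>i\<close> divides \<open>z_mset M\<close> by
  precisely this number, and pairs of a multiset and a part correspond to pairs of a part and a
  multiset of sum \<open>k - i\<close>.\<close>

lemma E_newton: "scale (of_nat k) (E k x) = (\<Sum>i\<in>{1..k}. b i (E (k - i) x))"
proof -
  let ?c = "\<lambda>M. inverse (of_nat (z_mset M)) :: 'k"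
  let ?S = "SIGMA M:mset_partitions k. set_mset M"
  let ?T = "SIGMA i:{1..k}. mset_partitions (k - i)"
  have "scale (of_nat k) (E k x) = (\<Sum>M\<in>mset_partitions k. \<Sum>i\<in>set_mset M. scale (?c (M - {#i#})) (b i (bm (M - {#i#}) x)))"
    unfolding E_eq_bm scale_sum_right
  proof (rule sum.cong[OF refl])
    fix M assume M: "M \<in> mset_partitions k"
    have "scale (of_nat k) (scale (?c M) (bm M x)) = (\<Sum>i\<in>set_mset M. scale (of_nat (i * count M i) * ?c M) (bm M x))"
    proof -
      have "(of_nat k :: 'k) = (\<Sum>i\<in>set_mset M. of_nat (i * count M i))"
        using M sum_count_mset[of M] by (simp add: mset_partitions_def of_nat_sum[symmetric] del: of_nat_sum of_nat_mult)
      then show ?thesis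
        by (simp only: scale_scale scale_sum_left[symmetric] sum_distrib_right)
    qed
    also have "\<dots> = (\<Sum>i\<in>set_mset M. scale (?c (M - {#i#})) (b i (bm (M - {#i#}) x)))"
    proof (rule sum.cong[OF refl])
      fix i assume i: "i \<in># M"
      then have N: "M = add_mset i (M - {#i#})" and i1: "i \<ge> 1"
        using M by (auto simp: mset_partitions_def Suc_le_eq intro: gr0I)
      define N where "N = M - {#i#}"
      then have MN: "M = add_mset i N"
        using N by simp
      define r :: 'k where "r = of_nat (i * Suc (count N i))"
      have "r \<noteq> 0"
        using i1 unfolding r_def of_nat_eq_0_iff by simp
      moreover have "of_nat (i * count M i) * ?c M = r * inverse (r * of_nat (z_mset N))"
        unfolding MN z_mset_add_mset r_def by (simp del: of_nat_Suc)
      ultimately have "of_nat (i * count M i) * ?c M = ?c N"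
        by (simp only: inverse_mult_distrib mult.assoc[symmetric] right_inverse mult_1_left simp_thms)
      then show "scale (of_nat (i * count M i) * ?c M) (bm M x) = scale (?c (M - {#i#})) (b i (bm (M - {#i#}) x))"
        unfolding N_def[symmetric] by (simp only: MN bm_add_mset[OF i1])
    qed
    finally show "scale (of_nat k) (scale (?c M) (bm M x))
      = (\<Sum>i\<in>set_mset M. scale (?c (M - {#i#})) (b i (bm (M - {#i#}) x)))" .
  qed
  also have "\<dots> = (\<Sum>(M, i)\<in>?S. scale (?c (M - {#i#})) (b i (bm (M - {#i#}) x)))"
    by (rule sum.Sigma) (simp_all add: finite_mset_partitions)
  also have "\<dots> = (\<Sum>(i, N)\<in>?T. scale (?c N) (b i (bm N x)))"
  proof (rule sum.reindex_bij_witness[where j = "\<lambda>(M, i). (i, M - {#i#})" and i = "\<lambda>(i, N). (add_mset i N, i)"])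
    fix p assume "p \<in> ?S"
    then obtain M i where p: "p = (M, i)" and M: "0 \<notin># M" "sum_mset M = k" and i: "i \<in># M"
      by (auto simp: mset_partitions_def)
    obtain N where N: "M = add_mset i N"
      using i by (metis mset_add)
    show "(case (case p of (M, i) \<Rightarrow> (i, M - {#i#})) of (i, N) \<Rightarrow> (add_mset i N, i)) = p"
      using p N by simp
    show "(case p of (M, i) \<Rightarrow> (i, M - {#i#})) \<in> ?T"
      using p N M by (auto simp: mset_partitions_def Suc_le_eq)
    show "(case case p of (M, i) \<Rightarrow> (i, M - {#i#}) of (i, N) \<Rightarrow> scale (?c N) (b i (bm N x)))
      = (case p of (M, i) \<Rightarrow> scale (?c (M - {#i#})) (b i (bm (M - {#i#}) x)))"
      using p by simp
  next
    fix p assume "p \<in> ?T"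
    then obtain i N where p: "p = (i, N)" and "1 \<le> i" "i \<le> k" "0 \<notin># N" "sum_mset N = k - i"
      by (auto simp: mset_partitions_def)
    then show "(case case p of (i, N) \<Rightarrow> (add_mset i N, i) of (M, i) \<Rightarrow> (i, M - {#i#})) = p"
      "(case p of (i, N) \<Rightarrow> (add_mset i N, i)) \<in> ?S"
      by (auto simp: mset_partitions_def)
  qed
  also have "\<dots> = (\<Sum>i\<in>{1..k}. \<Sum>N\<in>mset_partitions (k - i). scale (?c N) (b i (bm N x)))"
    by (rule sum.Sigma[symmetric]) (simp_all add: finite_mset_partitions)
  also have "\<dots> = (\<Sum>i\<in>{1..k}. b i (E (k - i) x))"
    unfolding E_eq_bm by (rule sum.cong) (simp_all add: b_sum b_scale)
  finally show ?thesis .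
qed

text \<open>Linearity and commutation of \<open>E\<close> are derived from the Newton recursion,
  where one \<open>b i\<close> appears at a time, and not from the sum over partitions.\<close>

lemma E_add: "E k (x + y) = E k x + E k y"
proof (induction k rule: less_induct)
  case (less k)
  show ?case
  proof (cases "k = 0")
    case False
    have "scale (of_nat k) (E k (x + y)) = scale (of_nat k) (E k x + E k y)"
      unfolding scale_right_distrib E_newton sum.distrib[symmetric]
      by (rule sum.cong) (simp_all add: less b_add)
    with False show ?thesis
      by simp
  qed (simp add: E_0)
qed

lemma E_scale: "E k (scale c x) = scale c (E k x)"
proof (induction k rule: less_induct)
  case (less k)
  show ?case
  proof (cases "k = 0")
    case False
    have "scale (of_nat k) (E k (scale c x)) = scale c (scale (of_nat k) (E k x))"
      unfolding E_newton scale_sum_right by (rule sum.cong) (simp_all add: less b_scale)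
    also have "\<dots> = scale (of_nat k) (scale c (E k x))"
      by (rule scale_left_commute)
    finally have "scale (of_nat k) (E k (scale c x)) = scale (of_nat k) (scale c (E k x))" .
    then show ?thesis
      by (rule scale_left_imp_eq[rotated]) (use False in simp)
  qed (simp add: E_0)
qed

lemma E_zero: "E k 0 = 0"
  using E_scale[of k 0 0] by simp

lemma E_sum: "E k (\<Sum>i\<in>A. f i) = (\<Sum>i\<in>A. E k (f i))"
  by (induction A rule: infinite_finite_induct) (simp_all add: E_add E_zero)

lemma b_E_commute: "i \<ge> 1 \<Longrightarrow> b i (E k x) = E k (b i x)"
proof (induction k rule: less_induct)
  case (less k)
  show ?case
  proof (cases "k = 0")
    case False
    have "scale (of_nat k) (b i (E k x)) = b i (\<Sum>j\<in>{1..k}. b j (E (k - j) x))"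
      using less.prems by (simp only: b_scale[symmetric] E_newton)
    also have "\<dots> = (\<Sum>j\<in>{1..k}. b j (E (k - j) (b i x)))"
      unfolding b_sum[OF less.prems] using less by (intro sum.cong) (simp_all add: b_commute[of i])
    also have "\<dots> = scale (of_nat k) (E k (b i x))"
      by (rule E_newton[symmetric])
    finally show ?thesis
      using False by simp
  qed (simp add: E_0)
qed

lemma E_commute: "E k (E l x) = E l (E k x)"
proof (induction k arbitrary: x rule: less_induct)
  case (less k)
  show ?case
  proof (cases "k = 0")
    case False
    have "scale (of_nat k) (E k (E l x)) = (\<Sum>i\<in>{1..k}. E l (b i (E (k - i) x)))"
      unfolding E_newton using less by (intro sum.cong) (simp_all add: b_E_commute)
    also have "\<dots> = scale (of_nat k) (E l (E k x))"
      by (simp only: E_sum[symmetric] E_newton[symmetric] E_scale)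
    finally show ?thesis
      using False by simp
  qed (simp add: E_0)
qed

end

section \<open>Commutation of the generating series\<close>

text \<open>The operators \<open>b\<^sub>i\<close> and \<open>c\<^sub>i\<close> are \<open>B'\<^sub>i\<close> and \<open>B'\<^bsub>-i\<^esub>\<close>.\<close>

locale two_families =
  D: commuting_family scale b + U: commuting_family scale c
  for scale :: "'k::field_char_0 \<Rightarrow> 'v::ab_group_add \<Rightarrow> 'v" and b c +
  fixes a \<eta> :: "nat \<Rightarrow> 'k"
  assumes \<eta>_0: "\<eta> 0 = 1"
    and \<eta>_newton: "of_nat n * \<eta> n = (\<Sum>i\<in>{1..n}. a i * \<eta> (n - i))"
begin

abbreviation "D \<equiv> P_op scale b"
abbreviation "U \<equiv> P_op scale c"

definition heisenberg_rel :: bool where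
  "heisenberg_rel \<longleftrightarrow> (\<forall>j\<ge>1. \<forall>l\<ge>1. \<forall>x.
    b j (c l x) - c l (b j x) = scale (if j = l then of_nat j * a j else 0) x)"

text \<open>The half-step between the two relations: the coefficients of
  \<open>[b_j, U(x)] = a_j x^j U(x)\<close>.\<close>

definition bU_rel :: "nat \<Rightarrow> bool" where
  "bU_rel j \<longleftrightarrow> (\<forall>l x. b j (U l x) = U l (b j x) + (if j \<le> l then scale (a j) (U (l - j) x) else 0))"

definition DU_rel :: bool where
  "DU_rel \<longleftrightarrow> (\<forall>k l x. D k (U l x) = (\<Sum>n\<le>k. if n \<le> l then scale (\<eta> n) (U (l - n) (D (k - n) x)) else 0))"

text \<open>Newton's identity for \<open>U\<close> splits \<open>l [b_j, U_l]\<close> into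
  commutators of \<open>b j\<close> with the \<open>c i\<close> and with smaller \<open>U_m\<close>.
  The rule is demanded only for \<open>m < l\<close>, so the lemma fits inside an induction on
  \<open>l\<close>.\<close>

lemma sum_commutators:
  assumes "j \<ge> 1" and "\<And>m. m < l \<Longrightarrow> b j (U m x) = U m (b j x) + (if j \<le> m then scale (a j) (U (m - j) x) else 0)"
  shows "(\<Sum>i\<in>{1..l}. b j (c i (U (l - i) x)) - c i (b j (U (l - i) x)))
    = scale (of_nat l) (b j (U l x)) - scale (of_nat l) (U l (b j x))
      - (if j \<le> l then scale (of_nat (l - j) * a j) (U (l - j) x) else 0)"
proof -
  have "(\<Sum>i\<in>{1..l}. b j (c i (U (l - i) x))) = scale (of_nat l) (b j (U l x))"
    using assms(1) by (simp only: D.b_sum[symmetric] U.E_newton[symmetric] D.b_scale)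
  moreover have "(\<Sum>i\<in>{1..l}. c i (b j (U (l - i) x)))
    = (\<Sum>i\<in>{1..l}. c i (U (l - i) (b j x)) + (if j \<le> l - i then scale (a j) (c i (U (l - i - j) x)) else 0))"
    by (rule sum.cong) (auto simp: assms(2) U.b_add U.b_scale U.b_zero)
  moreover have "\<dots> = scale (of_nat l) (U l (b j x))
      + (\<Sum>i\<in>{1..l}. if j \<le> l - i then scale (a j) (c i (U (l - i - j) x)) else 0)"
    unfolding sum.distrib U.E_newton ..
  moreover have "(\<Sum>i\<in>{1..l}. if j \<le> l - i then scale (a j) (c i (U (l - i - j) x)) else 0)
    = (if j \<le> l then scale (of_nat (l - j) * a j) (U (l - j) x) else 0)"
  proof (cases "j \<le> l")
    case True
    have "(\<Sum>i\<in>{1..l}. if j \<le> l - i then scale (a j) (c i (U (l - i - j) x)) else 0)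
      = (\<Sum>i\<in>{1..l - j}. scale (a j) (c i (U (l - j - i) x)))"
      using assms(1) by (intro sum.mono_neutral_cong_right) (auto simp: diff_diff_add add.commute)
    also have "\<dots> = scale (a j) (scale (of_nat (l - j)) (U (l - j) x))"
      by (simp only: D.scale_sum_right[symmetric] U.E_newton)
    finally show ?thesis
      using True by (simp add: mult.commute)
  next
    case False
    then show ?thesis
      by (auto intro!: sum.neutral)
  qed
  ultimately show ?thesis
    by (simp add: sum_subtractf algebra_simps)
qed

text \<open>Only the commutator with \<open>c j\<close> survives and contributes a factor
  \<open>j\<close>; the smaller \<open>U_m\<close> contribute \<open>l - j\<close>. Together they
  give the \<open>l\<close> that is cancelled.\<close>

lemma heisenberg_imp_bU:
  assumes heisenberg_rel "j \<ge> 1"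
  shows "bU_rel j"
proof -
  have "b j (U l x) = U l (b j x) + (if j \<le> l then scale (a j) (U (l - j) x) else 0)" for l x
  proof (induction l rule: less_induct)
    case (less l)
    show ?case
    proof (cases "l = 0")
      case True
      then show ?thesis
        using assms(2) by (simp add: U.E_0)
    next
      case False
      have "(\<Sum>i\<in>{1..l}. b j (c i (U (l - i) x)) - c i (b j (U (l - i) x)))
        = (\<Sum>i\<in>{1..l}. if i = j then scale (of_nat j * a j) (U (l - j) x) else 0)"
        using assms by (intro sum.cong) (auto simp: heisenberg_rel_def)
      also have "\<dots> = (if j \<le> l then scale (of_nat j * a j) (U (l - j) x) else 0)"
        using assms(2) by simp
      finally have eq: "scale (of_nat l) (b j (U l x)) - scale (of_nat l) (U l (b j x))
          - (if j \<le> l then scale (of_nat (l - j) * a j) (U (l - j) x) else 0)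
          = (if j \<le> l then scale (of_nat j * a j) (U (l - j) x) else 0)"
        using sum_commutators[OF assms(2) less] by simp
      have "scale (of_nat l) (b j (U l x)) = scale (of_nat l) (U l (b j x) + (if j \<le> l then scale (a j) (U (l - j) x) else 0))"
      proof (cases "j \<le> l")
        case True
        have "scale (of_nat l) (b j (U l x)) = scale (of_nat l) (U l (b j x))
          + (scale (of_nat (l - j) * a j) (U (l - j) x) + scale (of_nat j * a j) (U (l - j) x))"
          using eq True by (simp add: algebra_simps)
        also have "scale (of_nat (l - j) * a j) (U (l - j) x) + scale (of_nat j * a j) (U (l - j) x)
          = scale (of_nat l) (scale (a j) (U (l - j) x))"
          unfolding D.scale_left_distrib[symmetric] distrib_right[symmetric] of_nat_add[symmetric] using True by simp
        finally show ?thesis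
          using True by (simp add: D.scale_right_distrib)
      next
        case False
        then show ?thesis
          using eq by simp
      qed
      then show ?thesis
        using False by simp
    qed
  qed
  then show ?thesis
    by (simp add: bU_rel_def)
qed

text \<open>In the sum of commutators the term \<open>i = l\<close> is followed by
  \<open>U 0 = id\<close>, so it is the commutator of \<open>b j\<close> and \<open>c l\<close>
  itself; the terms \<open>i < l\<close> are known by induction.\<close>

lemma bU_imp_heisenberg:
  assumes bU: "\<And>j. j \<ge> 1 \<Longrightarrow> bU_rel j"
  shows heisenberg_rel
proof -
  have "b j (c l x) - c l (b j x) = scale (if j = l then of_nat j * a j else 0) x"
    if j: "j \<ge> 1" and l: "l \<ge> 1" for j l x
    using l
  proof (induction l arbitrary: x rule: less_induct)
    case (less l)
    have bUj: "b j (U m x) = U m (b j x) + (if j \<le> m then scale (a j) (U (m - j) x) else 0)" for m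
      using bU[OF j] by (simp add: bU_rel_def)
    have "(\<Sum>i\<in>{1..l}. b j (c i (U (l - i) x)) - c i (b j (U (l - i) x)))
      = (if j \<le> l then scale (of_nat j * a j) (U (l - j) x) else 0)"
    proof (cases "j \<le> l")
      case True
      have "scale (of_nat l) (b j (U l x)) = scale (of_nat l) (U l (b j x)) + scale (of_nat l * a j) (U (l - j) x)"
        using True by (simp add: bUj D.scale_right_distrib)
      moreover have "(of_nat l * a j) = of_nat (l - j) * a j + of_nat j * a j"
        using True by (simp add: distrib_right[symmetric] of_nat_add[symmetric] del: of_nat_add)
      ultimately show ?thesis
        using True unfolding sum_commutators[OF j bUj] by (simp add: D.scale_left_distrib)
    next
      case False
      then show ?thesis
        unfolding sum_commutators[OF j bUj] by (simp add: bUj)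
    qed
    moreover have "{1..l} = insert l {1..<l}"
      using less.prems by auto
    moreover have "(\<Sum>i\<in>{1..<l}. b j (c i (U (l - i) x)) - c i (b j (U (l - i) x)))
      = (\<Sum>i\<in>{1..<l}. if i = j then scale (of_nat j * a j) (U (l - j) x) else 0)"
      using less.IH by (intro sum.cong) auto
    moreover have "\<dots> = (if j < l then scale (of_nat j * a j) (U (l - j) x) else 0)"
      using j by simp
    ultimately have "b j (c l x) - c l (b j x) + (if j < l then scale (of_nat j * a j) (U (l - j) x) else 0)
      = (if j \<le> l then scale (of_nat j * a j) (U (l - j) x) else 0)"
      by (simp add: U.E_0)
    then show ?case
      by (cases j l rule: linorder_cases) (simp_all add: U.E_0)
  qed
  then show ?thesis
    by (simp add: heisenberg_rel_def)
qed

text \<open>The summand for \<open>i\<close> is \<open>b\<^sub>i D\<^bsub>k-i\<^esub> U\<^sub>l\<close> after both commutation rules have been applied.\<close>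

lemma sum_DU_newton:
  "(\<Sum>i\<in>{1..k}. \<Sum>n\<le>k - i. if n \<le> l then scale (\<eta> n) (U (l - n) (b i (D (k - i - n) x))
      + (if i \<le> l - n then scale (a i) (U (l - n - i) (D (k - i - n) x)) else 0)) else 0)
    = scale (of_nat k) (\<Sum>n\<le>k. if n \<le> l then scale (\<eta> n) (U (l - n) (D (k - n) x)) else 0)"
proof -
  let ?V = "\<lambda>n. U (l - n) (D (k - n) x)"
  \<comment> \<open>For the summands containing \<open>b i\<close>: with \<open>n\<close> outside,
    Newton's identity for \<open>D\<close> applies and yields the factor
    \<open>k - n\<close>.\<close>
  have swap: "(\<Sum>i\<in>{1..k}. \<Sum>n\<le>k - i. f i n) = (\<Sum>n\<le>k. \<Sum>i\<in>{1..k - n}. f i n)" for f :: "nat \<Rightarrow> nat \<Rightarrow> 'v"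
    unfolding sum.Sigma[OF finite_atLeastAtMost ballI[OF finite_atMost]]
      sum.Sigma[OF finite_atMost ballI[OF finite_atLeastAtMost]]
    by (rule sum.reindex_bij_witness[where i = "\<lambda>(n, i). (i, n)" and j = "\<lambda>(i, n). (n, i)"]) auto
  \<comment> \<open>For the summands containing \<open>a i\<close>: collected by
    \<open>N = n + i\<close>, they are subject to Newton's identity for \<open>\<eta>\<close>, with
    factor \<open>N\<close>. The two factors add up to \<open>k\<close>.\<close>
  have diag: "(\<Sum>i\<in>{1..k}. \<Sum>n\<le>k - i. f i n) = (\<Sum>N\<le>k. \<Sum>i\<in>{1..N}. f i (N - i))" for f :: "nat \<Rightarrow> nat \<Rightarrow> 'v"
    unfolding sum.Sigma[OF finite_atLeastAtMost ballI[OF finite_atMost]]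
      sum.Sigma[OF finite_atMost ballI[OF finite_atLeastAtMost]]
    by (rule sum.reindex_bij_witness[where i = "\<lambda>(N, i). (i, N - i)" and j = "\<lambda>(i, n). (n + i, i)"]) auto
  have "(\<Sum>i\<in>{1..k}. \<Sum>n\<le>k - i. if n \<le> l then scale (\<eta> n) (U (l - n) (b i (D (k - i - n) x))
      + (if i \<le> l - n then scale (a i) (U (l - n - i) (D (k - i - n) x)) else 0)) else 0)
    = (\<Sum>i\<in>{1..k}. \<Sum>n\<le>k - i. if n \<le> l then scale (\<eta> n) (U (l - n) (b i (D (k - n - i) x))) else 0)
      + (\<Sum>i\<in>{1..k}. \<Sum>n\<le>k - i. if n + i \<le> l then scale (a i * \<eta> n) (?V (n + i)) else 0)"
    unfolding sum.distrib[symmetric]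
    by (intro sum.cong refl) (auto simp: D.scale_right_distrib mult.commute diff_diff_add add.commute)
  also have "(\<Sum>i\<in>{1..k}. \<Sum>n\<le>k - i. if n \<le> l then scale (\<eta> n) (U (l - n) (b i (D (k - n - i) x))) else 0)
    = (\<Sum>n\<le>k. if n \<le> l then scale (of_nat (k - n) * \<eta> n) (?V n) else 0)"
    unfolding swap
  proof (rule sum.cong[OF refl])
    fix n
    have "(\<Sum>i\<in>{1..k - n}. scale (\<eta> n) (U (l - n) (b i (D (k - n - i) x)))) = scale (\<eta> n) (scale (of_nat (k - n)) (?V n))"
      by (simp only: D.scale_sum_right[symmetric] U.E_sum[symmetric] D.E_newton[symmetric] U.E_scale)
    then show "(\<Sum>i\<in>{1..k - n}. if n \<le> l then scale (\<eta> n) (U (l - n) (b i (D (k - n - i) x))) else 0)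
      = (if n \<le> l then scale (of_nat (k - n) * \<eta> n) (?V n) else 0)"
      by (simp add: mult.commute)
  qed
  also have "(\<Sum>i\<in>{1..k}. \<Sum>n\<le>k - i. if n + i \<le> l then scale (a i * \<eta> n) (?V (n + i)) else 0)
    = (\<Sum>n\<le>k. if n \<le> l then scale (of_nat n * \<eta> n) (?V n) else 0)"
    unfolding diag
  proof (rule sum.cong[OF refl])
    fix N
    have "(\<Sum>i\<in>{1..N}. if N - i + i \<le> l then scale (a i * \<eta> (N - i)) (?V (N - i + i)) else 0)
      = (\<Sum>i\<in>{1..N}. if N \<le> l then scale (a i * \<eta> (N - i)) (?V N) else 0)"
      by (rule sum.cong) auto
    also have "\<dots> = (if N \<le> l then scale (of_nat N * \<eta> N) (?V N) else 0)"
      by (simp add: \<eta>_newton D.scale_sum_left)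
    finally show "(\<Sum>i\<in>{1..N}. if N - i + i \<le> l then scale (a i * \<eta> (N - i)) (?V (N - i + i)) else 0)
      = (if N \<le> l then scale (of_nat N * \<eta> N) (?V N) else 0)" .
  qed
  also have "(\<Sum>n\<le>k. if n \<le> l then scale (of_nat (k - n) * \<eta> n) (?V n) else 0)
      + (\<Sum>n\<le>k. if n \<le> l then scale (of_nat n * \<eta> n) (?V n) else 0)
    = (\<Sum>n\<le>k. scale (of_nat k) (if n \<le> l then scale (\<eta> n) (?V n) else 0))"
    unfolding sum.distrib[symmetric]
    by (intro sum.cong) (auto simp: D.scale_left_distrib[symmetric] distrib_right[symmetric] of_nat_add[symmetric] simp del: of_nat_add)
  finally show ?thesis
    by (simp only: D.scale_sum_right)
qed

lemma b_DU_sum: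
  assumes "bU_rel i" "i \<ge> 1"
  shows "b i (\<Sum>n\<le>k - i. if n \<le> l then scale (\<eta> n) (U (l - n) (D (k - i - n) x)) else 0)
    = (\<Sum>n\<le>k - i. if n \<le> l then scale (\<eta> n) (U (l - n) (b i (D (k - i - n) x))
      + (if i \<le> l - n then scale (a i) (U (l - n - i) (D (k - i - n) x)) else 0)) else 0)"
  unfolding D.b_sum[OF assms(2)]
  using assms by (intro sum.cong) (auto simp: D.b_scale D.b_zero bU_rel_def)

text \<open>After Newton's identity for \<open>D k\<close>, the induction hypothesis moves
  \<open>D (k - i)\<close> past \<open>U l\<close> and the half-step moves \<open>b i\<close>;
  \<open>sum_DU_newton\<close> evaluates the outcome.\<close>

lemma bU_imp_DU:
  assumes bU: "\<And>j. j \<ge> 1 \<Longrightarrow> bU_rel j"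
  shows DU_rel
proof -
  have "D k (U l x) = (\<Sum>n\<le>k. if n \<le> l then scale (\<eta> n) (U (l - n) (D (k - n) x)) else 0)" for k l x
  proof (induction k rule: less_induct)
    case (less k)
    show ?case
    proof (cases "k = 0")
      case True
      then show ?thesis
        by (simp add: D.E_0 \<eta>_0)
    next
      case False
      have "scale (of_nat k) (D k (U l x)) = (\<Sum>i\<in>{1..k}. b i (D (k - i) (U l x)))"
        by (rule D.E_newton)
      also have "\<dots> = (\<Sum>i\<in>{1..k}. \<Sum>n\<le>k - i. if n \<le> l then scale (\<eta> n) (U (l - n) (b i (D (k - i - n) x))
          + (if i \<le> l - n then scale (a i) (U (l - n - i) (D (k - i - n) x)) else 0)) else 0)"
      proof (rule sum.cong[OF refl])
        fix i assume i: "i \<in> {1..k}"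
        then have "k - i < k" "i \<ge> 1"
          by auto
        then show "b i (D (k - i) (U l x)) = (\<Sum>n\<le>k - i. if n \<le> l then scale (\<eta> n) (U (l - n) (b i (D (k - i - n) x))
          + (if i \<le> l - n then scale (a i) (U (l - n - i) (D (k - i - n) x)) else 0)) else 0)"
          unfolding less.IH[OF \<open>k - i < k\<close>] by (intro b_DU_sum bU)
      qed
      finally show ?thesis
        unfolding sum_DU_newton using False by simp
    qed
  qed
  then show ?thesis
    by (simp add: DU_rel_def)
qed

text \<open>Two expansions of \<open>j D_j U_l\<close> agree term by term for \<open>i < j\<close>
  by induction. The remaining term \<open>i = j\<close> has \<open>D 0 = id\<close> and is the
  claim.\<close>

lemma DU_imp_bU:
  assumes DU: DU_rel and "j \<ge> 1"
  shows "bU_rel j"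
  using assms(2)
proof (induction j rule: less_induct)
  case (less j)
  have "b j (U l x) = U l (b j x) + (if j \<le> l then scale (a j) (U (l - j) x) else 0)" for l x
  proof -
    let ?L = "\<lambda>i. b i (D (j - i) (U l x))"
    let ?R = "\<lambda>i. \<Sum>n\<le>j - i. if n \<le> l then scale (\<eta> n) (U (l - n) (b i (D (j - i - n) x))
          + (if i \<le> l - n then scale (a i) (U (l - n - i) (D (j - i - n) x)) else 0)) else 0"
    have DU': "D k (U l x) = (\<Sum>n\<le>k. if n \<le> l then scale (\<eta> n) (U (l - n) (D (k - n) x)) else 0)" for k
      using DU by (simp add: DU_rel_def)
    have "(\<Sum>i\<in>{1..j}. ?L i) = scale (of_nat j) (D j (U l x))"
      by (rule D.E_newton[symmetric])
    also have "\<dots> = (\<Sum>i\<in>{1..j}. ?R i)"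
      unfolding sum_DU_newton DU' ..
    finally have "(\<Sum>i\<in>insert j {1..<j}. ?L i) = (\<Sum>i\<in>insert j {1..<j}. ?R i)"
      using less.prems by (simp add: insert_absorb atLeastLessThanSuc_atLeastAtMost[symmetric] atLeastLessThanSuc)
    moreover have "(\<Sum>i\<in>{1..<j}. ?L i) = (\<Sum>i\<in>{1..<j}. ?R i)"
    proof (rule sum.cong[OF refl])
      fix i assume "i \<in> {1..<j}"
      then show "?L i = ?R i"
        unfolding DU' by (intro b_DU_sum less.IH) auto
    qed
    ultimately have "?L j = ?R j"
      by simp
    then show ?thesis
      by (simp add: D.E_0 \<eta>_0)
  qed
  then show ?case
    by (simp add: bU_rel_def)
qed

lemma heisenberg_iff_DU: "heisenberg_rel \<longleftrightarrow> DU_rel"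
  using heisenberg_imp_bU bU_imp_DU DU_imp_bU bU_imp_heisenberg by blast

end

section \<open>Words of operators\<close>

text \<open>Because \<open>T 0\<close> is the identity, a word may be read up to any bound past its
  degree, so words of different degrees can be compared over a common range.\<close>

lemma apply_word_eq_fold:
  assumes "T 0 = id" "Poly_Mapping.degree \<alpha> \<le> n"
  shows "apply_word T \<alpha> = fold (\<lambda>i. T (lookup \<alpha> i)) [0..<n]"
proof -
  have "fold (\<lambda>i. T (lookup \<alpha> i)) [Poly_Mapping.degree \<alpha>..<Poly_Mapping.degree \<alpha> + m] = id" for m
    using assms(1) by (induction m) (simp_all add: beyond_degree_lookup_zero)
  from this[of "n - Poly_Mapping.degree \<alpha>"] show ?thesis
    using assms(2) upt_add_eq_append[of 0 "Poly_Mapping.degree \<alpha>" "n - Poly_Mapping.degree \<alpha>"]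
    by (simp add: apply_word_def)
qed

lemma apply_word_mono_cons:
  assumes "T 0 = id"
  shows "apply_word T (mono_cons k \<alpha>) x = apply_word T \<alpha> (T k x)"
proof -
  define n where "n = max (Poly_Mapping.degree \<alpha>) (Poly_Mapping.degree (mono_cons k \<alpha>))"
  have "[0..<Suc n] = 0 # map Suc [0..<n]"
    by (simp add: upt_conv_Cons map_Suc_upt del: upt_Suc)
  then have "apply_word T (mono_cons k \<alpha>) x = fold (\<lambda>i. T (lookup \<alpha> i)) [0..<n] (T k x)"
    by (subst apply_word_eq_fold[where n = "Suc n"])
      (simp_all add: assms n_def fold_map comp_def del: upt_Suc)
  then show ?thesis
    by (subst apply_word_eq_fold[where n = n and \<alpha> = \<alpha>]) (simp_all add: assms n_def)
qed

lemma apply_word_0: "apply_word T 0 x = x"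
  by (simp add: apply_word_def)

lemma apply_word_eq_fold_mset:
  assumes "T 0 = id" "comp_fun_commute T"
  shows "apply_word T \<alpha> x = fold_mset T x (vals \<alpha>)"
proof (induction \<alpha> arbitrary: x rule: mono_cons_induct)
  case zero
  then show ?case
    by (simp add: apply_word_0 vals_def)
next
  case (cons k \<alpha>)
  then show ?case
    using assms
    by (simp add: apply_word_mono_cons vals_mono_cons comp_fun_commute.fold_mset_add_mset
        comp_fun_commute.fold_mset_fun_left_comm)
qed

context commuting_family
begin

lemma E_0_id: "E 0 = id"
  by (simp add: fun_eq_iff E_0)

abbreviation "Ew \<equiv> apply_word E"

lemma Ew_mono_cons: "Ew (mono_cons k \<alpha>) x = Ew \<alpha> (E k x)"
  by (rule apply_word_mono_cons, rule E_0_id)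

lemma Ew_0: "Ew 0 x = x"
  by (rule apply_word_0)

lemma Ew_add: "Ew \<alpha> (x + y) = Ew \<alpha> x + Ew \<alpha> y"
  by (induction \<alpha> arbitrary: x y rule: mono_cons_induct) (simp_all add: Ew_mono_cons Ew_0 E_add)

lemma Ew_scale: "Ew \<alpha> (scale c x) = scale c (Ew \<alpha> x)"
  by (induction \<alpha> arbitrary: x rule: mono_cons_induct) (simp_all add: Ew_mono_cons Ew_0 E_scale)

text \<open>Commuting operators turn a word into a fold over the multiset of its exponents; this is
  the symmetry of the generating series.\<close>

lemma Ew_vals: "vals \<alpha> = vals \<beta> \<Longrightarrow> Ew \<alpha> x = Ew \<beta> x"
proof -
  have "comp_fun_commute E"
    by unfold_locales (simp add: fun_eq_iff E_commute)
  then show "vals \<alpha> = vals \<beta> \<Longrightarrow> Ew \<alpha> x = Ew \<beta> x"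
    by (simp add: apply_word_eq_fold_mset E_0_id)
qed

lemma E_kill:
  assumes "\<And>i. i \<ge> 1 \<Longrightarrow> b i x = 0"
  shows "E k x = (if k = 0 then x else 0)"
proof (cases "k = 0")
  case False
  have "scale (of_nat k) (E k x) = 0"
    unfolding E_newton using assms by (intro sum.neutral) (simp add: b_E_commute E_zero)
  with False show ?thesis
    by simp
qed (simp add: E_0)

lemma Ew_zero: "Ew \<alpha> 0 = 0"
  using Ew_scale[of \<alpha> 0 0] by simp

lemma Ew_kill:
  assumes "\<And>i. i \<ge> 1 \<Longrightarrow> b i x = 0"
  shows "Ew \<alpha> x = (if \<alpha> = 0 then x else 0)"
  by (induction \<alpha> rule: mono_cons_induct)
    (auto simp: Ew_mono_cons Ew_0 E_kill[OF assms] Ew_zero mono_cons_eq_0_iff)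

definition Gser :: "('v \<Rightarrow> 'k) \<Rightarrow> 'v \<Rightarrow> (nat, 'k) mps" where
  "Gser \<phi> x = Abs_mps (\<lambda>\<beta>. \<phi> (Ew \<beta> x))"

lemma mps_coeff_Gser [simp]: "mps_coeff (Gser \<phi> x) \<beta> = \<phi> (Ew \<beta> x)"
  by (simp add: Gser_def)

lemma sym_T_Gser: "sym_T k (Gser \<phi> x) = Gser \<phi> (E k x)"
  by (rule mps_eqI) (simp add: Ew_mono_cons)

end

definition lin_form :: "('k::field \<Rightarrow> 'v::ab_group_add \<Rightarrow> 'v) \<Rightarrow> ('v \<Rightarrow> 'k) \<Rightarrow> bool" where
  "lin_form scale \<phi> \<longleftrightarrow> (\<forall>x y. \<phi> (x + y) = \<phi> x + \<phi> y) \<and> (\<forall>c x. \<phi> (scale c x) = c * \<phi> x)"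

lemma (in vector_space) lin_formD:
  assumes "lin_form scale \<phi>"
  shows "\<phi> (x + y) = \<phi> x + \<phi> y" "\<phi> (scale c x) = c * \<phi> x" "\<phi> 0 = 0"
    "\<phi> (\<Sum>i\<in>A. f i) = (\<Sum>i\<in>A. \<phi> (f i))"
proof -
  show add: "\<phi> (x + y) = \<phi> x + \<phi> y" and scale: "\<phi> (scale c x) = c * \<phi> x" for x y c
    using assms by (auto simp: lin_form_def)
  show zero: "\<phi> 0 = 0"
    using scale[of 0 0] by simp
  show "\<phi> (\<Sum>i\<in>A. f i) = (\<Sum>i\<in>A. \<phi> (f i))"
    by (induction A rule: infinite_finite_induct) (simp_all add: add zero)
qed

lemma splits_zero: "{p. fst p + snd p = (0 :: 'x \<Rightarrow>\<^sub>0 nat)} = {(0, 0)}"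
  by (auto simp: poly_mapping_eq_iff fun_eq_iff lookup_add)

lemma mps_coeff_sym_H_0: "\<eta> 0 = 1 \<Longrightarrow> mps_coeff (sym_H \<eta> k) 0 = (if k = 0 then 1 else 0)"
  by (auto simp: sym_H_def)

context two_families
begin

abbreviation "Dw \<equiv> apply_word D"
abbreviation "Uw \<equiv> apply_word U"
abbreviation "H \<equiv> (sym_H \<eta> :: nat \<Rightarrow> (nat, 'k) mps)"

lemma lin_form_U: "lin_form scale \<phi> \<Longrightarrow> lin_form scale (\<lambda>x. \<phi> (U k x))"
  by (simp add: lin_form_def U.E_add U.E_scale)

lemma lin_form_Uw: "lin_form scale \<phi> \<Longrightarrow> lin_form scale (\<lambda>x. \<phi> (Uw \<alpha> x))"
  by (simp add: lin_form_def U.Ew_add U.Ew_scale)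

lemma lin_form_Dw: "lin_form scale \<phi> \<Longrightarrow> lin_form scale (\<lambda>x. \<phi> (Dw \<alpha> x))"
  by (simp add: lin_form_def D.Ew_add D.Ew_scale)

text \<open>The right side imitates \<open>DU_rel\<close>: one summand for each power
  \<open>m\<close> absorbed by \<open>H\<close>, containing a sum of the original kind for
  \<open>k - m\<close>. This is the form in which the induction of \<open>Gser_U\<close>
  closes.\<close>

lemma sym_T_sum_H:
  fixes g :: "nat \<Rightarrow> (nat, 'k) mps"
  shows "sym_T n (\<Sum>i\<le>k. H i * g (k - i))
    = (\<Sum>m\<le>n. if m \<le> k then mps_scale (\<eta> m) (\<Sum>j\<le>k - m. H j * sym_T (n - m) (g (k - m - j))) else 0)"
proof -
  have "sym_T n (\<Sum>i\<le>k. H i * g (k - i))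
    = (\<Sum>i\<le>k. \<Sum>m\<le>n. if m \<le> i then mps_scale (\<eta> m) (H (i - m) * sym_T (n - m) (g (k - i))) else 0)"
    unfolding sym_T_sum sym_T_times
    by (intro sum.cong refl) (simp add: sym_T_sym_H \<eta>_0 mps_scale_mult_left)
  also have "\<dots> = (\<Sum>m\<le>n. \<Sum>i\<le>k. if m \<le> i then mps_scale (\<eta> m) (H (i - m) * sym_T (n - m) (g (k - i))) else 0)"
    by (rule sum.swap)
  also have "\<dots> = (\<Sum>m\<le>n. if m \<le> k then mps_scale (\<eta> m) (\<Sum>j\<le>k - m. H j * sym_T (n - m) (g (k - m - j))) else 0)"
  proof (rule sum.cong[OF refl])
    fix m
    show "(\<Sum>i\<le>k. if m \<le> i then mps_scale (\<eta> m) (H (i - m) * sym_T (n - m) (g (k - i))) else 0)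
      = (if m \<le> k then mps_scale (\<eta> m) (\<Sum>j\<le>k - m. H j * sym_T (n - m) (g (k - m - j))) else 0)"
    proof (cases "m \<le> k")
      case True
      have "(\<Sum>i\<le>k. if m \<le> i then mps_scale (\<eta> m) (H (i - m) * sym_T (n - m) (g (k - i))) else 0)
        = (\<Sum>i\<in>{m..k}. mps_scale (\<eta> m) (H (i - m) * sym_T (n - m) (g (k - i))))"
        by (rule sum.mono_neutral_cong_right) auto
      also have "\<dots> = (\<Sum>j\<le>k - m. mps_scale (\<eta> m) (H j * sym_T (n - m) (g (k - m - j))))"
        by (rule sum.reindex_bij_witness[where i = "\<lambda>j. j + m" and j = "\<lambda>i. i - m"])
          (use True in \<open>auto simp: diff_diff_add add.commute\<close>)
      finally show ?thesis
        using True by (simp add: mps.scale_sum_right)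
    qed (auto intro!: sum.neutral)
  qed
  finally show ?thesis .
qed

text \<open>Moves \<open>U k\<close> to the left through all lowering operators at once. A new first
  \<open>y\<close>-variable acts on one side by \<open>DU_rel\<close> and on the other by
  \<open>sym_T_sum_H\<close>, with the same result; \<open>k\<close> and \<open>x\<close> change on
  the way and must stay arbitrary.\<close>

lemma Gser_U:
  assumes DU_rel and \<phi>: "lin_form scale \<phi>"
  shows "D.Gser \<phi> (U k x) = (\<Sum>i\<le>k. H i * D.Gser (\<lambda>y. \<phi> (U (k - i) y)) x)"
proof (rule mps_eqI)
  fix \<beta>
  show "mps_coeff (D.Gser \<phi> (U k x)) \<beta> = mps_coeff (\<Sum>i\<le>k. H i * D.Gser (\<lambda>y. \<phi> (U (k - i) y)) x) \<beta>"
  proof (induction \<beta> arbitrary: k x rule: mono_cons_induct)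
    case zero
    have "mps_coeff (\<Sum>i\<le>k. H i * D.Gser (\<lambda>y. \<phi> (U (k - i) y)) x) 0
      = (\<Sum>i\<le>k. if i = 0 then \<phi> (U (k - i) x) else 0)"
      unfolding mps_coeff_sum
      by (rule sum.cong) (auto simp: mps_coeff_0_times mps_coeff_sym_H_0 \<eta>_0 D.Ew_0)
    then show ?case
      by (simp add: D.Ew_0)
  next
    case (cons n \<beta>)
    have "mps_coeff (D.Gser \<phi> (U k x)) (mono_cons n \<beta>)
      = (\<Sum>m\<le>n. if m \<le> k then \<eta> m * mps_coeff (D.Gser \<phi> (U (k - m) (D (n - m) x))) \<beta> else 0)"
    proof -
      have D: "D n (U k x) = (\<Sum>m\<le>n. if m \<le> k then scale (\<eta> m) (U (k - m) (D (n - m) x)) else 0)"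
        using assms(1) by (simp add: DU_rel_def)
      note lin = D.lin_formD[OF lin_form_Dw[OF \<phi>, of \<beta>]]
      show ?thesis
        unfolding D.mps_coeff_Gser D.Ew_mono_cons D lin(4)
        by (rule sum.cong) (auto simp: lin)
    qed
    also have "\<dots> = (\<Sum>m\<le>n. if m \<le> k then \<eta> m * mps_coeff (\<Sum>j\<le>k - m. H j * D.Gser (\<lambda>y. \<phi> (U (k - m - j) y)) (D (n - m) x)) \<beta> else 0)"
      unfolding cons.IH ..
    also have "\<dots> = mps_coeff (sym_T n (\<Sum>i\<le>k. H i * D.Gser (\<lambda>y. \<phi> (U (k - i) y)) x)) \<beta>"
      unfolding sym_T_sum_H[of n "\<lambda>i. D.Gser (\<lambda>y. \<phi> (U i y)) x"] D.sym_T_Gser mps_coeff_sum[of _ "{..n}"]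
      by (rule sum.cong) auto
    finally show ?case
      by simp
  qed
qed

text \<open>\<open>Gser_U\<close> is repeated for each \<open>x\<close>-variable. The first half of
  a split of \<open>\<alpha>\<close> records the powers absorbed by the kernel, the second half the
  raising operators that pass through.\<close>

lemma Gser_Uw:
  assumes DU_rel and \<phi>: "lin_form scale \<phi>"
  shows "D.Gser \<phi> (Uw \<alpha> x)
    = (\<Sum>p\<in>{p. fst p + snd p = \<alpha>}. H_word \<eta> (fst p) * D.Gser (\<lambda>y. \<phi> (Uw (snd p) y)) x)"
proof (induction \<alpha> arbitrary: x rule: mono_cons_induct)
  case zero
  show ?case
    by (simp add: splits_zero H_word_0 U.Ew_0)
next
  case (cons k \<alpha>)
  have "D.Gser \<phi> (Uw (mono_cons k \<alpha>) x)
    = (\<Sum>p\<in>{p. fst p + snd p = \<alpha>}. \<Sum>i\<le>k. H_word \<eta> (fst p) * (H i * D.Gser (\<lambda>y. \<phi> (Uw (snd p) (U (k - i) y))) x))"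
    unfolding U.Ew_mono_cons cons.IH Gser_U[OF assms(1) lin_form_Uw[OF \<phi>]] sum_distrib_left ..
  also have "\<dots> = (\<Sum>i\<le>k. \<Sum>p\<in>{p. fst p + snd p = \<alpha>}. H_word \<eta> (mono_cons i (fst p)) * D.Gser (\<lambda>y. \<phi> (Uw (mono_cons (k - i) (snd p)) y)) x)"
    by (subst sum.swap) (simp add: H_word_mono_cons \<eta>_0 U.Ew_mono_cons mult_ac)
  also have "\<dots> = (\<Sum>p\<in>{p. fst p + snd p = mono_cons k \<alpha>}. H_word \<eta> (fst p) * D.Gser (\<lambda>y. \<phi> (Uw (snd p) y)) x)"
    by (rule sum_splits_mono_cons[symmetric, where g = "\<lambda>u w. H_word \<eta> u * D.Gser (\<lambda>y. \<phi> (Uw w y)) x"])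
  finally show ?case .
qed

text \<open>The coefficient of the pure power \<open>y_1^k\<close> involves one lowering operator
  only, so it recovers the relation between \<open>D k\<close> and \<open>U l\<close>.\<close>

lemma DU_from_Gser_U:
  assumes \<phi>: "lin_form scale \<phi>"
    and eq: "D.Gser \<phi> (U l x) = (\<Sum>i\<le>l. H i * D.Gser (\<lambda>y. \<phi> (U (l - i) y)) x)"
  shows "\<phi> (D k (U l x)) = \<phi> (\<Sum>n\<le>k. if n \<le> l then scale (\<eta> n) (U (l - n) (D (k - n) x)) else 0)"
proof -
  note lin = D.lin_formD[OF \<phi>]
  have "\<phi> (D k (U l x)) = mps_coeff (sym_T k (D.Gser \<phi> (U l x))) 0"
    by (simp only: D.sym_T_Gser D.mps_coeff_Gser D.Ew_0)
  also have "\<dots> = (\<Sum>m\<le>k. if m \<le> l then \<eta> m * mps_coeff (\<Sum>j\<le>l - m. H j * D.Gser (\<lambda>y. \<phi> (U (l - m - j) y)) (D (k - m) x)) 0 else 0)"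
    unfolding eq sym_T_sum_H[of k "\<lambda>i. D.Gser (\<lambda>y. \<phi> (U i y)) x"] D.sym_T_Gser mps_coeff_sum[of _ "{..k}"]
    by (rule sum.cong) auto
  also have "\<dots> = (\<Sum>m\<le>k. if m \<le> l then \<eta> m * \<phi> (U (l - m) (D (k - m) x)) else 0)"
  proof (rule sum.cong[OF refl])
    fix m
    have "mps_coeff (\<Sum>j\<le>l - m. H j * D.Gser (\<lambda>y. \<phi> (U (l - m - j) y)) (D (k - m) x)) 0
      = (\<Sum>j\<le>l - m. if j = 0 then \<phi> (U (l - m - j) (D (k - m) x)) else 0)"
      unfolding mps_coeff_sum
      by (rule sum.cong) (auto simp: mps_coeff_0_times mps_coeff_sym_H_0 \<eta>_0 D.Ew_0)
    then show "(if m \<le> l then \<eta> m * mps_coeff (\<Sum>j\<le>l - m. H j * D.Gser (\<lambda>y. \<phi> (U (l - m - j) y)) (D (k - m) x)) 0 else 0)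
      = (if m \<le> l then \<eta> m * \<phi> (U (l - m) (D (k - m) x)) else 0)"
      by simp
  qed
  also have "\<dots> = \<phi> (\<Sum>n\<le>k. if n \<le> l then scale (\<eta> n) (U (l - n) (D (k - n) x)) else 0)"
    unfolding lin(4) by (rule sum.cong) (auto simp: lin)
  finally show ?thesis .
qed

end

section \<open>The graded setting\<close>

locale graded_operators =
  fixes scale :: "'k::field_char_0 \<Rightarrow> 'v::ab_group_add \<Rightarrow> 'v"
    and V :: "int \<Rightarrow> 'v set"
    and deg :: "'s \<Rightarrow> int"
    and v :: "'s \<Rightarrow> 'v"
    and ip :: "'v \<Rightarrow> 'v \<Rightarrow> 'k"
    and m :: int
    and B :: "int \<Rightarrow> 'v \<Rightarrow> 'v"
    and b :: 's
    and a :: "int \<Rightarrow> 'k"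
  assumes graded: "graded_vector_space scale V"
    and basis: "homogeneous_basis scale V deg v"
    and form: "orthonormal_form scale v ip"
    and m_nonzero: "m \<noteq> 0"
    and B_graded: "\<And>k. k \<noteq> 0 \<Longrightarrow> graded_operator scale V (- m * k) (B k)"
    and B_commute: "\<And>k l. (k > 0 \<and> l > 0) \<or> (k < 0 \<and> l < 0) \<Longrightarrow> B k \<circ> B l = B l \<circ> B k"
    and B_vacuum: "\<And>k. k > 0 \<Longrightarrow> B k (v b) = 0"
    and a_sym: "\<And>k. k \<noteq> 0 \<Longrightarrow> a k = a (- k)"
    and G_inj: "inj (\<lambda>s. G_skew scale ip v B s b)"
    and G_independent: "\<not> mps.dependent (range (\<lambda>s. G_skew scale ip v B s b))"
begin

sublocale vector_space scale
  using graded by (simp add: graded_vector_space_def)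

lemma B_linear:
  assumes "k \<noteq> 0"
  shows "B k (x + y) = B k x + B k y" "B k (scale c x) = scale c (B k x)"
  using B_graded[OF assms] by (auto simp: graded_operator_def Vector_Spaces.linear_iff)

lemma B_commute': "(k > 0 \<and> l > 0) \<or> (k < 0 \<and> l < 0) \<Longrightarrow> B k (B l x) = B l (B k x)"
  using B_commute[of k l] by (simp add: fun_eq_iff)

sublocale two_families scale "\<lambda>i. B (int i)" "\<lambda>i. B (- int i)" "\<lambda>i. a (int i)" "h_angle a"
proof unfold_locales
  fix i j :: nat and x y c
  assume i: "1 \<le> i"
  show "B (int i) (x + y) = B (int i) x + B (int i) y" "B (int i) (scale c x) = scale c (B (int i) x)"
    "B (- int i) (x + y) = B (- int i) x + B (- int i) y" "B (- int i) (scale c x) = scale c (B (- int i) x)"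
    using i by (auto intro!: B_linear)
  assume "1 \<le> j"
  with i show "B (int i) (B (int j) x) = B (int j) (B (int i) x)"
    "B (- int i) (B (- int j) x) = B (- int j) (B (- int i) x)"
    by (auto intro!: B_commute')
qed (simp_all add: h_angle_0 h_angle_newton)

text \<open>Operators with indices of equal sign commute by hypothesis. The case
  \<open>k < 0 < l\<close> reduces to the opposite one by antisymmetry of the commutator and
  \<open>a (- l) = a l\<close>.\<close>

lemma heisenberg_action_iff: "heisenberg_action scale a B \<longleftrightarrow> heisenberg_rel"
proof
  assume H: "heisenberg_action scale a B"
  show heisenberg_rel
    unfolding heisenberg_rel_def
  proof (intro allI impI)
    fix j l :: nat and x assume "1 \<le> j" "1 \<le> l"
    then show "B (int j) (B (- int l) x) - B (- int l) (B (int j) x)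
      = scale (if j = l then of_nat j * a (int j) else 0) x"
      using H unfolding heisenberg_action_def by (auto simp: of_int_of_nat_eq)
  qed
next
  assume rel: heisenberg_rel
  have mixed: "B (int j) (B (- int l) x) - B (- int l) (B (int j) x)
      = scale (if j = l then of_nat j * a (int j) else 0) x" if "1 \<le> j" "1 \<le> l" for j l x
    using rel that by (simp add: heisenberg_rel_def)
  show "heisenberg_action scale a B"
    unfolding heisenberg_action_def
  proof (intro allI impI)
    fix k l :: int and x assume kl: "k \<noteq> 0" "l \<noteq> 0"
    consider "(k > 0 \<and> l > 0) \<or> (k < 0 \<and> l < 0)" | "k > 0" "l < 0" | "k < 0" "l > 0"
      using kl by linarith
    then show "B k (B l x) - B l (B k x) = scale (if k = - l then of_int k * a k else 0) x"
    proof cases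
      case 1
      then show ?thesis
        using B_commute'[of k l x] by auto
    next
      case 2
      then have "int (nat k) = k" "int (nat (- l)) = - l" "nat k = nat (- l) \<longleftrightarrow> k = - l"
        "1 \<le> nat k" "1 \<le> nat (- l)" "of_nat (nat k) = (of_int k :: 'k)"
        by (auto simp: of_nat_nat)
      then show ?thesis
        using mixed[of "nat k" "nat (- l)" x] by simp
    next
      case 3
      then have nat: "int (nat l) = l" "int (nat (- k)) = - k" "nat l = nat (- k) \<longleftrightarrow> k = - l"
        "1 \<le> nat l" "1 \<le> nat (- k)" "of_nat (nat l) = (of_int l :: 'k)"
        by (auto simp: of_nat_nat)
      then have eq: "B l (B k x) - B k (B l x) = scale (if k = - l then of_int l * a l else 0) x"
        using mixed[of "nat l" "nat (- k)" x] by simp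
      have "B k (B l x) - B l (B k x) = - (B l (B k x) - B k (B l x))"
        by simp
      also have "\<dots> = scale (if k = - l then of_int k * a k else 0) x"
      proof (cases "k = - l")
        case True
        moreover have "a (- l) = a l"
          using a_sym[of l] kl by simp
        ultimately show ?thesis
          unfolding eq by simp
      next
        case False
        then show ?thesis
          unfolding eq by simp
      qed
      finally show ?thesis .
    qed
  qed
qed

section \<open>Orthonormal expansions and the grading\<close>

lemma ip_linear:
  "ip (x + y) z = ip x z + ip y z" "ip (scale c x) z = c * ip x z"
  using form by (auto simp: orthonormal_form_def Vector_Spaces.linear_iff)

lemma lin_form_ip: "lin_form scale (\<lambda>x. ip x z)"
  by (simp add: lin_form_def ip_linear)

lemma ip_basis: "ip (v s) (v t) = (if s = t then 1 else 0)"
  using form by (simp add: orthonormal_form_def)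

lemma finite_expansion:
  "finite {s. ip x (v s) \<noteq> 0}" "x = (\<Sum>s | ip x (v s) \<noteq> 0. scale (ip x (v s)) (v s))"
proof -
  have "x \<in> span (range v)"
    using basis by (simp add: homogeneous_basis_def)
  then have "\<exists>A c. finite A \<and> x = (\<Sum>s\<in>A. scale (c s) (v s))"
  proof (induction rule: span_induct_alt)
    case base
    show ?case
      by (intro exI[of _ "{}"]) simp
  next
    case (step d y z)
    then obtain A c t where A: "finite A" "z = (\<Sum>s\<in>A. scale (c s) (v s))" "y = v t"
      by auto
    let ?c = "\<lambda>s. (if s = t then d else 0) + (if s \<in> A then c s else 0)"
    have "(\<Sum>s\<in>insert t A. scale (?c s) (v s))
      = (\<Sum>s\<in>insert t A. if s = t then scale d (v s) else 0)
        + (\<Sum>s\<in>insert t A. if s \<in> A then scale (c s) (v s) else 0)"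
      unfolding sum.distrib[symmetric] by (rule sum.cong) (auto simp: scale_left_distrib)
    also have "(\<Sum>s\<in>insert t A. if s = t then scale d (v s) else 0) = scale d y"
      using A by simp
    also have "(\<Sum>s\<in>insert t A. if s \<in> A then scale (c s) (v s) else 0) = z"
      unfolding A(2) using A(1) by (intro sum.mono_neutral_cong_right) auto
    finally show ?case
      using A(1) by (intro exI[of _ "insert t A"] exI[of _ ?c]) simp
  qed
  then obtain A c where A: "finite A" and x: "x = (\<Sum>s\<in>A. scale (c s) (v s))"
    by blast
  have ip: "ip x (v s) = (if s \<in> A then c s else 0)" for s
    unfolding x using A by (simp add: lin_formD(4)[OF lin_form_ip] ip_linear ip_basis
        if_distrib[of "(*) _"] sum.delta cong: if_cong)
  then have sub: "{s. ip x (v s) \<noteq> 0} \<subseteq> A"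
    by auto
  with A show "finite {s. ip x (v s) \<noteq> 0}"
    by (rule rev_finite_subset)
  have "(\<Sum>s\<in>A. scale (c s) (v s)) = (\<Sum>s | ip x (v s) \<noteq> 0. scale (ip x (v s)) (v s))"
    using A by (intro sum.mono_neutral_cong_right) (auto simp: ip)
  then show "x = (\<Sum>s | ip x (v s) \<noteq> 0. scale (ip x (v s)) (v s))"
    using x by simp
qed

lemma ip_separates:
  assumes "\<And>s. ip x (v s) = ip y (v s)"
  shows "x = y"
  by (subst (1 2) finite_expansion(2)) (simp only: assms)

text \<open>Inserts the identity \<open>\<Sum>_s v_s \<langle>_, v_s\<rangle>\<close>; this
  collapses the sums over \<open>S\<close> in all the identities to be compared.\<close>

lemma lin_form_expansion:
  assumes "lin_form scale \<phi>"
  shows "Sum_any (\<lambda>s. ip x (v s) * \<phi> (v s)) = \<phi> x"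
proof -
  have "Sum_any (\<lambda>s. ip x (v s) * \<phi> (v s)) = (\<Sum>s | ip x (v s) \<noteq> 0. ip x (v s) * \<phi> (v s))"
    by (rule Sum_any.expand_superset) (auto simp: finite_expansion(1))
  also have "\<dots> = \<phi> (\<Sum>s | ip x (v s) \<noteq> 0. scale (ip x (v s)) (v s))"
    by (simp add: lin_formD[OF assms])
  also have "\<dots> = \<phi> x"
    by (simp only: finite_expansion(2)[symmetric])
  finally show ?thesis .
qed

lemma subspace_V: "subspace (V n)"
  using graded by (simp add: graded_vector_space_def)

lemma v_in_V: "v s \<in> V (deg s)"
  using basis by (simp add: homogeneous_basis_def)

text \<open>Both the homogeneous parts of the basis expansion of \<open>x\<close> and \<open>x\<close> alone are decompositions
  of \<open>x\<close> into homogeneous components.\<close>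

lemma ip_homogeneous:
  assumes x: "x \<in> V n" and "ip x (v s) \<noteq> 0"
  shows "deg s = n"
proof (rule ccontr)
  assume ne: "deg s \<noteq> n"
  let ?A = "{s. ip x (v s) \<noteq> 0}"
  define c where "c d = (\<Sum>t\<in>{t \<in> ?A. deg t = d}. scale (ip x (v t)) (v t))" for d
  define c' where "c' d = (if d = n then x else 0)" for d
  have c: "(\<forall>d. c d \<in> V d) \<and> finite {d. c d \<noteq> 0} \<and> x = (\<Sum>d | c d \<noteq> 0. c d)"
  proof (intro conjI allI)
    fix d show "c d \<in> V d"
      unfolding c_def by (intro subspace_sum[OF subspace_V] subspace_scale[OF subspace_V]) (use v_in_V in auto)
  next
    have sub: "{d. c d \<noteq> 0} \<subseteq> deg ` ?A"
    proof
      fix d assume "d \<in> {d. c d \<noteq> 0}"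
      then have "{t \<in> ?A. deg t = d} \<noteq> {}"
        unfolding c_def mem_Collect_eq by (rule contrapos_nn) (simp only: sum.empty)
      then show "d \<in> deg ` ?A"
        by auto
    qed
    then show "finite {d. c d \<noteq> 0}"
      by (rule finite_subset) (simp add: finite_expansion(1))
    have "x = (\<Sum>t\<in>?A. scale (ip x (v t)) (v t))"
      by (rule finite_expansion(2))
    also have "\<dots> = (\<Sum>d\<in>deg ` ?A. c d)"
      unfolding c_def by (rule sum.image_gen[OF finite_expansion(1)])
    also have "\<dots> = (\<Sum>d | c d \<noteq> 0. c d)"
      using sub by (intro sum.mono_neutral_right) (auto simp: finite_expansion(1))
    finally show "x = (\<Sum>d | c d \<noteq> 0. c d)" .
  qed
  have c': "(\<forall>d. c' d \<in> V d) \<and> finite {d. c' d \<noteq> 0} \<and> x = (\<Sum>d | c' d \<noteq> 0. c' d)"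
  proof (intro conjI allI)
    show "c' d \<in> V d" for d
      using x subspace_0[OF subspace_V] by (simp add: c'_def)
    have sub: "{d. c' d \<noteq> 0} \<subseteq> {n}"
      by (auto simp: c'_def)
    then show "finite {d. c' d \<noteq> 0}"
      by (rule finite_subset) simp
    have "(\<Sum>d | c' d \<noteq> 0. c' d) = (\<Sum>d\<in>{n}. c' d)"
      using sub by (intro sum.mono_neutral_left) auto
    then show "x = (\<Sum>d | c' d \<noteq> 0. c' d)"
      by (simp add: c'_def)
  qed
  have unique: "p = q" if "\<exists>!c. P c" "P p" "P q" for P and p q :: "int \<Rightarrow> 'v"
    using that by blast
  have ex1: "\<exists>!c. (\<forall>d. c d \<in> V d) \<and> finite {d. c d \<noteq> 0} \<and> x = (\<Sum>d | c d \<noteq> 0. c d)"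
    using graded by (simp add: graded_vector_space_def)
  have "c = c'"
    by (rule unique[OF ex1 c c'])
  then have zero: "c (deg s) = 0"
    using ne by (simp add: c'_def)
  have "ip (c (deg s)) (v s) = (\<Sum>t\<in>{t \<in> ?A. deg t = deg s}. if t = s then ip x (v s) else 0)"
    unfolding c_def lin_formD(4)[OF lin_form_ip]
    by (rule sum.cong) (auto simp: ip_linear ip_basis)
  also have "\<dots> = ip x (v s)"
    using assms(2) by (subst sum.delta) (auto simp: finite_expansion(1))
  finally show False
    using zero assms(2) lin_formD(3)[OF lin_form_ip] by simp
qed

lemma B_V: "k \<noteq> 0 \<Longrightarrow> x \<in> V n \<Longrightarrow> B k x \<in> V (n - m * k)"
  using B_graded[of k] by (auto simp: graded_operator_def)

lemma D_V: "x \<in> V n \<Longrightarrow> D k x \<in> V (n - m * int k)"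
proof (induction k rule: less_induct)
  case (less k)
  show ?case
  proof (cases "k = 0")
    case False
    have "B (int i) (D (k - i) x) \<in> V (n - m * int k)" if i: "i \<in> {1..k}" for i
    proof -
      have "D (k - i) x \<in> V (n - m * int (k - i))"
        using i by (intro less.IH less.prems) auto
      then have "B (int i) (D (k - i) x) \<in> V (n - m * int (k - i) - m * int i)"
        using i by (intro B_V) auto
      moreover have "n - m * int (k - i) - m * int i = n - m * int k"
        using i by (simp add: of_nat_diff algebra_simps)
      ultimately show ?thesis
        by simp
    qed
    then have "scale (of_nat k) (D k x) \<in> V (n - m * int k)"
      unfolding D.E_newton by (intro subspace_sum[OF subspace_V])
    then have "scale (inverse (of_nat k)) (scale (of_nat k) (D k x)) \<in> V (n - m * int k)"
      by (rule subspace_scale[OF subspace_V])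
    then show ?thesis
      using False by simp
  qed (use less.prems in \<open>simp add: D.E_0\<close>)
qed

lemma U_V: "x \<in> V n \<Longrightarrow> U k x \<in> V (n + m * int k)"
proof (induction k rule: less_induct)
  case (less k)
  show ?case
  proof (cases "k = 0")
    case False
    have "B (- int i) (U (k - i) x) \<in> V (n + m * int k)" if i: "i \<in> {1..k}" for i
    proof -
      have "U (k - i) x \<in> V (n + m * int (k - i))"
        using i by (intro less.IH less.prems) auto
      then have "B (- int i) (U (k - i) x) \<in> V (n + m * int (k - i) - m * (- int i))"
        using i by (intro B_V) auto
      moreover have "n + m * int (k - i) - m * (- int i) = n + m * int k"
        using i by (simp add: of_nat_diff algebra_simps)
      ultimately show ?thesis
        by (simp only:)
    qed
    then have "scale (of_nat k) (U k x) \<in> V (n + m * int k)"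
      unfolding U.E_newton by (intro subspace_sum[OF subspace_V])
    then have "scale (inverse (of_nat k)) (scale (of_nat k) (U k x)) \<in> V (n + m * int k)"
      by (rule subspace_scale[OF subspace_V])
    then show ?thesis
      using False by simp
  qed (use less.prems in \<open>simp add: U.E_0\<close>)
qed

lemma Dw_V: "x \<in> V n \<Longrightarrow> Dw \<alpha> x \<in> V (n - m * int (mdeg \<alpha>))"
proof (induction \<alpha> arbitrary: x n rule: mono_cons_induct)
  case (cons k \<alpha>)
  have "Dw \<alpha> (D k x) \<in> V (n - m * int k - m * int (mdeg \<alpha>))"
    by (intro cons.IH D_V cons.prems)
  then show ?case
    by (simp add: D.Ew_mono_cons mdeg_mono_cons algebra_simps)
qed (simp add: D.Ew_0)

lemma Uw_V: "x \<in> V n \<Longrightarrow> Uw \<alpha> x \<in> V (n + m * int (mdeg \<alpha>))"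
proof (induction \<alpha> arbitrary: x n rule: mono_cons_induct)
  case (cons k \<alpha>)
  have "Uw \<alpha> (U k x) \<in> V (n + m * int k + m * int (mdeg \<alpha>))"
    by (intro cons.IH U_V cons.prems)
  then show ?case
    by (simp add: U.Ew_mono_cons mdeg_mono_cons algebra_simps)
qed (simp add: U.Ew_0)

section \<open>The map from vectors to symmetric functions\<close>

abbreviation form_b :: "'v \<Rightarrow> 'k" where
  "form_b \<equiv> \<lambda>x. ip x (v b)"

abbreviation G_b :: "'v \<Rightarrow> (nat, 'k) mps" where
  "G_b \<equiv> D.Gser form_b"

lemma G_skew_eq: "G_skew scale ip v B s t = D.Gser (\<lambda>x. ip x (v t)) (v s)"
  by (simp add: G_skew_def D.Gser_def D_op_eq)

lemma F_skew_coeff: "mps_coeff (F_skew scale ip v B s t) \<alpha> = ip (Uw \<alpha> (v t)) (v s)"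
  by (simp add: F_skew_def U_op_eq)

lemma G_b_degree:
  assumes "ip (Dw \<beta> (v s)) (v b) \<noteq> 0"
  shows "deg s - m * int (mdeg \<beta>) = deg b"
  using ip_homogeneous[OF Dw_V[OF v_in_V] assms] by simp

text \<open>The grading allows only monomials with \<open>m * mdeg \<beta> = deg s - deg b\<close>,
  which bounds the degree since \<open>m \<noteq> 0\<close>.\<close>

lemma G_b_in_Sym: "G_b (v s) \<in> Sym"
proof -
  have "mdeg \<beta> \<le> nat \<bar>deg s - deg b\<bar>" if "mps_coeff (G_b (v s)) \<beta> \<noteq> 0" for \<beta>
  proof -
    have "m * int (mdeg \<beta>) = deg s - deg b"
      using G_b_degree[of \<beta> s] that by simp
    then have "\<bar>deg s - deg b\<bar> = \<bar>m\<bar> * int (mdeg \<beta>)"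
      by (metis abs_mult abs_of_nat)
    moreover have "1 * int (mdeg \<beta>) \<le> \<bar>m\<bar> * int (mdeg \<beta>)"
      using m_nonzero by (intro mult_right_mono) auto
    ultimately show ?thesis
      by linarith
  qed
  moreover have "mps_coeff (G_b (v s)) (Poly_Mapping.map_key \<pi> \<beta>) = mps_coeff (G_b (v s)) \<beta>"
    if "bij \<pi>" for \<pi> \<beta>
    using D.Ew_vals[OF vals_map_key[OF that, of \<beta>]] by simp
  ultimately show ?thesis
    by (rule SymI)
qed

lemma Gser_sum:
  assumes "lin_form scale \<phi>"
  shows "D.Gser \<phi> (\<Sum>i\<in>A. scale (c i) (f i)) = (\<Sum>i\<in>A. mps_scale (c i) (D.Gser \<phi> (f i)))"
  by (rule mps_eqI) (simp add: lin_formD[OF lin_form_Dw[OF assms]])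

lemma G_b_eq_0:
  assumes "G_b x = 0"
  shows "x = 0"
proof -
  let ?G = "\<lambda>s. G_b (v s)"
  let ?A = "{s. ip x (v s) \<noteq> 0}"
  have inj: "inj ?G" and indep: "\<not> mps.dependent (range ?G)"
    using G_inj G_independent by (simp_all add: G_skew_eq)
  have "(\<Sum>s\<in>?A. mps_scale (ip x (v s)) (?G s)) = G_b (\<Sum>s\<in>?A. scale (ip x (v s)) (v s))"
    by (rule Gser_sum[OF lin_form_ip, symmetric])
  also have "\<dots> = 0"
    by (simp only: finite_expansion(2)[symmetric] assms)
  finally have sum: "(\<Sum>s\<in>?A. mps_scale (ip x (v s)) (?G s)) = 0" .
  have "ip x (v s) = 0" for s
  proof (rule ccontr)
    assume s: "ip x (v s) \<noteq> 0"
    \<comment> \<open>Independence speaks of a set of series, so the coefficients are carried over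
      along the inverse of the injective indexing.\<close>
    have "(\<Sum>g\<in>?G ` ?A. mps_scale (ip x (v (inv ?G g))) g) = 0"
      using sum by (subst sum.reindex) (auto intro: inj_on_subset[OF inj] simp: inv_f_f[OF inj])
    then have "ip x (v (inv ?G (?G s))) = 0"
      by (rule mps.independentD[OF indep, rotated 2]) (use s in \<open>auto simp: finite_expansion(1)\<close>)
    with s show False
      by (simp add: inv_f_f[OF inj])
  qed
  then show ?thesis
    using ip_separates[of x 0] lin_formD(3)[OF lin_form_ip] by simp
qed

text \<open>By linear independence no \<open>G'\<^sub>s\<close> vanishes, so no \<open>v\<^sub>s\<close> lies below the vacuum \<open>v\<^sub>b\<close>.\<close>

lemma form_b_U:
  assumes "j \<ge> 1"
  shows "ip (U j x) (v b) = 0"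
proof -
  have basis: "ip (U j (v s)) (v b) = 0" for s
  proof (rule ccontr)
    assume "ip (U j (v s)) (v b) \<noteq> 0"
    then have up: "deg b = deg s + m * int j"
      by (rule ip_homogeneous[OF U_V[OF v_in_V]])
    have "v s \<noteq> 0"
      using ip_basis[of s s] lin_formD(3)[OF lin_form_ip, of "v s"] by auto
    then have "G_b (v s) \<noteq> 0"
      using G_b_eq_0 by blast
    then obtain \<beta> where "ip (Dw \<beta> (v s)) (v b) \<noteq> 0"
      using mps_eqI[of "G_b (v s)" 0] by auto
    then have "deg s - m * int (mdeg \<beta>) = deg b"
      by (rule G_b_degree)
    \<comment> \<open>\<open>U j\<close> and a word of lowering operators shift degrees in opposite
      directions, so both can lead from \<open>v s\<close> to the degree of \<open>v b\<close> only
      if the total shift is 0.\<close>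
    with up have "m * (int j + int (mdeg \<beta>)) = 0"
      by (simp add: algebra_simps)
    with m_nonzero assms show False
      by simp
  qed
  show ?thesis
    using lin_form_expansion[OF lin_form_U[OF lin_form_ip], of x j "v b"] by (simp add: basis)
qed

lemma Gser_expansion:
  assumes "lin_form scale \<phi>"
  shows "mps_sum (\<lambda>t. mps_scale (ip x (v t)) (D.Gser \<phi> (v t))) = D.Gser \<phi> x"
  by (rule mps_eqI) (simp add: mps_coeff_mps_sum lin_form_expansion[OF lin_form_Dw[OF assms]])

text \<open>In \<open>Gser_U\<close> the summands with \<open>i < k\<close> pair a vector in the
  image of some \<open>U j\<close>, \<open>j \<ge> 1\<close>, with \<open>v b\<close> and vanish by
  \<open>form_b_U\<close>.\<close>

lemma h_bracket_G_b:
  assumes DU_rel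
  shows "h_bracket a k * G_b x = G_b (U k x)"
proof -
  have zero: "D.Gser (\<lambda>y. ip (U j y) (v b)) x = 0" if "j \<ge> 1" for j
    by (rule mps_eqI) (simp add: form_b_U[OF that])
  have "G_b (U k x) = (\<Sum>i\<le>k. sym_H (h_angle a) i * D.Gser (\<lambda>y. ip (U (k - i) y) (v b)) x)"
    by (rule Gser_U[OF assms lin_form_ip])
  also have "\<dots> = (\<Sum>i\<le>k. if i = k then sym_H (h_angle a) k * G_b x else 0)"
    by (rule sum.cong) (auto simp: zero U.E_0)
  finally show ?thesis
    by (simp add: h_bracket_eq)
qed

lemma sym_h_perp_G_b: "sym_h_perp k (G_b (v s)) = G_b (D k (v s))"
  by (simp add: sym_h_perp_eq[OF G_b_in_Sym] D.sym_T_Gser)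

lemma DU_relI:
  assumes "\<And>k l t. D k (U l (v t)) = (\<Sum>n\<le>k. if n \<le> l then scale (h_angle a n) (U (l - n) (D (k - n) (v t))) else 0)"
  shows DU_rel
proof -
  have "D k (U l x) = (\<Sum>n\<le>k. if n \<le> l then scale (h_angle a n) (U (l - n) (D (k - n) x)) else 0)" for k l x
  proof (rule ip_separates)
    fix s
    let ?R = "\<lambda>x. \<Sum>n\<le>k. if n \<le> l then scale (h_angle a n) (U (l - n) (D (k - n) x)) else 0"
    have add: "?R (x + y) = ?R x + ?R y" for x y
      unfolding sum.distrib[symmetric]
      by (rule sum.cong) (auto simp: D.E_add U.E_add scale_right_distrib)
    have scale: "?R (scale c x) = scale c (?R x)" for c x
      unfolding scale_sum_right
      by (rule sum.cong) (auto simp: D.E_scale U.E_scale scale_left_commute)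
    have "lin_form scale (\<lambda>x. ip (?R x) (v s))"
      unfolding lin_form_def by (simp only: add scale ip_linear simp_thms)
    then have R: "Sum_any (\<lambda>t. ip x (v t) * ip (?R (v t)) (v s)) = ip (?R x) (v s)"
      by (rule lin_form_expansion)
    have "lin_form scale (\<lambda>x. ip (D k (U l x)) (v s))"
      by (simp add: lin_form_def U.E_add D.E_add U.E_scale D.E_scale ip_linear)
    then have L: "Sum_any (\<lambda>t. ip x (v t) * ip (D k (U l (v t))) (v s)) = ip (D k (U l x)) (v s)"
      by (rule lin_form_expansion)
    show "ip (D k (U l x)) (v s) = ip (?R x) (v s)"
      unfolding L[symmetric] R[symmetric] by (simp only: assms)
  qed
  then show ?thesis
    by (simp add: DU_rel_def)
qed

text \<open>Evaluate \<open>sym_T k\<close> on \<open>H l * G_b (v t)\<close> twice: as the image of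
  \<open>D k (U l (v t))\<close>, and by the product rule with \<open>sym_T_sym_H\<close>.
  Injectivity of \<open>G_b\<close> brings the equality back to vectors.\<close>

lemma DU_if_h_bracket:
  assumes "\<And>k s. k \<ge> 1 \<Longrightarrow> h_bracket a k * G_b (v s) = G_b (U k (v s))"
  shows DU_rel
proof (rule DU_relI)
  fix k l t
  have HG: "H k * G_b x = G_b (U k x)" for k x
  proof (cases "k = 0")
    case True
    then show ?thesis
      by (simp add: sym_H_0 h_angle_0 U.E_0)
  next
    case False
    let ?A = "{s. ip x (v s) \<noteq> 0}"
    have "H k * G_b (\<Sum>s\<in>?A. scale (ip x (v s)) (v s)) = (\<Sum>s\<in>?A. mps_scale (ip x (v s)) (G_b (U k (v s))))"
      using False assms[of k] unfolding Gser_sum[OF lin_form_ip] sum_distrib_left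
      by (simp add: mps_scale_mult_right h_bracket_eq)
    also have "\<dots> = G_b (U k (\<Sum>s\<in>?A. scale (ip x (v s)) (v s)))"
      by (simp add: Gser_sum[OF lin_form_ip] U.E_sum U.E_scale)
    finally show ?thesis
      by (simp only: finite_expansion(2)[symmetric])
  qed
  let ?x = "v t"
  let ?R = "\<Sum>n\<le>k. if n \<le> l then scale (h_angle a n) (U (l - n) (D (k - n) ?x)) else 0"
  have "G_b (D k (U l ?x)) = sym_T k (H l * G_b ?x)"
    by (simp only: HG D.sym_T_Gser)
  also have "\<dots> = (\<Sum>n\<le>k. if n \<le> l then mps_scale (h_angle a n) (G_b (U (l - n) (D (k - n) ?x))) else 0)"
    unfolding sym_T_times
    by (rule sum.cong) (auto simp: sym_T_sym_H h_angle_0 mps_scale_mult_left D.sym_T_Gser HG)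
  also have "\<dots> = (\<Sum>n\<le>k. mps_scale (if n \<le> l then h_angle a n else 0) (G_b (U (l - n) (D (k - n) ?x))))"
    by (rule sum.cong) auto
  also have "\<dots> = G_b (\<Sum>n\<le>k. scale (if n \<le> l then h_angle a n else 0) (U (l - n) (D (k - n) ?x)))"
    by (rule Gser_sum[OF lin_form_ip, symmetric])
  also have "(\<Sum>n\<le>k. scale (if n \<le> l then h_angle a n else 0) (U (l - n) (D (k - n) ?x))) = ?R"
    by (rule sum.cong) auto
  finally have eq: "G_b (D k (U l ?x)) = G_b ?R" .
  have "G_b (D k (U l ?x) - ?R) = 0"
  proof (rule mps_eqI)
    fix \<beta>
    have add: "form_b (Dw \<beta> (x + y)) = form_b (Dw \<beta> x) + form_b (Dw \<beta> y)" for x y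
      by (rule lin_formD(1)[OF lin_form_Dw[OF lin_form_ip]])
    have "form_b (Dw \<beta> (D k (U l ?x))) = form_b (Dw \<beta> ?R)"
      using arg_cong[OF eq, of "\<lambda>f. mps_coeff f \<beta>"] by simp
    then show "mps_coeff (G_b (D k (U l ?x) - ?R)) \<beta> = mps_coeff 0 \<beta>"
      using add[of "D k (U l ?x) - ?R" ?R] by simp
  qed
  then show "D k (U l ?x) = ?R"
    using G_b_eq_0 by fastforce
qed

section \<open>Skew Cauchy identities as identities of matrix coefficients\<close>

text \<open>Summing over \<open>s\<close> inserts the identity between two words; here the raising
  word acts first.\<close>

lemma slice_left:
  "mps_slice \<alpha> (mps_sum (\<lambda>s. in_X (F_skew scale ip v B s t) * in_Y (G_skew scale ip v B s r)))
    = D.Gser (\<lambda>x. ip x (v r)) (Uw \<alpha> (v t))"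
  by (simp only: mps_slice_mps_sum mps_slice_in_X_in_Y F_skew_coeff G_skew_eq Gser_expansion[OF lin_form_ip])

text \<open>The opposite order: the lowering word acts first, and the raising word joins the linear
  form.\<close>

lemma slice_right:
  "mps_slice \<alpha> (mps_sum (\<lambda>s. in_X (F_skew scale ip v B r s) * in_Y (G_skew scale ip v B t s)))
    = D.Gser (\<lambda>x. ip (Uw \<alpha> x) (v r)) (v t)"
  by (rule mps_eqI)
    (simp only: mps_slice_mps_sum mps_slice_in_X_in_Y mps_coeff_mps_sum mps_coeff_scale F_skew_coeff
      G_skew_eq D.mps_coeff_Gser mult.commute[of "ip (Uw _ _) _"]
      lin_form_expansion[OF lin_form_Uw[OF lin_form_ip]])

lemma skew_cauchy_iff_slices:
  "mps_sum (\<lambda>s. in_X (F_skew scale ip v B s t) * in_Y (G_skew scale ip v B s r)) =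
     cauchy_kernel a * mps_sum (\<lambda>s. in_X (F_skew scale ip v B r s) * in_Y (G_skew scale ip v B t s))
   \<longleftrightarrow> (\<forall>\<alpha>. D.Gser (\<lambda>x. ip x (v r)) (Uw \<alpha> (v t))
     = (\<Sum>p\<in>{p. fst p + snd p = \<alpha>}. H_word (h_angle a) (fst p) * D.Gser (\<lambda>x. ip (Uw (snd p) x) (v r)) (v t)))"
  unfolding mps_eq_slice_iff mps_slice_times slice_left slice_right mps_slice_cauchy_kernel ..

lemma skew_cauchy:
  assumes DU_rel
  shows "mps_sum (\<lambda>s. in_X (F_skew scale ip v B s t) * in_Y (G_skew scale ip v B s r)) =
     cauchy_kernel a * mps_sum (\<lambda>s. in_X (F_skew scale ip v B r s) * in_Y (G_skew scale ip v B t s))"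
  unfolding skew_cauchy_iff_slices using Gser_Uw[OF assms lin_form_ip] by blast

text \<open>One \<open>x\<close>-variable with exponent \<open>l\<close> suffices:
  \<open>mono_cons l 0\<close> reduces the raising word to \<open>U l\<close>, and a single
  \<open>y\<close>-variable then isolates \<open>D k\<close>. Varying \<open>r\<close> yields every
  matrix coefficient.\<close>

lemma DU_if_skew_cauchy:
  assumes "\<And>r t. mps_sum (\<lambda>s. in_X (F_skew scale ip v B s t) * in_Y (G_skew scale ip v B s r)) =
     cauchy_kernel a * mps_sum (\<lambda>s. in_X (F_skew scale ip v B r s) * in_Y (G_skew scale ip v B t s))"
  shows DU_rel
proof (intro DU_relI ip_separates)
  fix k l t r
  have "D.Gser (\<lambda>x. ip x (v r)) (Uw (mono_cons l 0) (v t))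
     = (\<Sum>p\<in>{p. fst p + snd p = mono_cons l 0}. H_word (h_angle a) (fst p) * D.Gser (\<lambda>x. ip (Uw (snd p) x) (v r)) (v t))"
    using assms[of t r] unfolding skew_cauchy_iff_slices by blast
  also have "\<dots> = (\<Sum>i\<le>l. \<Sum>p\<in>{p. fst p + snd p = 0}.
      H_word (h_angle a) (mono_cons i (fst p)) * D.Gser (\<lambda>x. ip (Uw (mono_cons (l - i) (snd p)) x) (v r)) (v t))"
    by (rule sum_splits_mono_cons[where g = "\<lambda>u w. H_word (h_angle a) u * D.Gser (\<lambda>x. ip (Uw w x) (v r)) (v t)"])
  also have "\<dots> = (\<Sum>i\<le>l. H i * D.Gser (\<lambda>x. ip (U (l - i) x) (v r)) (v t))"
    by (simp add: splits_zero H_word_mono_cons h_angle_0 H_word_0 U.Ew_mono_cons U.Ew_0)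
  finally have "D.Gser (\<lambda>x. ip x (v r)) (U l (v t)) = (\<Sum>i\<le>l. H i * D.Gser (\<lambda>x. ip (U (l - i) x) (v r)) (v t))"
    by (simp add: U.Ew_mono_cons U.Ew_0)
  then show "ip (D k (U l (v t))) (v r)
    = ip (\<Sum>n\<le>k. if n \<le> l then scale (h_angle a n) (U (l - n) (D (k - n) (v t))) else 0) (v r)"
    by (rule DU_from_Gser_U[OF lin_form_ip])
qed

text \<open>The case \<open>r = t = b\<close>, where the factor beside the kernel becomes 1:
  nontrivial lowering words kill the vacuum, and nontrivial raising words change its degree because
  \<open>m \<noteq> 0\<close>.\<close>

lemma cauchy:
  assumes DU_rel
  shows "mps_sum (\<lambda>s. in_X (F_skew scale ip v B s b) * in_Y (G_skew scale ip v B s b)) = cauchy_kernel a"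
  unfolding mps_eq_slice_iff slice_left mps_slice_cauchy_kernel
proof
  fix \<alpha>
  have kill: "Dw \<beta> (v b) = (if \<beta> = 0 then v b else 0)" for \<beta>
    by (rule D.Ew_kill) (simp add: B_vacuum)
  have ip0: "ip (Uw \<delta> (v b)) (v b) = (if \<delta> = 0 then 1 else 0)" for \<delta>
  proof (cases "\<delta> = 0")
    case True
    then show ?thesis
      by (simp add: U.Ew_0 ip_basis)
  next
    case False
    have "deg b = deg b + m * int (mdeg \<delta>)" if "ip (Uw \<delta> (v b)) (v b) \<noteq> 0"
      by (rule ip_homogeneous[OF Uw_V[OF v_in_V] that])
    with False m_nonzero show ?thesis
      by auto
  qed
  have "D.Gser (\<lambda>x. ip (Uw \<delta> x) (v b)) (v b) = (if \<delta> = 0 then 1 else 0)" for \<delta>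
    by (rule mps_eqI) (auto simp: kill ip0 mps_coeff_one U.Ew_zero lin_formD(3)[OF lin_form_ip])
  then have "D.Gser form_b (Uw \<alpha> (v b)) = (\<Sum>p\<in>{p. fst p + snd p = \<alpha>}. if p = (\<alpha>, 0) then H_word (h_angle a) \<alpha> else 0)"
    unfolding Gser_Uw[OF assms lin_form_ip] by (intro sum.cong) (auto simp: prod_eq_iff)
  then show "D.Gser form_b (Uw \<alpha> (v b)) = H_word (h_angle a) \<alpha>"
    by (simp add: sum.delta)
qed

lemma heisenberg_iff_G_relations:
  "heisenberg_action scale a B
    \<longleftrightarrow>
    (\<forall>k\<ge>1. \<forall>s.
       h_bracket a k * G_skew scale ip v B s b =
         mps_sum (\<lambda>t. mps_scale (ip (U_op scale B k (v s)) (v t)) (G_skew scale ip v B t b)) \<and>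
       sym_h_perp k (G_skew scale ip v B s b) =
         mps_sum (\<lambda>t. mps_scale (ip (D_op scale B k (v s)) (v t)) (G_skew scale ip v B t b)))"
  unfolding heisenberg_action_iff heisenberg_iff_DU D_op_eq U_op_eq G_skew_eq sym_h_perp_G_b
    Gser_expansion[OF lin_form_ip]
  using h_bracket_G_b DU_if_h_bracket by blast

lemma heisenberg_iff_cauchy:
  "heisenberg_action scale a B
    \<longleftrightarrow>
    mps_sum (\<lambda>s. in_X (F_skew scale ip v B s b) * in_Y (G_skew scale ip v B s b)) =
      cauchy_kernel a \<and>
    (\<forall>r t.
       mps_sum (\<lambda>s. in_X (F_skew scale ip v B s t) * in_Y (G_skew scale ip v B s r)) =
         cauchy_kernel a *
         mps_sum (\<lambda>s. in_X (F_skew scale ip v B r s) * in_Y (G_skew scale ip v B t s)))"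
  unfolding heisenberg_action_iff heisenberg_iff_DU
  using cauchy skew_cauchy DU_if_skew_cauchy by blast

end

theorem theorem10:
  fixes scale :: "'k::field_char_0 \<Rightarrow> 'v::ab_group_add \<Rightarrow> 'v"
    and V :: "int \<Rightarrow> 'v set"
    and deg :: "'s \<Rightarrow> int"
    and v :: "'s \<Rightarrow> 'v"
    and ip :: "'v \<Rightarrow> 'v \<Rightarrow> 'k"
    and m :: int
    and B :: "int \<Rightarrow> 'v \<Rightarrow> 'v"
    and b :: 's
    and a :: "int \<Rightarrow> 'k"
  assumes "graded_vector_space scale V"
    and "graded_components_finite_dim scale V"
    and "homogeneous_basis scale V deg v"
    and "orthonormal_form scale v ip"
    and "m \<noteq> 0"
    and "\<And>k. k \<noteq> 0 \<Longrightarrow> graded_operator scale V (- m * k) (B k)"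
    and "\<And>k l. (k > 0 \<and> l > 0) \<or> (k < 0 \<and> l < 0) \<Longrightarrow> B k \<circ> B l = B l \<circ> B k"
    and "\<And>k. k > 0 \<Longrightarrow> B k (v b) = 0"
    and "\<And>k. k \<noteq> 0 \<Longrightarrow> a k \<noteq> 0"
    and "\<And>k. k \<noteq> 0 \<Longrightarrow> a k = a (- k)"
    and "inj (\<lambda>s. G_skew scale ip v B s b)"
    and "\<not> mps.dependent (range (\<lambda>s. G_skew scale ip v B s b))"
  shows
    "(heisenberg_action scale a B
      \<longleftrightarrow>
      (\<forall>k\<ge>1. \<forall>s.
         h_bracket a k * G_skew scale ip v B s b =
           mps_sum (\<lambda>t. mps_scale (ip (U_op scale B k (v s)) (v t)) (G_skew scale ip v B t b)) \<and>
         sym_h_perp k (G_skew scale ip v B s b) =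
           mps_sum (\<lambda>t. mps_scale (ip (D_op scale B k (v s)) (v t)) (G_skew scale ip v B t b))))
     \<and>
     (heisenberg_action scale a B
      \<longleftrightarrow>
      mps_sum (\<lambda>s. in_X (F_skew scale ip v B s b) * in_Y (G_skew scale ip v B s b)) =
        cauchy_kernel a \<and>
      (\<forall>r t.
         mps_sum (\<lambda>s. in_X (F_skew scale ip v B s t) * in_Y (G_skew scale ip v B s r)) =
           cauchy_kernel a *
           mps_sum (\<lambda>s. in_X (F_skew scale ip v B r s) * in_Y (G_skew scale ip v B t s))))"
proof -
  interpret graded_operators scale V deg v ip m B b a
    using assms(1,3-8,10-12) by unfold_locales
  show ?thesis
    using heisenberg_iff_G_relations heisenberg_iff_cauchy by blast
qed

end
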